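(* Let $n\in\mathbb N$, $s\in(1,\infty)\setminus\mathbb N$ and let $A$ be a Young function. Assume that the embedding $$V^{s,A}_{d,k+1}(\mathbb R^n)\to\mathcal L^{k,\varphi}(\mathbb R^n)$$ holds for some admissible function $\varphi$ and for some $k\in\{0,\dots,[s]-1\}$. Then $s\in(1,n+k+1)$ and $$\int_0\left(\frac t{A(t)}\right)^{\frac{s-(k+1)}{n-(s-(k+1))}}dt<\infty .$$
   Context: A Young function is a convex, left-continuous function $A:[0,\infty)\to[0,\infty]$, non-constant in $(0,\infty)$, with $A(0)=0$. The notation $\int_0(\cdots)\,dt<\infty$ means convergence of the integral on $(0,\delta)$ for some $\delta>0$. For $s\in(0,\infty)\setminus\mathbb N$, $[s]$ and $\{s\}=s-[s]$ denote the integer and fractional parts. For $\sigma\in(0,1)$ and a measurable, possibly vector-valued, $v$ on $\mathbb R^n$, set $$J_{\sigma,A}(v)=\int_{\mathbb R^n}\int_{\mathbb R^n}A\left(\frac{|v(x)-v(y)|}{|x-y|^\sigma}\right)\frac{dx\,dy}{|x-y|^n},\qquad |v|_{\sigma,A,\mathbb R^n}=\inf\{\lambda>0:J_{\sigma,A}(v/\lambda)\le1\},$$ with $|\cdot|$ the Euclidean norm. Define $V^{s,A}(\mathbb R^n)$ as the set of measurable $u:\mathbb R^n\to\mathbb R$ that are $[s]$-times weakly differentiable with $|\nabla^{[s]}u|_{\{s\},A,\mathbb R^n}<\infty$, with seminorm $|\nabla^{[s]}u|_{\{s\},A,\mathbb R^n}$. For $j\in\{0,\dots,[s]\}$, $$V^{s,A}_{d,j}(\mathbb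 R^n)=\{u\in V^{s,A}(\mathbb R^n):\ |\{|\nabla^hu|>t\}|<\infty\ \text{for every } t>0\text{ and } h=j,\dots,[s]\},\qquad\nabla^0u=u.$$ A function $\varphi:(0,\infty)\to(0,\infty)$ is admissible if $\inf_{r\in[a,\infty)}\varphi(r)>0$ for every $a\in(0,\infty)$. For $k\in\mathbb N\cup\{0\}$, the $k$-th order Campanato space $\mathcal L^{k,\varphi}(\mathbb R^n)$ consists of all $u\in W^{k,1}_{\rm loc}(\mathbb R^n)$ (meaning $L^1_{\rm loc}(\mathbb R^n)$ if $k=0$) such that $$|u|_{\mathcal L^{k,\varphi}(\mathbb R^n)}=\sup_B\frac1{\varphi(|B|^{1/n})\,|B|^{k/n}}\,\frac1{|B|}\int_B|u-P^k_B[u]|\,dx<\infty,$$ where the supremum is over all balls $B\subset\mathbb R^n$, $|B|$ is the Lebesgue measure, and $P^k_B[u]$ is the unique polynomial of degree at most $k$ such that $\int_B(\nabla^hu-\nabla^hP^k_B[u])\,dx=0$ for $h=0,\dots,k$ (so $P_B^0[u]$ is the mean of $u$ over $B$). The arrow $\to$ denotes a continuous embedding, i.e. inclusion together with a bound $|u|_{\mathcal L^{k,\varphi}(\mathbb R^n)}\le c\,|\nabla^{[s]}u|_{\{s\},A,\mathbb R^n}$ for some constant $c$. *)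

theory Defs
  imports "HOL-Analysis.Analysis"
begin

text \<open>A Young function lives on the half-line; the values of \<open>A\<close> at negative arguments are
  unconstrained and never used. In \<^typ>\<open>ennreal\<close> we have \<open>0 * \<infinity> = 0\<close>.\<close>

definition young_function :: "(real \<Rightarrow> ennreal) \<Rightarrow> bool" where
  "young_function A \<longleftrightarrow>
     A 0 = 0 \<and>
     (\<forall>x\<ge>0. \<forall>y\<ge>0. \<forall>t\<in>{0..1}. A ((1 - t) * x + t * y) \<le> ennreal (1 - t) * A x + ennreal t * A y) \<and>
     (\<forall>x>0. continuous (at_left x) A) \<and>
     \<not> A constant_on {0<..}"

text \<open>Real powers on \<open>[0,\<infinity>]\<close>, meant for positive exponents.\<close>

definition ennreal_powr :: "ennreal \<Rightarrow> real \<Rightarrow> ennreal" where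
  "ennreal_powr x p = (if x = \<infinity> then \<infinity> else ennreal (enn2real x powr p))"

definition converges_near_0 :: "(real \<Rightarrow> ennreal) \<Rightarrow> bool" where
  "converges_near_0 f \<longleftrightarrow> (\<exists>\<delta>>0. (\<integral>\<^sup>+t\<in>{0<..<\<delta>}. f t \<partial>lborel) < \<infinity>)"

text \<open>Partial derivatives of order \<open>h\<close> are indexed by words \<open>w\<close> of length \<open>h\<close> over the
  coordinate index type, so \<open>\<nabla>\<^sup>h u\<close> is the full tensor \<open>(D\<^sub>w u)\<close>, \<open>length w = h\<close>, carrying the
  Euclidean norm of its components.\<close>

primrec partials :: "'n::finite list \<Rightarrow> (real^'n \<Rightarrow> real) \<Rightarrow> real^'n \<Rightarrow> real" where
  "partials [] f = f"
| "partials (i # w) f = (\<lambda>x. frechet_derivative (partials w f) (at x) (axis i 1))"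

definition test_function :: "(real^'n::finite \<Rightarrow> real) \<Rightarrow> bool" where
  "test_function \<psi> \<longleftrightarrow>
     (\<forall>w. partials w \<psi> differentiable_on UNIV) \<and> compact (closure {x. \<psi> x \<noteq> 0})"

definition locally_integrable :: "(real^'n::finite \<Rightarrow> real) \<Rightarrow> bool" where
  "locally_integrable u \<longleftrightarrow> (\<forall>K. compact K \<longrightarrow> u absolutely_integrable_on K)"

definition has_weak_deriv ::
  "(real^'n::finite \<Rightarrow> real) \<Rightarrow> 'n list \<Rightarrow> (real^'n \<Rightarrow> real) \<Rightarrow> bool" where
  "has_weak_deriv u w g \<longleftrightarrow> locally_integrable g \<and>
     (\<forall>\<psi>. test_function \<psi> \<longrightarrow>
        (\<integral>x. u x * partials w \<psi> x \<partial>lebesgue) = (-1) ^ length w * (\<integral>x. g x * \<psi> x \<partial>lebesgue))"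

text \<open>Equivalently \<open>u\<close> is in the local Sobolev space of order \<open>m\<close> and exponent 1,
  which for \<open>m = 0\<close> is the space of locally integrable functions.\<close>

definition weakly_differentiable :: "nat \<Rightarrow> (real^'n::finite \<Rightarrow> real) \<Rightarrow> bool" where
  "weakly_differentiable m u \<longleftrightarrow>
     locally_integrable u \<and> (\<forall>w. length w \<le> m \<longrightarrow> (\<exists>g. has_weak_deriv u w g))"

text \<open>A representative of the weak derivative, unique up to null sets.\<close>

definition weak_deriv :: "'n::finite list \<Rightarrow> (real^'n \<Rightarrow> real) \<Rightarrow> real^'n \<Rightarrow> real" where
  "weak_deriv w u = (if w = [] then u else (SOME g. has_weak_deriv u w g))"

text \<open>A vector-valued function on \<open>\<real>\<^sup>n\<close> is given by its components \<open>v i\<close>, \<open>i \<in> I\<close>, with \<open>I\<close> finite;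
  \<^const>\<open>L2_set\<close> is the Euclidean norm.\<close>

definition J :: "real \<Rightarrow> (real \<Rightarrow> ennreal) \<Rightarrow> 'i set \<Rightarrow> ('i \<Rightarrow> real^'n::finite \<Rightarrow> real) \<Rightarrow> ennreal" where
  "J \<sigma> A I v =
     (\<integral>\<^sup>+x. \<integral>\<^sup>+y. A (L2_set (\<lambda>i. v i x - v i y) I / dist x y powr \<sigma>)
                  / ennreal (dist x y ^ CARD('n)) \<partial>lebesgue \<partial>lebesgue)"

text \<open>The infimum of the empty set is \<open>\<infinity>\<close>.\<close>

definition luxemburg_seminorm ::
  "real \<Rightarrow> (real \<Rightarrow> ennreal) \<Rightarrow> 'i set \<Rightarrow> ('i \<Rightarrow> real^'n::finite \<Rightarrow> real) \<Rightarrow> ennreal" where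
  "luxemburg_seminorm \<sigma> A I v =
     Inf (ennreal ` {l. l > 0 \<and> J \<sigma> A I (\<lambda>i x. v i x / l) \<le> 1})"

definition V_seminorm :: "real \<Rightarrow> (real \<Rightarrow> ennreal) \<Rightarrow> (real^'n::finite \<Rightarrow> real) \<Rightarrow> ennreal" where
  "V_seminorm s A u =
     luxemburg_seminorm (frac s) A {w. length w = nat \<lfloor>s\<rfloor>} (\<lambda>w. weak_deriv w u)"

definition V :: "real \<Rightarrow> (real \<Rightarrow> ennreal) \<Rightarrow> (real^'n::finite \<Rightarrow> real) set" where
  "V s A = {u. u \<in> borel_measurable lebesgue \<and> weakly_differentiable (nat \<lfloor>s\<rfloor>) u \<and>
               V_seminorm s A u < \<infinity>}"

definition V_d :: "nat \<Rightarrow> real \<Rightarrow> (real \<Rightarrow> ennreal) \<Rightarrow> (real^'n::finite \<Rightarrow> real) set" where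
  "V_d j s A = {u \<in> V s A. \<forall>t>0. \<forall>h\<in>{j..nat \<lfloor>s\<rfloor>}.
     emeasure lebesgue {x. L2_set (\<lambda>w. weak_deriv w u x) {w. length w = h} > t} < \<infinity>}"

definition admissible :: "(real \<Rightarrow> real) \<Rightarrow> bool" where
  "admissible \<phi> \<longleftrightarrow> (\<forall>r>0. \<phi> r > 0) \<and> (\<forall>a>0. (INF r\<in>{a..}. \<phi> r) > 0)"

text \<open>The coefficients are indexed by multi-indices \<open>\<alpha>\<close> with \<open>|\<alpha>| \<le> k\<close>.\<close>

definition polynomial_deg_le :: "nat \<Rightarrow> (real^'n::finite \<Rightarrow> real) \<Rightarrow> bool" where
  "polynomial_deg_le k P \<longleftrightarrow>
     (\<exists>c. P = (\<lambda>x. \<Sum>\<alpha> | sum \<alpha> UNIV \<le> k. c \<alpha> * (\<Prod>i\<in>UNIV. x $ i ^ \<alpha> i)))"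

definition campanato_poly ::
  "nat \<Rightarrow> (real^'n) set \<Rightarrow> (real^'n::finite \<Rightarrow> real) \<Rightarrow> real^'n \<Rightarrow> real" where
  "campanato_poly k B u = (THE P. polynomial_deg_le k P \<and>
     (\<forall>w. length w \<le> k \<longrightarrow> (LINT x:B|lebesgue. weak_deriv w u x - partials w P x) = 0))"

definition campanato_seminorm ::
  "nat \<Rightarrow> (real \<Rightarrow> real) \<Rightarrow> (real^'n::finite \<Rightarrow> real) \<Rightarrow> ennreal" where
  "campanato_seminorm k \<phi> u =
     (SUP B \<in> {ball a r |a r. r > 0}.
        let m = measure lebesgue B; n = real CARD('n) in
        ennreal (1 / (\<phi> (m powr (1 / n)) * m powr (real k / n))) * ennreal (1 / m) *
        (\<integral>\<^sup>+x\<in>B. ennreal \<bar>u x - campanato_poly k B u x\<bar> \<partial>lebesgue))"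

definition campanato :: "nat \<Rightarrow> (real \<Rightarrow> real) \<Rightarrow> (real^'n::finite \<Rightarrow> real) set" where
  "campanato k \<phi> = {u. weakly_differentiable k u \<and> campanato_seminorm k \<phi> u < \<infinity>}"

definition continuous_embedding ::
  "'a set \<Rightarrow> ('a \<Rightarrow> ennreal) \<Rightarrow> 'a set \<Rightarrow> ('a \<Rightarrow> ennreal) \<Rightarrow> bool" where
  "continuous_embedding X p Y q \<longleftrightarrow> X \<subseteq> Y \<and> (\<exists>c::real. \<forall>u\<in>X. q u \<le> ennreal c * p u)"

end

theory Submission
  imports Defs "HOL-Computational_Algebra.Polynomial"
begin

text \<open>
Write \<open>\<beta> = s - (k + 1)\<close> and let \<open>\<psi>\<close> be a smooth compactly supported function equal to \<open>x\<^sub>i ^ (k + 1)\<close>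
on the unit ball. The superposition \<open>u x = \<Sum>l. a\<^sub>l * 2 ^ (l * (k + 1)) * \<psi> (x / 2 ^ l)\<close> equals
\<open>(\<Sum>l. a\<^sub>l) * x\<^sub>i ^ (k + 1)\<close> on the unit ball, so its Campanato seminorm is at least a constant times
\<open>\<Sum>l. a\<^sub>l\<close>. Each term contributes to the difference quotient of the top-order derivatives an amount
\<open>a\<^sub>l * 2 powr (- l * \<beta>)\<close> times a quantity which is summable over \<open>l\<close>, uniformly in the two points; Jensen's
inequality therefore bounds the modular of \<open>u\<close> by a multiple of
\<open>\<Sum>l. 2 ^ (l * n) * A (C * a\<^sub>l * 2 powr (- l * \<beta>))\<close>. If \<open>\<beta> > n\<close>, or if \<open>\<beta> < n\<close> and the integral
diverges, the \<open>a\<^sub>l\<close> can be chosen so that the latter sum is at most 1 while \<open>\<Sum>l. a\<^sub>l\<close> is arbitrarily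
large, which contradicts the embedding. The case \<open>\<beta> = n\<close> does not occur since \<open>s\<close> is not an integer.
\<close>

section \<open>Smooth functions of one variable\<close>

text \<open>The factor \<open>2 ^ (l * (k + 1))\<close> comes from homogeneity: every dilated
  profile becomes the same monomial on the unit ball, so the amplitudes add up without cancellation,
  and no polynomial of degree at most k can absorb a monomial of degree k + 1. With
  \<open>b l = a l * 2 powr (- l * \<beta>)\<close> an extremal problem remains: how large can
  \<open>\<Sum>l. 2 powr (l * \<beta>) * b l\<close> (the gain) be if
  \<open>\<Sum>l. 2 ^ (l * n) * A (b l)\<close> (the cost) is at most 1? For
  \<open>\<beta> > n\<close> a single large scale suffices, as a Young function grows at most
  linearly near 0. For \<open>\<beta> < n\<close> each \<open>b l\<close> is taken as large as keeps
  \<open>A t / t\<close> below a multiple of \<open>2 powr (- l * (n - \<beta>))\<close>. Since A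
  need not be doubling and may take the value \<infinity>, a constant cannot be pulled out of its
  argument; constants are absorbed in advance by shrinking the amplitudes, which convexity turns
  into a smaller cost. All functions used are test functions, yet \<open>weak_deriv\<close> is an
  arbitrary representative, so classical and weak derivatives have to be matched almost everywhere
  through the fundamental lemma of the calculus of variations.\<close>

coinductive smooth_real :: "(real \<Rightarrow> real) \<Rightarrow> bool" where
  smooth_realI: "(\<And>t. (f has_real_derivative f' t) (at t)) \<Longrightarrow> smooth_real f' \<Longrightarrow> smooth_real f"

text \<open>Smoothness is coinductive so that it can be proved by naming a class of functions closed
  under differentiation; no formula for higher derivatives has to be written down. Products,
  polynomials and flat exponentials are treated in this way.\<close>

lemma smooth_real_coinduct:
  assumes "X f"
    and "\<And>f. X f \<Longrightarrow> \<exists>f'. (\<forall>t. (f has_real_derivative f' t) (at t)) \<and> X f'"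
  shows "smooth_real f"
proof (rule smooth_real.coinduct[of X, OF assms(1)])
  fix h assume "X h"
  then show "\<exists>f f'. h = f \<and> (\<forall>t. (f has_real_derivative f' t) (at t)) \<and> (X f' \<or> smooth_real f')"
    using assms(2)[of h] by auto
qed

lemma smooth_realE:
  assumes "smooth_real f"
  obtains f' where "\<And>t. (f has_real_derivative f' t) (at t)" "smooth_real f'"
  using assms by (rule smooth_real.cases) blast

lemma smooth_real_continuous: "smooth_real f \<Longrightarrow> continuous_on S f"
  by (meson smooth_realE DERIV_continuous_on has_field_derivative_at_within)

lemma smooth_real_affine:
  assumes "smooth_real f"
  shows "smooth_real (\<lambda>t. c * f (a * t + b))"
proof -
  define X where "X h \<longleftrightarrow> (\<exists>f c. smooth_real f \<and> h = (\<lambda>t. c * f (a * t + b)))" for h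
  have "X (\<lambda>t. c * f (a * t + b))" using assms X_def by blast
  then show ?thesis
  proof (rule smooth_real_coinduct[of X])
    fix h assume "X h"
    then obtain f c where f: "smooth_real f" and h: "h = (\<lambda>t. c * f (a * t + b))"
      unfolding X_def by blast
    obtain f' where f': "\<And>t. (f has_real_derivative f' t) (at t)" "smooth_real f'"
      using f by (rule smooth_realE) blast
    have "(h has_real_derivative (c * a) * f' (a * t + b)) (at t)" for t
      unfolding h
      by (rule derivative_eq_intros DERIV_chain2[where f=f, OF f'(1)] refl | simp)+
    moreover have "X (\<lambda>t. (c * a) * f' (a * t + b))" using f'(2) X_def by blast
    ultimately show "\<exists>h'. (\<forall>t. (h has_real_derivative h' t) (at t)) \<and> X h'"
      by (intro exI[of _ "\<lambda>t. (c * a) * f' (a * t + b)"]) simp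
  qed
qed

text \<open>Products of smooth functions are not visibly closed under differentiation, but by the
  Leibniz rule finite sums of them are. This class is the invariant for the coinduction in
  \<open>smooth_real_mult\<close>.\<close>

inductive smooth_product_sum :: "(real \<Rightarrow> real) \<Rightarrow> bool" where
  prod: "smooth_real f \<Longrightarrow> smooth_real g \<Longrightarrow> smooth_product_sum (\<lambda>t. f t * g t)"
| sum: "smooth_product_sum f \<Longrightarrow> smooth_product_sum g \<Longrightarrow> smooth_product_sum (\<lambda>t. f t + g t)"

lemma smooth_product_sum_deriv:
  assumes "smooth_product_sum h"
  shows "\<exists>h'. (\<forall>t. (h has_real_derivative h' t) (at t)) \<and> smooth_product_sum h'"
  using assms
proof induction
  case (prod f g)
  obtain f' where f': "\<And>t. (f has_real_derivative f' t) (at t)" "smooth_real f'"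
    using prod(1) by (rule smooth_realE) blast
  obtain g' where g': "\<And>t. (g has_real_derivative g' t) (at t)" "smooth_real g'"
    using prod(2) by (rule smooth_realE) blast
  have "((\<lambda>t. f t * g t) has_real_derivative f' t * g t + g' t * f t) (at t)" for t
    by (rule DERIV_mult f' g')+
  moreover have "smooth_product_sum (\<lambda>t. f' t * g t + g' t * f t)"
    using prod f' g' by (intro smooth_product_sum.intros)
  ultimately show ?case by (intro exI[of _ "\<lambda>t. f' t * g t + g' t * f t"]) simp
next
  case (sum f g)
  then obtain f' g' where "\<And>t. (f has_real_derivative f' t) (at t)" "smooth_product_sum f'"
    "\<And>t. (g has_real_derivative g' t) (at t)" "smooth_product_sum g'" by blast
  then show ?case
    by (intro exI[of _ "\<lambda>t. f' t + g' t"]) (simp add: DERIV_add smooth_product_sum.sum)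
qed

lemma smooth_real_mult:
  assumes "smooth_real f" "smooth_real g"
  shows "smooth_real (\<lambda>t. f t * g t)"
proof -
  have "smooth_product_sum (\<lambda>t. f t * g t)" using assms by (rule smooth_product_sum.prod)
  then show ?thesis by (rule smooth_real_coinduct[of smooth_product_sum, OF _ smooth_product_sum_deriv])
qed

lemma smooth_real_poly: "smooth_real (poly p)"
proof -
  show ?thesis
  proof (rule smooth_real_coinduct[of "\<lambda>h. h \<in> range poly"])
    fix h :: "real \<Rightarrow> real" assume "h \<in> range poly"
    then obtain q where "h = poly q" by blast
    then show "\<exists>h'. (\<forall>t. (h has_real_derivative h' t) (at t)) \<and> h' \<in> range poly"
      by (intro exI[of _ "poly (pderiv q)"]) (simp add: poly_DERIV)
  qed simp
qed

lemma smooth_real_power: "smooth_real (\<lambda>t. t ^ j)"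
proof -
  have "poly (monom 1 j) = (\<lambda>t::real. t ^ j)" by (auto simp: poly_monom)
  then show ?thesis using smooth_real_poly[of "monom 1 j"] by simp
qed

text \<open>The classical flat function \<open>exp (- c / t)\<close>, multiplied by a polynomial in
  \<open>1 / t\<close> so that all derivatives stay in the family. The parameter c is kept free
  because, for \<open>p = 1\<close>, letting it tend to 0 produces the indicator of the positive
  half-line.\<close>

definition flat_exp :: "real \<Rightarrow> real poly \<Rightarrow> real \<Rightarrow> real" where
  "flat_exp c p t = (if t > 0 then poly p (1 / t) * exp (- c / t) else 0)"

lemma poly_times_exp_tendsto_0:
  assumes "c > 0"
  shows "((\<lambda>x::real. poly p x * exp (- c * x)) \<longlongrightarrow> 0) at_top"
proof -
  have *: "((\<lambda>x::real. x ^ j * exp (- c * x)) \<longlongrightarrow> 0) at_top" for j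
  proof -
    have "((\<lambda>x. x ^ j / exp x) \<longlongrightarrow> (0::real)) at_top" by (rule tendsto_power_div_exp_0)
    then have "((\<lambda>x. (c * x) ^ j / exp (c * x)) \<longlongrightarrow> 0) at_top"
      by (rule filterlim_compose)
        (use assms in \<open>intro filterlim_tendsto_pos_mult_at_top[OF tendsto_const] filterlim_ident\<close>)
    then have "((\<lambda>x. (c * x) ^ j / exp (c * x) * (1 / c ^ j)) \<longlongrightarrow> 0 * (1 / c ^ j)) at_top"
      by (intro tendsto_mult tendsto_const)
    moreover have "(c * x) ^ j / exp (c * x) * (1 / c ^ j) = x ^ j * exp (- c * x)" for x
      using assms by (simp add: power_mult_distrib exp_minus field_simps)
    ultimately show ?thesis by simp
  qed
  have "((\<lambda>x. \<Sum>j\<le>degree p. coeff p j * (x ^ j * exp (- c * x))) \<longlongrightarrow> (\<Sum>j\<le>degree p. coeff p j * 0)) at_top"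
    by (intro tendsto_sum tendsto_mult tendsto_const *)
  then show ?thesis by (simp add: poly_altdef sum_distrib_right mult.assoc)
qed

lemma flat_exp_deriv:
  assumes "c > 0"
  shows "(flat_exp c p has_real_derivative flat_exp c ([:0, 0, 1:] * (smult c p - pderiv p)) t) (at t)"
    (is "(_ has_real_derivative flat_exp c ?q t) _")
proof -
  consider "t > 0" | "t < 0" | "t = 0" by linarith
  then show ?thesis
  proof cases
    case 1
    have inv: "((\<lambda>t. a / t) has_real_derivative - a / t\<^sup>2) (at t)" for a
      using 1 by (auto intro!: derivative_eq_intros simp: power2_eq_square)
    have "((\<lambda>t. poly p (1 / t) * exp (- c / t)) has_real_derivative
        poly (pderiv p) (1 / t) * (- 1 / t\<^sup>2) * exp (- c / t)
        + exp (- c / t) * (- (- c) / t\<^sup>2) * poly p (1 / t)) (at t)"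
      by (intro DERIV_mult DERIV_chain2[OF poly_DERIV inv] DERIV_chain2[OF DERIV_exp inv])
    moreover have "poly (pderiv p) (1 / t) * (- 1 / t\<^sup>2) * exp (- c / t)
        + exp (- c / t) * (- (- c) / t\<^sup>2) * poly p (1 / t) = poly ?q (1 / t) * exp (- c / t)"
      using 1 by (simp add: field_simps power2_eq_square)
    ultimately have "((\<lambda>t. poly p (1 / t) * exp (- c / t)) has_real_derivative
        poly ?q (1 / t) * exp (- c / t)) (at t)" by simp
    moreover have "\<forall>\<^sub>F s in nhds t. flat_exp c p s = poly p (1 / s) * exp (- c / s)"
      using eventually_nhds_in_open[of "{0<..}" t] 1
      by (auto elim!: eventually_mono simp: flat_exp_def)
    ultimately show ?thesis
      using 1 by (subst DERIV_cong_ev[OF refl]) (auto simp: flat_exp_def)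
  next
    case 2
    have "\<forall>\<^sub>F s in nhds t. flat_exp c p s = 0"
      using eventually_nhds_in_open[of "{..<0}" t] 2
      by (auto elim!: eventually_mono simp: flat_exp_def)
    then show ?thesis
      using 2 by (subst DERIV_cong_ev[OF refl]) (auto simp: flat_exp_def)
  next
    case 3
    have l: "((\<lambda>h. flat_exp c p h / h) \<longlongrightarrow> 0) (at_left 0)"
      by (rule tendsto_eventually, rule eventually_mono[OF eventually_at_left_real[of "-1" 0]])
        (auto simp: flat_exp_def)
    \<comment> \<open>At the origin the right difference quotient is
      \<open>x * poly p x * exp (- c * x)\<close> with \<open>x = 1 / h\<close>, and the exponential
      beats every polynomial at infinity.\<close>
    have "((\<lambda>h::real. poly ([:0,1:] * p) (inverse h) * exp (- c * inverse h)) \<longlongrightarrow> 0) (at_right 0)"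
      by (rule filterlim_compose[OF poly_times_exp_tendsto_0[OF assms] filterlim_inverse_at_top_right])
    then have r: "((\<lambda>h. flat_exp c p h / h) \<longlongrightarrow> 0) (at_right 0)"
      by (rule Lim_transform_eventually)
        (rule eventually_mono[OF eventually_at_right_real[of 0 1]],
          auto simp: flat_exp_def field_simps)
    have "((\<lambda>h. flat_exp c p h / h) \<longlongrightarrow> 0) (at 0)"
      using l r by (rule filterlim_split_at)
    then show ?thesis unfolding DERIV_def using 3 by (simp add: flat_exp_def)
  qed
qed

lemma smooth_real_flat_exp:
  assumes "c > 0" shows "smooth_real (flat_exp c p)"
proof -
  show ?thesis
  proof (rule smooth_real_coinduct[of "\<lambda>h. h \<in> range (flat_exp c)"])
    fix h :: "real \<Rightarrow> real" assume "h \<in> range (flat_exp c)"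
    then obtain q where "h = flat_exp c q" by blast
    then show "\<exists>h'. (\<forall>t. (h has_real_derivative h' t) (at t)) \<and> h' \<in> range (flat_exp c)"
      by (intro exI[of _ "flat_exp c ([:0, 0, 1:] * (smult c q - pderiv q))"])
        (simp add: flat_exp_deriv[OF assms] del: mult_pCons_left)
  qed simp
qed

definition bump :: "real \<Rightarrow> real \<Rightarrow> real \<Rightarrow> real \<Rightarrow> real" where
  "bump c a b t = flat_exp c 1 (t - a) * flat_exp c 1 (b - t)"

lemma smooth_real_bump:
  assumes "c > 0" shows "smooth_real (bump c a b)"
  using smooth_real_mult[OF smooth_real_affine[OF smooth_real_flat_exp[OF assms], of 1 1 1 "- a"]
      smooth_real_affine[OF smooth_real_flat_exp[OF assms], of 1 1 "-1" b]]
  by (simp add: bump_def[abs_def])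

lemma bump_range: "c > 0 \<Longrightarrow> bump c a b t \<in> {0..1}"
  by (auto simp: bump_def flat_exp_def intro!: mult_le_one)

lemma bump_pos_iff: "c > 0 \<Longrightarrow> bump c a b t > 0 \<longleftrightarrow> t \<in> {a<..<b}"
  by (auto simp: bump_def flat_exp_def)

lemma bump_eq_0: "t \<notin> {a<..<b} \<Longrightarrow> bump c a b t = 0"
  by (auto simp: bump_def flat_exp_def)

text \<open>For u > 0 the factor \<open>exp (- c / u)\<close> tends to 1 as c tends to 0. Products
  of such bumps over the coordinates are the test functions that approximate the indicator of a box
  in \<open>fundamental_lemma_variations\<close>.\<close>

lemma bump_tendsto_indicator:
  "(\<lambda>j. bump (1 / real (Suc j)) a b t) \<longlonglongrightarrow> indicator {a<..<b} t"
proof -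
  have *: "(\<lambda>j. flat_exp (1 / real (Suc j)) 1 u) \<longlonglongrightarrow> indicator {0<..} u" for u
  proof (cases "u > 0")
    case True
    have "(\<lambda>j. exp (- (1 / real (Suc j)) / u)) \<longlonglongrightarrow> exp (- 0 / u)"
      using lim_1_over_n[where 'a=real, THEN LIMSEQ_Suc] True by (intro tendsto_intros) auto
    with True show ?thesis by (simp add: flat_exp_def)
  qed (auto simp: flat_exp_def)
  have "(\<lambda>j. bump (1 / real (Suc j)) a b t) \<longlonglongrightarrow>
      indicator {0<..} (t - a) * indicator {0<..} (b - t)"
    unfolding bump_def by (intro tendsto_mult *)
  also have "indicator {0<..} (t - a) * indicator {0<..} (b - t) = (indicator {a<..<b} t :: real)"
    by (auto simp: indicator_def)
  finally show ?thesis .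
qed

text \<open>An antiderivative of a bump on (1, 2) is constant on either side of that interval.
  Normalised, it descends from 1 to 0, and multiplication with its mirror image makes it a cutoff in
  |t|.\<close>

lemma smooth_cutoff_exists:
  obtains \<eta> where "smooth_real \<eta>" "\<And>t. \<bar>t\<bar> \<le> 1 \<Longrightarrow> \<eta> t = 1" "\<And>t. \<bar>t\<bar> \<ge> 2 \<Longrightarrow> \<eta> t = 0"
proof -
  let ?B = "bump 1 1 2"
  have smB: "smooth_real ?B" by (rule smooth_real_bump) simp
  have "\<exists>F. \<forall>x :: real. - \<infinity> < ereal x \<longrightarrow> ereal x < \<infinity> \<longrightarrow> (F has_vector_derivative ?B x) (at x)"
    by (rule einterval_antiderivative)
      (use smooth_real_continuous[OF smB, of UNIV] in \<open>auto simp: continuous_on_eq_continuous_at\<close>)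
  then obtain F where F: "\<And>x. (F has_real_derivative ?B x) (at x)"
    by (auto simp: has_real_derivative_iff_has_vector_derivative)
  have lo: "F t = F 1" if "t \<le> 1" for t
  proof (cases "t < 1")
    case True
    then show ?thesis
      using MVT2[OF True F] by (auto simp: bump_eq_0)
  qed (use that in simp)
  have hi: "F t = F 2" if "t \<ge> 2" for t
  proof (cases "t > 2")
    case True
    then show ?thesis
      using MVT2[OF True F] by (auto simp: bump_eq_0)
  qed (use that in simp)
  obtain z where z: "1 < z" "z < 2" "F 2 - F 1 = (2 - 1) * ?B z"
    using MVT2[of 1 2 F ?B] F by auto
  then have pos: "F 2 - F 1 > 0" using bump_pos_iff[of 1 1 2 z] by auto
  have smF: "smooth_real F" by (rule smooth_realI[OF F smB])
  define e where "e t = (F 2 - F t) / (F 2 - F 1)" for t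
  have "(e has_real_derivative (-1 / (F 2 - F 1)) * ?B (1 * t + 0)) (at t)" for t
    unfolding e_def by (rule derivative_eq_intros F refl | (use pos in simp))+
  then have sme: "smooth_real e" using smooth_real_affine[OF smB] by (rule smooth_realI)
  show ?thesis
  proof
    show "smooth_real (\<lambda>t. e t * e (- t))"
      using smooth_real_mult[OF sme smooth_real_affine[OF sme, of 1 "-1" 0]] by simp
    show "e t * e (- t) = 1" if "\<bar>t\<bar> \<le> 1" for t
      using that lo[of t] lo[of "-t"] pos by (simp add: e_def)
    show "e t * e (- t) = 0" if "\<bar>t\<bar> \<ge> 2" for t
      using that hi[of t] hi[of "-t"] by (cases "t \<ge> 0") (auto simp: e_def)
  qed
qed

section \<open>Iterated partial derivatives and weak derivatives\<close>

definition smooth_fun :: "(real^'n::finite \<Rightarrow> real) \<Rightarrow> bool" where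
  "smooth_fun f \<longleftrightarrow> (\<forall>w. partials w f differentiable_on UNIV)"

section \<open>Rules for iterated partial derivatives\<close>

lemma partials_append: "partials (v @ w) f = partials v (partials w f)"
  by (induction v) auto

lemma partials_snoc: "partials (w @ [i]) f = partials w (partials [i] f)"
  by (rule partials_append)

lemma smooth_fun_partials: "smooth_fun f \<Longrightarrow> smooth_fun (partials w f)"
  by (simp add: smooth_fun_def flip: partials_append)

lemma smooth_fun_has_derivative:
  "smooth_fun f \<Longrightarrow> (partials w f has_derivative frechet_derivative (partials w f) (at x)) (at x)"
  by (simp add: smooth_fun_def differentiable_on_def frechet_derivative_works)

lemma smooth_fun_continuous: "smooth_fun f \<Longrightarrow> continuous_on S (partials w f)"
  unfolding smooth_fun_def
  by (meson continuous_on_subset differentiable_imp_continuous_on subset_UNIV)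

lemma smooth_fun_borel: "smooth_fun f \<Longrightarrow> partials w f \<in> borel_measurable borel"
  by (intro borel_measurable_continuous_onI smooth_fun_continuous)

lemma smooth_fun_coinduct:
  assumes "X f"
    and "\<And>f. X f \<Longrightarrow> f differentiable_on UNIV \<and> (\<forall>i. X (partials [i] f))"
  shows "smooth_fun f"
proof -
  have "X (partials w f)" for w
    using assms by (induction w) auto
  then show ?thesis using assms(2) by (auto simp: smooth_fun_def)
qed

lemma partial_eqI:
  "(f has_derivative f') (at x) \<Longrightarrow> partials [i] f x = f' (axis i 1)"
  by (simp add: frechet_derivative_at[symmetric])

lemma frechet_derivative_cong_open:
  assumes "open S" "x \<in> S" "\<And>y. y \<in> S \<Longrightarrow> f y = g y"
  shows "frechet_derivative f (at x) = frechet_derivative g (at x)"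
proof -
  have "(f has_derivative f') (at x) \<longleftrightarrow> (g has_derivative f') (at x)" for f'
    using assms has_derivative_transform_within_open[of f f' x UNIV S g]
      has_derivative_transform_within_open[of g f' x UNIV S f] by auto
  then show ?thesis by (simp add: frechet_derivative_def)
qed

lemma partials_cong_open:
  assumes "open S" "x \<in> S" "\<And>y. y \<in> S \<Longrightarrow> f y = g y"
  shows "partials w f x = partials w g x"
  using assms(2)
proof (induction w arbitrary: x)
  case (Cons i w)
  then show ?case
    using frechet_derivative_cong_open[OF assms(1) Cons.prems, of "partials w f" "partials w g"] by simp
qed (use assms in simp)

lemma partials_zero [simp]: "partials w (\<lambda>x. 0) = (\<lambda>x. 0)"
  by (induction w) auto

lemma partials_eq_0:
  assumes "\<And>y. norm y > R \<Longrightarrow> f y = 0" "norm x > R"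
  shows "partials w f x = 0"
  using partials_cong_open[of "{y. norm y > R}" x f "\<lambda>x. 0" w] assms
  by (simp add: open_Collect_less continuous_on_norm_id)

lemma smooth_fun_linear_combination:
  assumes "finite I" "\<And>l. l \<in> I \<Longrightarrow> smooth_fun (f l)"
  shows "partials w (\<lambda>x. \<Sum>l\<in>I. c l * f l x) = (\<lambda>x. \<Sum>l\<in>I. c l * partials w (f l) x)"
    and "smooth_fun (\<lambda>x. \<Sum>l\<in>I. c l * f l x)"
proof -
  have der: "((\<lambda>x. \<Sum>l\<in>I. c l * partials w (f l) x) has_derivative
      (\<lambda>h. \<Sum>l\<in>I. c l * frechet_derivative (partials w (f l)) (at x) h)) (at x)" for w x
    using assms smooth_fun_has_derivative by (intro has_derivative_sum has_derivative_mult_right) auto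
  show *: "partials w (\<lambda>x. \<Sum>l\<in>I. c l * f l x) = (\<lambda>x. \<Sum>l\<in>I. c l * partials w (f l) x)" for w
  proof (induction w)
    case (Cons i w)
    show ?case unfolding partials.simps(2) Cons
      by (subst frechet_derivative_at[OF der, symmetric]) simp
  qed simp
  show "smooth_fun (\<lambda>x. \<Sum>l\<in>I. c l * f l x)"
    unfolding smooth_fun_def * differentiable_on_def differentiable_def using der by blast
qed

lemma smooth_fun_scale:
  assumes "smooth_fun f"
  shows "partials w (\<lambda>x. f (r *\<^sub>R x)) = (\<lambda>x. r ^ length w * partials w f (r *\<^sub>R x))"
    and "smooth_fun (\<lambda>x. f (r *\<^sub>R x))"
proof -
  have der: "((\<lambda>x. r ^ length w * partials w f (r *\<^sub>R x)) has_derivative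
      (\<lambda>h. r ^ length w * frechet_derivative (partials w f) (at (r *\<^sub>R x)) (r *\<^sub>R h))) (at x)" for w x
    by (intro has_derivative_mult_right has_derivative_compose[OF _ smooth_fun_has_derivative[OF assms]]
        has_derivative_scaleR_right has_derivative_ident)
  have lin: "linear (frechet_derivative (partials w f) (at x))" for w x
    using smooth_fun_has_derivative[OF assms] by (rule has_derivative_linear)
  show *: "partials w (\<lambda>x. f (r *\<^sub>R x)) = (\<lambda>x. r ^ length w * partials w f (r *\<^sub>R x))" for w
  proof (induction w)
    case (Cons i w)
    show ?case unfolding partials.simps(2) Cons
      by (subst frechet_derivative_at[OF der, symmetric]) (simp add: linear_scale[OF lin] mult_ac)
  qed simp
  show "smooth_fun (\<lambda>x. f (r *\<^sub>R x))"
    unfolding smooth_fun_def * differentiable_on_def differentiable_def using der by blast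
qed

text \<open>Differentiating a tensor product of functions of one variable replaces one factor by its
  derivative. Tensor products of smooth functions are thus closed under partial derivatives, which
  yields \<open>smooth_fun_product\<close> by coinduction.\<close>

lemma partial_product:
  assumes "\<And>i t. (f i has_real_derivative f' i t) (at t)"
  shows "(\<lambda>x::real^'n::finite. \<Prod>i\<in>UNIV. f i (x $ i)) differentiable_on UNIV"
    and "partials [j] (\<lambda>x::real^'n::finite. \<Prod>i\<in>UNIV. f i (x $ i)) =
      (\<lambda>x. \<Prod>i\<in>UNIV. (if i = j then f' i else f i) (x $ i))"
proof -
  have "((\<lambda>x::real^'n. f i (x $ i)) has_derivative (\<lambda>h. f' i (x $ i) * (h $ i))) (at x)" for i x
    by (rule has_derivative_compose[of "\<lambda>x. x $ i" "\<lambda>h. h $ i" x UNIV "f i"])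
      (use assms[of i] in \<open>auto simp: has_field_derivative_def intro: bounded_linear_imp_has_derivative
        bounded_linear_vec_nth\<close>)
  then have der: "((\<lambda>x::real^'n. \<Prod>i\<in>UNIV. f i (x $ i)) has_derivative
      (\<lambda>h. \<Sum>i\<in>UNIV. f' i (x $ i) * (h $ i) * (\<Prod>j\<in>UNIV - {i}. f j (x $ j)))) (at x)" for x
    by (intro has_derivative_prod) auto
  then show "(\<lambda>x::real^'n. \<Prod>i\<in>UNIV. f i (x $ i)) differentiable_on UNIV"
    unfolding differentiable_on_def differentiable_def by blast
  show "partials [j] (\<lambda>x::real^'n. \<Prod>i\<in>UNIV. f i (x $ i)) =
      (\<lambda>x. \<Prod>i\<in>UNIV. (if i = j then f' i else f i) (x $ i))"
  proof
    fix x :: "real^'n"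
    have "partials [j] (\<lambda>x::real^'n. \<Prod>i\<in>UNIV. f i (x $ i)) x =
        (\<Sum>i\<in>UNIV. f' i (x $ i) * (axis j 1 $ i) * (\<Prod>j\<in>UNIV - {i}. f j (x $ j)))"
      by (rule partial_eqI[OF der])
    also have "\<dots> = (\<Sum>i\<in>{j}. f' i (x $ i) * (axis j 1 $ i) * (\<Prod>j\<in>UNIV - {i}. f j (x $ j)))"
      by (rule sum.mono_neutral_right) (auto simp: axis_def)
    also have "\<dots> = f' j (x $ j) * (\<Prod>i\<in>UNIV - {j}. f i (x $ i))" by simp
    also have "\<dots> = (\<Prod>i\<in>UNIV. (if i = j then f' i else f i) (x $ i))"
      by (subst (2) prod.remove[of _ j]) auto
    finally show "partials [j] (\<lambda>x::real^'n. \<Prod>i\<in>UNIV. f i (x $ i)) x =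
        (\<Prod>i\<in>UNIV. (if i = j then f' i else f i) (x $ i))" .
  qed
qed

lemma smooth_fun_product:
  assumes "\<And>i. smooth_real (f i)"
  shows "smooth_fun (\<lambda>x::real^'n::finite. \<Prod>i\<in>UNIV. f i (x $ i))"
proof (rule smooth_fun_coinduct[of "\<lambda>h. \<exists>f. (\<forall>i. smooth_real (f i)) \<and> h = (\<lambda>x. \<Prod>i\<in>UNIV. f i (x $ i))"])
  fix h :: "real^'n \<Rightarrow> real"
  assume "\<exists>f. (\<forall>i. smooth_real (f i)) \<and> h = (\<lambda>x. \<Prod>i\<in>UNIV. f i (x $ i))"
  then obtain f where f: "\<And>i. smooth_real (f i)" and h: "h = (\<lambda>x. \<Prod>i\<in>UNIV. f i (x $ i))" by blast
  have "\<exists>g. (\<forall>t. (f i has_real_derivative g t) (at t)) \<and> smooth_real g" for i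
    using f[of i] by (meson smooth_realE)
  then obtain f' where f': "\<And>i t. (f i has_real_derivative f' i t) (at t)" "\<And>i. smooth_real (f' i)"
    by metis
  have "\<exists>g. (\<forall>i. smooth_real (g i)) \<and> partials [j] h = (\<lambda>x. \<Prod>i\<in>UNIV. g i (x $ i))" for j
    unfolding h partial_product(2)[OF f'(1)]
    by (intro exI[of _ "\<lambda>i. if i = j then f' i else f i"]) (simp add: f f')
  then show "h differentiable_on UNIV \<and>
      (\<forall>j. \<exists>g. (\<forall>i. smooth_real (g i)) \<and> partials [j] h = (\<lambda>x. \<Prod>i\<in>UNIV. g i (x $ i)))"
    using partial_product(1)[OF f'(1)] h by simp
qed (use assms in blast)

lemma test_functionI:
  assumes "smooth_fun f" "\<And>x. norm x > R \<Longrightarrow> f x = 0"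
  shows "test_function f"
proof -
  have "{x. f x \<noteq> 0} \<subseteq> cball 0 R" using assms(2) by (force simp: not_le)
  then have "bounded {x. f x \<noteq> 0}" using bounded_cball bounded_subset by blast
  then show ?thesis using assms(1) by (simp add: test_function_def smooth_fun_def compact_closure)
qed

lemma test_functionE:
  assumes "test_function f"
  obtains R where "R > 0" "smooth_fun f" "\<And>w x. norm x > R \<Longrightarrow> partials w f x = 0"
proof -
  have "bounded (closure {x. f x \<noteq> 0})"
    using assms by (simp add: test_function_def compact_imp_bounded)
  then obtain R where R: "R > 0" "\<And>x. x \<in> closure {x. f x \<noteq> 0} \<Longrightarrow> norm x \<le> R"
    by (meson bounded_pos)
  have "f y = 0" if "norm y > R" for y
    using R(2)[of y] that closure_subset[of "{x. f x \<noteq> 0}"] by force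
  then have "partials w f x = 0" if "norm x > R" for w x
    using that by (rule partials_eq_0)
  with R(1) assms show ?thesis
    by (intro that[of R]) (auto simp: test_function_def smooth_fun_def)
qed

section \<open>Integration by parts, and classical derivatives as weak derivatives\<close>

lemma integrable_lebesgue_iff_lborel:
  fixes f :: "'a::euclidean_space \<Rightarrow> real"
  shows "f \<in> borel_measurable borel \<Longrightarrow> integrable lebesgue f \<longleftrightarrow> integrable lborel f"
  by (rule integrable_completion) simp

lemma continuous_compact_support_integrable:
  fixes f :: "'a::euclidean_space \<Rightarrow> real"
  assumes "continuous_on UNIV f" "\<And>x. norm x > R \<Longrightarrow> f x = 0"
  shows "integrable lborel f" "integrable lebesgue f"
proof -
  have "integrable lborel (\<lambda>x. indicator (cball 0 R) x *\<^sub>R f x)"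
    using assms(1) continuous_on_subset by (intro borel_integrable_compact) auto
  moreover have "(\<lambda>x. indicator (cball 0 R) x *\<^sub>R f x) = f"
    using assms(2) by (force simp: indicator_def not_le)
  ultimately show *: "integrable lborel f" by simp
  show "integrable lebesgue f"
    using * borel_measurable_continuous_onI[OF assms(1)] integrable_lebesgue_iff_lborel by blast
qed

lemma continuous_imp_locally_integrable:
  fixes f :: "real^'n::finite \<Rightarrow> real"
  assumes "continuous_on UNIV f"
  shows "locally_integrable f"
  unfolding locally_integrable_def set_integrable_def
proof (intro allI impI)
  fix K :: "(real^'n) set" assume K: "compact K"
  have "integrable lborel (\<lambda>x. indicator K x *\<^sub>R f x)"
    using assms K continuous_on_subset by (intro borel_integrable_compact) auto
  moreover have "(\<lambda>x. indicator K x *\<^sub>R f x) \<in> borel_measurable borel"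
    using borel_measurable_continuous_onI[OF assms] borel_compact[OF K] by measurable
  ultimately show "integrable lebesgue (\<lambda>x. indicator K x *\<^sub>R f x)"
    using integrable_lebesgue_iff_lborel by blast
qed

lemma partial_line_derivative:
  assumes "F differentiable_on UNIV"
  shows "((\<lambda>t. F (x + t *\<^sub>R axis i 1)) has_real_derivative partials [i] F (x + t *\<^sub>R axis i 1)) (at t)"
proof -
  let ?D = "frechet_derivative F (at (x + t *\<^sub>R axis i 1))"
  have D: "(F has_derivative ?D) (at (x + t *\<^sub>R axis i 1))"
    using assms by (simp add: differentiable_on_def frechet_derivative_works)
  have "((\<lambda>t. F (x + t *\<^sub>R axis i 1)) has_derivative (\<lambda>h. ?D (h *\<^sub>R axis i 1))) (at t)"
    by (rule has_derivative_compose[of "\<lambda>t. x + t *\<^sub>R axis i 1" _ t UNIV F, OF _ D]) (auto intro!: derivative_eq_intros)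
  then show ?thesis
    using linear_scale[OF has_derivative_linear[OF D]]
    by (simp add: has_field_derivative_def mult_commute_abs)
qed

text \<open>By translation invariance every difference quotient of F in direction i has integral 0.
  The quotients converge to the partial derivative, and the mean value theorem bounds them by a
  bound of that derivative, so dominated convergence carries the value 0 to the limit.\<close>

lemma integral_partial_eq_0:
  fixes F :: "real^'n::finite \<Rightarrow> real"
  assumes diff: "F differentiable_on UNIV" and cont: "continuous_on UNIV (partials [i] F)"
    and R: "R > 0" and z: "\<And>x. norm x > R \<Longrightarrow> F x = 0"
  shows "(\<integral>x. partials [i] F x \<partial>lebesgue) = 0"
proof -
  let ?G = "partials [i] F" and ?e = "axis i 1 :: real^'n"
  have zG: "?G x = 0" if "norm x > R" for x using z that by (rule partials_eq_0)
  have contF: "continuous_on UNIV F" using diff by (rule differentiable_imp_continuous_on)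
  note [measurable] = borel_measurable_continuous_onI[OF contF] borel_measurable_continuous_onI[OF cont]
  obtain B where B: "\<And>x. \<bar>?G x\<bar> \<le> B"
  proof -
    have "compact (?G ` cball 0 R)"
      using cont continuous_on_subset by (intro compact_continuous_image compact_cball) blast
    then have "bounded (?G ` cball 0 R)" by (rule compact_imp_bounded)
    then obtain B where "\<And>x. x \<in> cball 0 R \<Longrightarrow> \<bar>?G x\<bar> \<le> B" "B > 0"
      unfolding bounded_pos real_norm_def by blast
    then show ?thesis using that[of B] zG by (metis abs_zero less_imp_le mem_cball_0 not_le)
  qed
  \<comment> \<open>Steps of length at most 1 keep all quotients supported in the ball of radius
    \<open>R + 1\<close>, which provides an integrable majorant.\<close>
  define h where "h N = 1 / real (Suc N)" for N
  have h: "0 < h N" "h N \<le> 1" for N by (auto simp: h_def)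
  define D where "D N x = (F (x + h N *\<^sub>R ?e) - F x) / h N" for N x
  have "(\<lambda>N. \<integral>x. D N x \<partial>lborel) \<longlonglongrightarrow> (\<integral>x. ?G x \<partial>lborel)"
  proof (rule integral_dominated_convergence)
    show "integrable lborel (\<lambda>x. indicator (cball 0 (R + 1)) x * B)"
      using borel_integrable_compact[of "cball 0 (R + 1)" "\<lambda>x. B"] by simp
    show "AE x in lborel. (\<lambda>N. D N x) \<longlonglongrightarrow> ?G x"
    proof (rule AE_I2)
      fix x
      have "(\<lambda>k. (F (x + k *\<^sub>R ?e) - F x) / k) \<midarrow>0\<rightarrow> ?G x"
        using partial_line_derivative[OF diff, of x i 0] by (simp add: DERIV_def)
      moreover have "filterlim h (at 0) sequentially"
        unfolding filterlim_at h_def using lim_1_over_n[where 'a=real, THEN LIMSEQ_Suc] by auto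
      ultimately show "(\<lambda>N. D N x) \<longlonglongrightarrow> ?G x"
        unfolding D_def by (rule filterlim_compose)
    qed
    show "AE x in lborel. norm (D N x) \<le> indicator (cball 0 (R + 1)) x * B" for N
    proof (rule AE_I2)
      fix x
      obtain z' where z': "0 < z'" "z' < h N"
        "F (x + h N *\<^sub>R ?e) - F (x + 0 *\<^sub>R ?e) = (h N - 0) * ?G (x + z' *\<^sub>R ?e)"
        using MVT2[OF h(1)[of N], of "\<lambda>t. F (x + t *\<^sub>R ?e)", OF partial_line_derivative[OF diff]] by blast
      then have D: "D N x = ?G (x + z' *\<^sub>R ?e)" using h(1)[of N] by (simp add: D_def)
      have "?G (x + z' *\<^sub>R ?e) = 0" if "norm x > R + 1"
      proof (rule zG)
        have "norm x \<le> norm (x + z' *\<^sub>R ?e) + norm (z' *\<^sub>R ?e)"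
          using norm_triangle_ineq4[of "x + z' *\<^sub>R ?e" "z' *\<^sub>R ?e"] by simp
        then show "R < norm (x + z' *\<^sub>R ?e)" using z' h(2)[of N] that by (simp add: norm_axis_1)
      qed
      then show "norm (D N x) \<le> indicator (cball 0 (R + 1)) x * B"
        using D B[of "x + z' *\<^sub>R ?e"] by (auto simp: indicator_def)
    qed
    show "D N \<in> borel_measurable lborel" for N unfolding D_def by measurable
  qed (use cont in \<open>simp del: partials.simps add: borel_measurable_continuous_onI\<close>)
  moreover have "(\<integral>x. D N x \<partial>lborel) = 0" for N
  proof -
    have intF: "integrable lborel F"
      using contF z by (rule continuous_compact_support_integrable(1))
    have d: "distr lborel borel (\<lambda>x. h N *\<^sub>R ?e + x) = lborel" by (rule lborel_distr_plus)
    have "integrable lborel (\<lambda>x. F (h N *\<^sub>R ?e + x))"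
      using intF integrable_distr_eq[of "\<lambda>x. h N *\<^sub>R ?e + x" lborel borel F] d by simp
    moreover have "(\<integral>x. F (h N *\<^sub>R ?e + x) \<partial>lborel) = (\<integral>x. F x \<partial>lborel)"
      using integral_distr[of "\<lambda>x. h N *\<^sub>R ?e + x" lborel borel F] d by simp
    ultimately show ?thesis
      using intF by (simp add: D_def add.commute)
  qed
  ultimately have "(\<integral>x. ?G x \<partial>lborel) = 0" by (simp add: LIMSEQ_const_iff)
  then show ?thesis
    by (subst integral_completion)
      (use cont in \<open>simp_all del: partials.simps add: borel_measurable_continuous_onI\<close>)
qed

lemma partial_mult:
  assumes "f differentiable_on UNIV" "g differentiable_on UNIV"
  shows "partials [i] (\<lambda>x. f x * g x) = (\<lambda>x. f x * partials [i] g x + partials [i] f x * g x)"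
proof
  fix x
  have "(f has_derivative frechet_derivative f (at x)) (at x)" "(g has_derivative frechet_derivative g (at x)) (at x)"
    using assms by (simp_all add: differentiable_on_def frechet_derivative_works)
  from partial_eqI[OF has_derivative_mult[OF this]]
  show "partials [i] (\<lambda>x. f x * g x) x = f x * partials [i] g x + partials [i] f x * g x" by simp
qed

lemma integration_by_parts:
  assumes "test_function u" "smooth_fun f"
  shows "(\<integral>x. u x * partials [i] f x \<partial>lebesgue) = - (\<integral>x. partials [i] u x * f x \<partial>lebesgue)"
proof -
  obtain R where R: "R > 0" and sm: "smooth_fun u" and z: "\<And>w x. norm x > R \<Longrightarrow> partials w u x = 0"
    using assms(1) by (rule test_functionE) blast
  note cont = smooth_fun_continuous[OF sm] smooth_fun_continuous[OF assms(2)]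
  have diff: "u differentiable_on UNIV" "f differentiable_on UNIV"
    using sm assms(2) unfolding smooth_fun_def by (metis partials.simps(1))+
  have "(\<integral>x. partials [i] (\<lambda>x. u x * f x) x \<partial>lebesgue) = 0"
  proof (rule integral_partial_eq_0)
    show "(\<lambda>x. u x * f x) differentiable_on UNIV" using diff by (rule differentiable_on_mult)
    show "continuous_on UNIV (partials [i] (\<lambda>x. u x * f x))"
      unfolding partial_mult[OF diff]
      using cont(1)[of UNIV "[]"] cont(2)[of UNIV "[]"] cont(1)[of UNIV "[i]"] cont(2)[of UNIV "[i]"]
      by (intro continuous_intros) simp_all
    show "R > 0" by (rule R)
    show "u x * f x = 0" if "norm x > R" for x using z[of x "[]"] that by simp
  qed
  then have "0 = (\<integral>x. u x * partials [i] f x + partials [i] u x * f x \<partial>lebesgue)"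
    unfolding partial_mult[OF diff] by simp
  also have "\<dots> = (\<integral>x. u x * partials [i] f x \<partial>lebesgue) + (\<integral>x. partials [i] u x * f x \<partial>lebesgue)"
  proof (rule Bochner_Integration.integral_add)
    show "integrable lebesgue (\<lambda>x. u x * partials [i] f x)"
      using cont(1)[of UNIV "[]"] cont(2)[of UNIV "[i]"] z[of _ "[]"]
      by (intro continuous_compact_support_integrable(2)[of _ R]) (auto intro: continuous_on_mult simp del: partials.simps(2))
    show "integrable lebesgue (\<lambda>x. partials [i] u x * f x)"
      using cont(1)[of UNIV "[i]"] cont(2)[of UNIV "[]"] z[of _ "[i]"]
      by (intro continuous_compact_support_integrable(2)[of _ R]) (auto intro: continuous_on_mult simp del: partials.simps(2))
  qed
  finally show ?thesis by simp
qed

lemma test_function_partials: "test_function u \<Longrightarrow> test_function (partials w u)"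
  by (metis test_functionE test_functionI smooth_fun_partials)

text \<open>Repeated integration by parts. The outermost letter of w is moved onto u first and
  therefore acts innermost there, which reverses the word.\<close>

lemma test_function_has_weak_deriv:
  assumes "test_function u"
  shows "has_weak_deriv u w (partials (rev w) u)"
  unfolding has_weak_deriv_def
proof (intro conjI allI impI)
  have "smooth_fun u" using assms by (rule test_functionE) blast
  then show "locally_integrable (partials (rev w) u)"
    by (intro continuous_imp_locally_integrable smooth_fun_continuous)
  fix \<psi> :: "real^'a \<Rightarrow> real" assume "test_function \<psi>"
  then have "smooth_fun \<psi>" by (rule test_functionE) blast
  with assms show "(\<integral>x. u x * partials w \<psi> x \<partial>lebesgue) =
      (- 1) ^ length w * (\<integral>x. partials (rev w) u x * \<psi> x \<partial>lebesgue)"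
  proof (induction w arbitrary: u)
    case (Cons i w)
    have "(\<integral>x. u x * partials (i # w) \<psi> x \<partial>lebesgue) = (\<integral>x. u x * partials [i] (partials w \<psi>) x \<partial>lebesgue)"
      by simp
    also have "\<dots> = - (\<integral>x. partials [i] u x * partials w \<psi> x \<partial>lebesgue)"
      by (intro integration_by_parts Cons.prems smooth_fun_partials)
    also have "(\<integral>x. partials [i] u x * partials w \<psi> x \<partial>lebesgue) =
        (- 1) ^ length w * (\<integral>x. partials (rev w) (partials [i] u) x * \<psi> x \<partial>lebesgue)"
      by (intro Cons.IH test_function_partials Cons.prems)
    finally show ?case by (simp only: rev.simps(2) partials_snoc length_Cons power_Suc mult_minus_left mult_1)
  qed simp
qed

text \<open>The positive and negative parts of f are densities of two finite measures that agree on
  boxes. Boxes form an intersection-stable generator of the Borel sets, so the measures, and then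
  their densities, coincide.\<close>

lemma AE_zero_if_box_integrals_zero:
  fixes f :: "'a::euclidean_space \<Rightarrow> real"
  assumes int: "integrable lborel f"
    and zero: "\<And>a b. (\<integral>x. indicator (box a b) x * f x \<partial>lborel) = 0"
  shows "AE x in lborel. f x = 0"
proof -
  note [measurable] = borel_measurable_integrable[OF int]
  let ?P = "\<lambda>x. ennreal (f x)" and ?N = "\<lambda>x. ennreal (- f x)"
  have fin: "(\<integral>\<^sup>+x. ?P x \<partial>lborel) < \<infinity>" "(\<integral>\<^sup>+x. ?N x \<partial>lborel) < \<infinity>"
    using int by (auto simp: real_integrable_def less_top)
  have eq: "emeasure (density lborel ?P) (box a b) = emeasure (density lborel ?N) (box a b)" for a b
  proof -
    have i: "integrable lborel (\<lambda>x. indicator (box a b) x * f x)"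
      using integrable_real_mult_indicator[OF _ int, of "box a b"] by (simp add: mult.commute)
    have le: "(\<integral>\<^sup>+x. ?P x * indicator (box a b) x \<partial>lborel) < \<infinity>"
       "(\<integral>\<^sup>+x. ?N x * indicator (box a b) x \<partial>lborel) < \<infinity>"
      by (rule le_less_trans[OF nn_integral_mono fin(1)] le_less_trans[OF nn_integral_mono fin(2)],
          simp add: indicator_def)+
    have c: "(\<integral>\<^sup>+x. ennreal (indicator (box a b) x * f x) \<partial>lborel) = (\<integral>\<^sup>+x. ?P x * indicator (box a b) x \<partial>lborel)"
      "(\<integral>\<^sup>+x. ennreal (- (indicator (box a b) x * f x)) \<partial>lborel) = (\<integral>\<^sup>+x. ?N x * indicator (box a b) x \<partial>lborel)"
      by (auto intro!: nn_integral_cong simp: indicator_def)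
    have "enn2real (\<integral>\<^sup>+x. ?P x * indicator (box a b) x \<partial>lborel) =
        enn2real (\<integral>\<^sup>+x. ?N x * indicator (box a b) x \<partial>lborel)"
      using real_lebesgue_integral_def[OF i] zero[of a b] unfolding c by simp
    then have "(\<integral>\<^sup>+x. ?P x * indicator (box a b) x \<partial>lborel) = (\<integral>\<^sup>+x. ?N x * indicator (box a b) x \<partial>lborel)"
      using le by (metis ennreal_enn2real infinity_ennreal_def)
    then show ?thesis by (simp add: emeasure_density)
  qed
  have "density lborel ?P = density lborel ?N"
  proof (rule measure_eqI_generator_eq)
    let ?E = "range (\<lambda>(a, b). box a b::'a set)"
    show "Int_stable ?E" by (auto simp: Int_stable_def box_Int_box)
    show "?E \<subseteq> Pow UNIV" "sets (density lborel ?P) = sigma_sets UNIV ?E"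
      "sets (density lborel ?N) = sigma_sets UNIV ?E"
      by (simp_all add: borel_eq_box)
    let ?A = "\<lambda>n::nat. box (- (real n *\<^sub>R One)) (real n *\<^sub>R One) :: 'a set"
    show "range ?A \<subseteq> ?E" "(\<Union>i. ?A i) = UNIV" unfolding UN_box_eq_UNIV by auto
    show "emeasure (density lborel ?P) (?A i) \<noteq> \<infinity>" for i
    proof -
      have "emeasure (density lborel ?P) (?A i) = (\<integral>\<^sup>+x. ?P x * indicator (?A i) x \<partial>lborel)"
        by (rule emeasure_density) auto
      also have "\<dots> < \<infinity>"
        by (rule le_less_trans[OF nn_integral_mono fin(1)]) (simp add: indicator_def)
      finally show ?thesis by simp
    qed
    show "emeasure (density lborel ?P) X = emeasure (density lborel ?N) X" if "X \<in> ?E" for X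
      using that eq by auto
  qed
  then have "AE x in lborel. ?P x = ?N x"
    using fin(1) by (subst (asm) finite_density_unique) auto
  then show ?thesis
    by eventually_elim (metis ennreal_eq_0_iff ennreal_neg linorder_linear neg_0_le_iff_le
        order_antisym_conv neg_le_0_iff_le)
qed

text \<open>Products of one-dimensional bumps approximate the indicator of a box, with |g| on the
  closed box as majorant, so all box integrals of g vanish. The conclusion is then drawn on each of
  countably many boxes exhausting the space.\<close>

lemma fundamental_lemma_variations:
  fixes g :: "real^'n::finite \<Rightarrow> real"
  assumes loc: "locally_integrable g"
    and zero: "\<And>\<psi>. test_function \<psi> \<Longrightarrow> (\<integral>x. g x * \<psi> x \<partial>lebesgue) = 0"
  shows "AE x in lebesgue. g x = 0"
proof -
  have box0: "(\<integral>x. indicator (box a b) x * g x \<partial>lebesgue) = 0" for a b :: "real^'n"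
  proof -
    define \<psi> where "\<psi> j x = (\<Prod>i\<in>UNIV. bump (1 / real (Suc j)) (a $ i) (b $ i) (x $ i))" for j and x :: "real^'n"
    have rng: "\<psi> j x \<in> {0..1}" for j x
      using bump_range[of "1 / real (Suc j)"] by (auto simp: \<psi>_def intro!: prod_nonneg prod_le_1)
    have supp: "\<psi> j x = 0" if "x \<notin> box a b" for j x
    proof -
      obtain i where "x $ i \<notin> {a $ i<..<b $ i}" using \<open>x \<notin> box a b\<close> by (auto simp: mem_box_cart)
      then have "bump (1 / real (Suc j)) (a $ i) (b $ i) (x $ i) = 0" by (rule bump_eq_0)
      then show ?thesis
        unfolding \<psi>_def by (intro prod_zero bexI[of _ i] finite UNIV_I)
    qed
    obtain R where R: "\<And>x. x \<in> box a b \<Longrightarrow> norm x \<le> R"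
      using bounded_box[of a b] by (auto simp: bounded_iff)
    have smooth: "smooth_fun (\<psi> j)" for j
      unfolding \<psi>_def by (intro smooth_fun_product smooth_real_bump) simp
    have test: "test_function (\<psi> j)" for j
      by (rule test_functionI[OF smooth, of R]) (use supp R in force)
    have lim: "(\<lambda>j. \<psi> j x) \<longlonglongrightarrow> indicator (box a b) x" for x
    proof -
      have "(\<lambda>j. \<psi> j x) \<longlonglongrightarrow> (\<Prod>i\<in>UNIV. indicator {a $ i<..<b $ i} (x $ i))"
        unfolding \<psi>_def by (intro tendsto_prod bump_tendsto_indicator)
      also have "(\<Prod>i\<in>UNIV. indicator {a $ i<..<b $ i} (x $ i)) = (indicator (box a b) x :: real)"
        by (cases "x \<in> box a b") (auto simp: mem_box_cart indicator_def intro!: prod_zero)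
      finally show ?thesis .
    qed
    have gint: "integrable lebesgue (\<lambda>x. indicator (cbox a b) x * g x)"
      using loc unfolding locally_integrable_def set_integrable_def by (simp add: compact_cbox)
    have [simp]: "(\<lambda>x. indicator (cbox a b) x * g x) \<in> borel_measurable lebesgue"
      using gint by (rule borel_measurable_integrable)
    have [simp]: "\<psi> j \<in> borel_measurable lebesgue" for j
      using smooth_fun_borel[OF smooth, of "[]"] by (auto intro: measurable_completion)
    have "(\<lambda>j. \<integral>x. (indicator (cbox a b) x * g x) * \<psi> j x \<partial>lebesgue) \<longlonglongrightarrow>
        (\<integral>x. (indicator (cbox a b) x * g x) * indicator (box a b) x \<partial>lebesgue)"
    proof (rule integral_dominated_convergence)
      show "integrable lebesgue (\<lambda>x. \<bar>indicator (cbox a b) x * g x\<bar>)"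
        using gint by (rule integrable_abs)
      show "AE x in lebesgue. (\<lambda>j. (indicator (cbox a b) x * g x) * \<psi> j x) \<longlonglongrightarrow>
          (indicator (cbox a b) x * g x) * indicator (box a b) x"
        by (intro AE_I2 tendsto_mult tendsto_const lim)
      show "AE x in lebesgue. norm ((indicator (cbox a b) x * g x) * \<psi> j x) \<le> \<bar>indicator (cbox a b) x * g x\<bar>" for j
        using rng[of j] by (intro AE_I2) (auto simp: abs_mult intro!: mult_left_le)
      show "(\<lambda>x. (indicator (cbox a b) x * g x) * indicator (box a b) x) \<in> borel_measurable lebesgue"
        by (rule borel_measurable_times[OF _ borel_measurable_indicator]) simp_all
      show "(\<lambda>x. (indicator (cbox a b) x * g x) * \<psi> j x) \<in> borel_measurable lebesgue" for j
        by (rule borel_measurable_times) simp_all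
    qed
    moreover have "(\<integral>x. (indicator (cbox a b) x * g x) * \<psi> j x \<partial>lebesgue) = 0" for j
    proof -
      have "(\<lambda>x. (indicator (cbox a b) x * g x) * \<psi> j x) = (\<lambda>x. g x * \<psi> j x)"
        using supp box_subset_cbox[of a b] by (force simp: indicator_def)
      then show ?thesis using zero[OF test] by simp
    qed
    ultimately have "(\<integral>x. (indicator (cbox a b) x * g x) * indicator (box a b) x \<partial>lebesgue) = 0"
      by (simp add: LIMSEQ_const_iff)
    moreover have "(\<lambda>x. (indicator (cbox a b) x * g x) * indicator (box a b) x) = (\<lambda>x. indicator (box a b) x * g x)"
      using box_subset_cbox[of a b] by (force simp: indicator_def)
    ultimately show ?thesis by simp
  qed
  have "AE x in lebesgue. x \<in> box (- (real N *\<^sub>R One)) (real N *\<^sub>R One) \<longrightarrow> g x = 0" for N :: nat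
  proof -
    let ?B = "box (- (real N *\<^sub>R One)) (real N *\<^sub>R One) :: (real^'n) set"
    let ?h = "\<lambda>x. indicator ?B x * g x"
    let ?C = "cbox (- (real N *\<^sub>R One)) (real N *\<^sub>R One) :: (real^'n) set"
    have "integrable lebesgue (\<lambda>x. indicator ?C x * g x)"
      using loc unfolding locally_integrable_def set_integrable_def by (simp add: compact_cbox)
    then have "integrable lebesgue (\<lambda>x. (indicator ?C x * g x) * indicator ?B x)"
      by (rule integrable_real_mult_indicator[rotated]) simp
    moreover have "(\<lambda>x. (indicator ?C x * g x) * indicator ?B x) = ?h"
      using box_subset_cbox by (force simp: indicator_def)
    ultimately have int: "integrable lebesgue ?h" by simp
    \<comment> \<open>g is Lebesgue measurable, whereas the comparison of measures takes place on
      Borel sets; a Borel representative of the localised function bridges the gap.\<close>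
    then obtain f where f[measurable]: "f \<in> borel_measurable lborel" and ae: "AE x in lborel. ?h x = f x"
      using completion_ex_borel_measurable_real[of ?h lborel] by blast
    have ae': "AE x in lebesgue. ?h x = f x" using ae by (rule AE_completion)
    have "integrable lebesgue f"
      using int measurable_completion[OF f] ae' by (rule integrable_cong_AE_imp)
    then have intf: "integrable lborel f" using f by (simp add: integrable_completion)
    have "(\<integral>x. indicator (box a b) x * f x \<partial>lborel) = 0" for a b
    proof -
      have "(\<integral>x. indicator (box a b) x * f x \<partial>lborel) = (\<integral>x. indicator (box a b) x * f x \<partial>lebesgue)"
        by (subst integral_completion) auto
      also have "\<dots> = (\<integral>x. indicator (box a b) x * ?h x \<partial>lebesgue)"
      proof (rule integral_cong_AE)
        have i: "(\<lambda>x. indicator (box a b) x) \<in> borel_measurable lebesgue"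
          by (intro borel_measurable_indicator) simp
        show "(\<lambda>x. indicator (box a b) x * f x) \<in> borel_measurable lebesgue"
          using i measurable_completion[OF f] by (rule borel_measurable_times)
        show "(\<lambda>x. indicator (box a b) x * ?h x) \<in> borel_measurable lebesgue"
          using i borel_measurable_integrable[OF int] by (rule borel_measurable_times)
      qed (use ae' in auto)
      also have "\<dots> = (\<integral>x. indicator (box a b \<inter> ?B) x * g x \<partial>lebesgue)"
        by (simp add: indicator_inter_arith mult.assoc)
      also have "\<dots> = 0" unfolding box_Int_box by (rule box0)
      finally show ?thesis .
    qed
    then have "AE x in lborel. f x = 0" by (rule AE_zero_if_box_integrals_zero[OF intf])
    then have "AE x in lebesgue. f x = 0" by (rule AE_completion)
    with ae' show ?thesis by eventually_elim (auto simp: indicator_def)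
  qed
  then have "AE x in lebesgue. \<forall>N::nat. x \<in> box (- (real N *\<^sub>R One)) (real N *\<^sub>R One) \<longrightarrow> g x = 0"
    unfolding AE_all_countable by blast
  then show ?thesis
  proof (rule eventually_mono)
    fix x :: "real^'n"
    obtain N :: nat where "x \<in> box (- (real N *\<^sub>R One)) (real N *\<^sub>R One)"
      using UN_box_eq_UNIV[where 'a="real^'n"] by blast
    then show "\<forall>N::nat. x \<in> box (- (real N *\<^sub>R One)) (real N *\<^sub>R One) \<longrightarrow> g x = 0 \<Longrightarrow> g x = 0"
      by blast
  qed
qed

lemma weak_deriv_unique:
  assumes "has_weak_deriv u w g" "has_weak_deriv u w h"
  shows "AE x in lebesgue. g x = h x"
proof -
  have loc: "locally_integrable g" "locally_integrable h"
    using assms by (auto simp: has_weak_deriv_def)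
  have "AE x in lebesgue. g x - h x = 0"
  proof (rule fundamental_lemma_variations)
    show "locally_integrable (\<lambda>x. g x - h x)"
      using loc unfolding locally_integrable_def by (auto intro: set_integral_diff(1))
    fix \<psi> :: "real^'a \<Rightarrow> real" assume t: "test_function \<psi>"
    then obtain R where R: "R > 0" "smooth_fun \<psi>" "\<And>w x. norm x > R \<Longrightarrow> partials w \<psi> x = 0"
      by (rule test_functionE) blast
    have c: "continuous_on UNIV \<psi>" using smooth_fun_continuous[OF R(2), of _ "[]"] by simp
    \<comment> \<open>Integrability of both products is what permits splitting the integral of the
      difference.\<close>
    have int: "integrable lebesgue (\<lambda>x. f x * \<psi> x)" if "locally_integrable f" for f
    proof -
      have "f absolutely_integrable_on cball 0 R" using that by (simp add: locally_integrable_def)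
      then have "(\<lambda>x. \<psi> x * f x) absolutely_integrable_on cball 0 R"
        using continuous_on_subset[OF c subset_UNIV]
        by (intro absolutely_integrable_bounded_measurable_product[OF bilinear_times]
          continuous_imp_measurable_on_sets_lebesgue compact_imp_bounded compact_continuous_image) auto
      then have "integrable lebesgue (\<lambda>x. indicator (cball 0 R) x *\<^sub>R (\<psi> x * f x))"
        by (simp add: set_integrable_def)
      moreover have "(\<lambda>x. indicator (cball 0 R) x *\<^sub>R (\<psi> x * f x)) = (\<lambda>x. f x * \<psi> x)"
        using R(3)[of _ "[]"] by (force simp: indicator_def)
      ultimately show ?thesis by simp
    qed
    have "(-1) ^ length w * (\<integral>x. g x * \<psi> x \<partial>lebesgue) = (-1) ^ length w * (\<integral>x. h x * \<psi> x \<partial>lebesgue)"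
      using assms[unfolded has_weak_deriv_def, THEN conjunct2, rule_format, OF t] by simp
    then show "(\<integral>x. (g x - h x) * \<psi> x \<partial>lebesgue) = 0"
      using int[OF loc(1)] int[OF loc(2)] by (simp add: left_diff_distrib)
  qed
  then show ?thesis by simp
qed

text \<open>\<open>weak_deriv\<close> picks some weak derivative by choice; uniqueness forces it to
  agree almost everywhere with the classical one.\<close>

lemma weak_deriv_test_function:
  assumes "test_function u"
  shows "AE x in lebesgue. weak_deriv w u x = partials (rev w) u x"
proof (cases "w = []")
  case False
  have "has_weak_deriv u w (weak_deriv w u)"
    using someI[of "has_weak_deriv u w", OF test_function_has_weak_deriv[OF assms]] False
    by (simp add: weak_deriv_def)
  then show ?thesis
    using test_function_has_weak_deriv[OF assms] by (rule weak_deriv_unique)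
qed (simp add: weak_deriv_def)

section \<open>Young functions\<close>

lemma ennreal_mult3:
  "0 \<le> a \<Longrightarrow> 0 \<le> b \<Longrightarrow> 0 \<le> c \<Longrightarrow> ennreal a * (ennreal b * ennreal c) = ennreal (a * (b * c))"
  by (simp add: ennreal_mult)

lemma young_function_convex:
  assumes "young_function A" "0 \<le> x" "0 \<le> y" "0 \<le> t" "t \<le> 1"
  shows "A ((1 - t) * x + t * y) \<le> ennreal (1 - t) * A x + ennreal t * A y"
  using assms by (auto simp: young_function_def)

lemma young_function_0: "young_function A \<Longrightarrow> A 0 = 0"
  by (simp add: young_function_def)

text \<open>Convexity on the segment starting at 0, where A vanishes. This one-sided homogeneity
  does the work of a doubling condition: constants are absorbed through it later on.\<close>

lemma young_function_scale:
  assumes "young_function A" "0 \<le> t" "0 \<le> \<theta>" "\<theta> \<le> 1"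
  shows "A (\<theta> * t) \<le> ennreal \<theta> * A t"
  using young_function_convex[OF assms(1), of 0 t \<theta>] young_function_0[OF assms(1)] assms by simp

lemma young_function_mono:
  assumes "young_function A" "0 \<le> r" "r \<le> t"
  shows "A r \<le> A t"
proof (cases "t = 0")
  case False
  have "A ((r / t) * t) \<le> ennreal (r / t) * A t"
    using assms False by (intro young_function_scale) auto
  also have "\<dots> \<le> 1 * A t" using assms False by (intro mult_right_mono) (auto simp: ennreal_le_1)
  finally show ?thesis using False by simp
qed (use assms in simp)

lemma young_function_finite:
  assumes "young_function A"
  obtains t where "t > 0" "A t < \<infinity>"
proof -
  have "\<exists>t>0. A t < \<infinity>"
  proof (rule ccontr)
    assume "\<not> ?thesis"
    then have "A t = \<infinity>" if "t > 0" for t using that by (metis infinity_ennreal_def top.not_eq_extremum)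
    then have "A constant_on {0<..}" by (auto simp: constant_on_def)
    then show False using assms by (simp add: young_function_def)
  qed
  then show ?thesis using that by blast
qed

text \<open>The weights may add up to less than 1, because the missing mass can be placed at 0,
  where A vanishes. In the application they vary with two points and only an upper bound of their
  sum is at hand. The induction splits off one weight and renormalises the others.\<close>

lemma young_function_jensen:
  assumes A: "young_function A" and "finite I" "\<And>i. i \<in> I \<Longrightarrow> 0 \<le> \<theta> i" "\<And>i. i \<in> I \<Longrightarrow> 0 \<le> t i"
    "sum \<theta> I \<le> 1"
  shows "A (\<Sum>i\<in>I. \<theta> i * t i) \<le> (\<Sum>i\<in>I. ennreal (\<theta> i) * A (t i))"
  using assms(2-)
proof (induction I arbitrary: \<theta> rule: finite_induct)
  case empty
  then show ?case using young_function_0[OF A] by simp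
next
  case (insert j I)
  have nn: "0 \<le> \<theta> j" "0 \<le> t j" "\<And>i. i \<in> I \<Longrightarrow> 0 \<le> \<theta> i" "\<And>i. i \<in> I \<Longrightarrow> 0 \<le> t i"
    and s: "\<theta> j + sum \<theta> I \<le> 1" "0 \<le> sum \<theta> I" using insert by (auto intro: sum_nonneg)
  show ?case
  proof (cases "\<theta> j = 1")
    case True
    then have "sum \<theta> I = 0" using s by linarith
    then have "\<And>i. i \<in> I \<Longrightarrow> \<theta> i = 0" using nn insert.hyps by (simp add: sum_nonneg_eq_0_iff)
    then show ?thesis using True insert.hyps by simp
  next
    case False
    then have lt: "\<theta> j < 1" using s by linarith
    let ?\<eta> = "\<lambda>i. \<theta> i / (1 - \<theta> j)"
    have "(\<Sum>i\<in>insert j I. \<theta> i * t i) = (1 - \<theta> j) * (\<Sum>i\<in>I. ?\<eta> i * t i) + \<theta> j * t j"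
      using insert.hyps lt by (simp add: sum_distrib_left)
    also have "A \<dots> \<le> ennreal (1 - \<theta> j) * A (\<Sum>i\<in>I. ?\<eta> i * t i) + ennreal (\<theta> j) * A (t j)"
      using nn lt by (intro young_function_convex A sum_nonneg) auto
    also have "\<dots> \<le> ennreal (1 - \<theta> j) * (\<Sum>i\<in>I. ennreal (?\<eta> i) * A (t i)) + ennreal (\<theta> j) * A (t j)"
      using nn lt s by (intro add_mono mult_left_mono insert.IH) (auto simp flip: sum_divide_distrib)
    also have "ennreal (1 - \<theta> j) * (\<Sum>i\<in>I. ennreal (?\<eta> i) * A (t i)) = (\<Sum>i\<in>I. ennreal (\<theta> i) * A (t i))"
      unfolding sum_distrib_left mult.assoc[symmetric]
      by (intro sum.cong refl arg_cong2[where f="(*)"]) (use nn lt in \<open>simp flip: ennreal_mult\<close>)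
    finally show ?thesis using insert.hyps by (simp add: add.commute)
  qed
qed

text \<open>One level is enough: an amplitude of order \<open>2 powr (- l * n)\<close> at level l
  has bounded cost, as A grows at most linearly near 0, while its gain is of order
  \<open>2 powr (l * (\<beta> - n))\<close> and hence unbounded in l.\<close>

lemma young_function_capacity_supercritical:
  assumes A: "young_function A" and "real n < \<beta>" and M: "M > 0"
  obtains N b where "\<And>l. 0 \<le> b l" "(\<Sum>l<N. ennreal (2 ^ (l * n)) * A (b l)) \<le> 1"
    "M \<le> (\<Sum>l<N. 2 powr (l * \<beta>) * b l)"
proof -
  obtain t0 where t0: "t0 > 0" "A t0 < \<infinity>" using young_function_finite[OF A] .
  then obtain K where K: "A t0 = ennreal K" "K \<ge> 0" by (cases "A t0") auto
  \<comment> \<open>Chosen so that \<open>e / 2 ^ (l * n)\<close> is t0 multiplied by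
    \<open>1 / (2 ^ (l * n) * (K + 1))\<close>; convexity then bounds the cost by
    \<open>K / (K + 1)\<close>. The summand 1 covers the case K = 0.\<close>
  define e where "e = t0 / (K + 1)"
  have e: "e > 0" using t0 K by (simp add: e_def)
  have "filterlim (\<lambda>l::nat. 2 powr (real l * (\<beta> - n)) * e) at_top sequentially"
  proof -
    have "filterlim (\<lambda>l::nat. real l * (\<beta> - n)) at_top sequentially"
      using assms by (intro filterlim_at_top_mult_tendsto_pos[OF tendsto_const] filterlim_real_sequentially) auto
    then have "filterlim (\<lambda>l::nat. exp (ln 2 * (real l * (\<beta> - n)))) at_top sequentially"
      by (intro filterlim_compose[OF exp_at_top] filterlim_tendsto_pos_mult_at_top[OF tendsto_const]) auto
    then have "filterlim (\<lambda>l::nat. exp (ln 2 * (real l * (\<beta> - n))) * e) at_top sequentially"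
      using e by (intro filterlim_at_top_mult_tendsto_pos[OF tendsto_const])
    then show ?thesis by (simp add: powr_def mult.commute)
  qed
  then obtain l where l: "M \<le> 2 powr (real l * (\<beta> - n)) * e"
    unfolding filterlim_at_top eventually_sequentially by blast
  let ?b = "\<lambda>i. if i = l then e / 2 ^ (l * n) else 0"
  show ?thesis
  proof
    show "0 \<le> ?b i" for i using e by simp
    have sumA: "(\<Sum>i<Suc l. ennreal (2 ^ (i * n)) * A (?b i)) = ennreal (2 ^ (l * n)) * A (e / 2 ^ (l * n))"
      using young_function_0[OF A] by simp
    have "A ((1 / (2 ^ (l * n) * (K + 1))) * t0) \<le> ennreal (1 / (2 ^ (l * n) * (K + 1))) * A t0"
    proof (intro young_function_scale A)
      have "1 * 1 \<le> 2 ^ (l * n) * (K + 1)" using K by (intro mult_mono) auto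
      then show "1 / (2 ^ (l * n) * (K + 1)) \<le> 1" by simp
    qed (use t0 K in auto)
    then have "ennreal (2 ^ (l * n)) * A (e / 2 ^ (l * n)) \<le>
        ennreal (2 ^ (l * n)) * (ennreal (1 / (2 ^ (l * n) * (K + 1))) * ennreal K)"
      unfolding K e_def by (intro mult_left_mono) (simp_all add: mult.commute)
    also have "\<dots> = ennreal (K / (K + 1))"
      using K by (simp flip: ennreal_mult)
    also have "\<dots> \<le> 1" using K by (simp add: ennreal_le_1)
    finally show "(\<Sum>i<Suc l. ennreal (2 ^ (i * n)) * A (?b i)) \<le> 1" unfolding sumA .
    have "2 powr (real l * \<beta>) * (e / 2 ^ (l * n)) = 2 powr (real l * (\<beta> - n)) * e"
      by (simp add: right_diff_distrib powr_diff flip: powr_realpow)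
    then show "M \<le> (\<Sum>i<Suc l. 2 powr (i * \<beta>) * ?b i)" using l by simp
  qed
qed

text \<open>Up to the bounded part, the integrand \<open>(t / A t) powr (\<beta> / (n - \<beta>))\<close> is a sum over dyadic levels:
  level \<open>l\<close> contributes \<open>2 powr (l * \<beta>)\<close> on the interval where \<open>A t \<le> \<mu> * 2 powr (- l * (n - \<beta>)) * t\<close>.
  A divergent integral therefore makes the weighted sum of the lengths of these intervals diverge.\<close>

lemma young_function_capacity_subcritical:
  assumes A: "young_function A" and \<beta>: "0 < \<beta>" "\<beta> < real n" and M: "M > 0"
    and div: "\<not> converges_near_0 (\<lambda>t. ennreal_powr (ennreal t / A t) (\<beta> / (real n - \<beta>)))"
  obtains N b where "\<And>l. 0 \<le> b l" "(\<Sum>l<N. ennreal (2 ^ (l * n)) * A (b l)) \<le> 1"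
    "M \<le> (\<Sum>l<N. 2 powr (l * \<beta>) * b l)"
proof -
  define \<gamma> where "\<gamma> = real n - \<beta>"
  define p where "p = \<beta> / \<gamma>"
  have \<gamma>: "\<gamma> > 0" and p: "p > 0" "\<gamma> * p = \<beta>" using \<beta> by (auto simp: \<gamma>_def p_def)
  \<comment> \<open>A Lagrange multiplier: amplitudes with
    \<open>A (b l) \<le> \<mu> * 2 powr (- l * \<gamma>) * b l\<close> have cost at most \<mu> times
    their gain, which is 1 when the gain equals M.\<close>
  define \<mu> where "\<mu> = 1 / M"
  have \<mu>: "\<mu> > 0" using M by (simp add: \<mu>_def)
  define E where "E l = {t \<in> {0<..<1}. A t \<le> ennreal (\<mu> * 2 powr (- (real l * \<gamma>)) * t)}" for l :: nat
  \<comment> \<open>Since \<open>A t / t\<close> is nondecreasing, \<open>E l\<close> is empty or an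
    interval with left end 0, and \<open>e l\<close> is its length. Inserting 0 gives the value 0 in
    the empty case.\<close>
  define e where "e l = Sup (insert 0 (E l))" for l
  have bdd: "bdd_above (insert 0 (E l))" for l by (auto simp: E_def intro!: bdd_aboveI[of _ 1])
  have e0: "e l \<ge> 0" for l unfolding e_def using bdd by (rule cSup_upper[rotated]) simp
  have eE: "t \<le> e l" if "t \<in> E l" for t l unfolding e_def using bdd that by (intro cSup_upper) auto
  \<comment> \<open>The supremum may fail to belong to \<open>E l\<close>. Its half lies below some
    point of \<open>E l\<close>, from which convexity transfers the estimate.\<close>
  have half: "A (e l / 2) \<le> ennreal (\<mu> * 2 powr (- (real l * \<gamma>)) * (e l / 2))" for l
  proof (cases "e l = 0")
    case True
    then show ?thesis using young_function_0[OF A] by simp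
  next
    case False
    then have "e l / 2 < e l" using e0[of l] by simp
    then obtain t where t: "t \<in> insert 0 (E l)" "e l / 2 < t"
      unfolding e_def using less_cSup_iff[OF _ bdd] by blast
    then have tE: "t \<in> E l" "t > 0" using e0[of l] by (auto simp: less_le_not_le)
    define \<theta> where "\<theta> = e l / 2 / t"
    have \<theta>: "0 \<le> \<theta>" "\<theta> \<le> 1" "\<theta> * t = e l / 2" using t tE e0[of l] by (auto simp: \<theta>_def)
    have "A (\<theta> * t) \<le> ennreal \<theta> * A t" using \<theta> tE by (intro young_function_scale A) auto
    also have "\<dots> \<le> ennreal \<theta> * ennreal (\<mu> * 2 powr (- (real l * \<gamma>)) * t)"
      using tE by (intro mult_left_mono) (auto simp: E_def)
    also have "\<dots> = ennreal (\<mu> * 2 powr (- (real l * \<gamma>)) * (\<theta> * t))"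
      using \<theta> tE \<mu> by (simp flip: ennreal_mult add: mult_ac)
    finally show ?thesis using \<theta> by simp
  qed
  \<comment> \<open>The factor \<open>2 powr \<beta>\<close> is the ratio of consecutive levels: the
    integrand at t is bounded through the first level that fails, the series is bounded below
    through the level just before it.\<close>
  define K where "K = 2 powr \<beta> * (1 / \<mu>) powr p"
  have K0: "K > 0" and K1: "(1 / \<mu>) powr p \<le> K"
    using \<mu> \<beta>(1) by (auto simp: K_def intro!: mult_right_mono[of 1 "2 powr \<beta>" "(1 / \<mu>) powr p", simplified] ge_one_powr_ge_zero)
  let ?f = "\<lambda>t. ennreal_powr (ennreal t / A t) p"
  let ?S = "\<lambda>t::real. \<Sum>l. ennreal (2 powr (real l * \<beta>)) * indicator {0<..e l} t"
  \<comment> \<open>Failure at level l means that \<open>t / A t\<close> is less than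
    \<open>2 powr (l * \<gamma>) / \<mu>\<close>; the power p turns \<gamma> into \<beta>.\<close>
  have level: "?f t \<le> ennreal ((1 / \<mu>) powr p * 2 powr (real l * \<beta>))"
    if "0 < t" "t < 1" "\<not> A t \<le> ennreal (\<mu> * 2 powr (- (real l * \<gamma>)) * t)" for t l
  proof -
    let ?q = "\<mu> * 2 powr (- (real l * \<gamma>))"
    have q: "?q > 0" using \<mu> by simp
    have bound: "enn2real (ennreal t / A t) \<le> 1 / ?q" and fin: "ennreal t / A t \<noteq> \<infinity>"
    proof -
      have le: "ennreal t / A t \<le> ennreal (1 / ?q)"
      proof (cases "A t")
        case (real a)
        then have "?q * t < a" using that q by (simp add: ennreal_le_iff)
        moreover have "0 < ?q * t" using that q by simp
        ultimately have "0 < a" "t / a \<le> 1 / ?q" using q by (auto simp: field_simps)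
        then show ?thesis using real that by (simp add: divide_ennreal ennreal_leI)
      qed simp
      then show "enn2real (ennreal t / A t) \<le> 1 / ?q" using q by (intro enn2real_leI) auto
      show "ennreal t / A t \<noteq> \<infinity>" using le by (auto simp: top_unique)
    qed
    have "enn2real (ennreal t / A t) powr p \<le> (1 / ?q) powr p"
      using bound p by (intro powr_mono2) auto
    also have "1 / ?q = (1 / \<mu>) * 2 powr (real l * \<gamma>)" by (simp add: powr_minus field_simps)
    also have "\<dots> powr p = (1 / \<mu>) powr p * 2 powr (real l * \<beta>)"
      unfolding p(2)[symmetric] using \<mu> by (subst powr_mult) (simp_all add: powr_powr mult.assoc)
    finally show ?thesis using fin by (simp add: ennreal_powr_def ennreal_leI)
  qed
  have ptw: "?f t * indicator {0<..<1} t \<le> ennreal K * (indicator {0<..<1} t + ?S t)" for t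
  proof (cases "0 < t \<and> t < 1")
    case True
    define P where "P l \<longleftrightarrow> A t \<le> ennreal (\<mu> * 2 powr (- (real l * \<gamma>)) * t)" for l :: nat
    have PE: "t \<in> {0<..e l}" if "P l" for l using that True eE[of t l] by (auto simp: P_def E_def)
    have level_le: "ennreal (2 powr (real l * \<beta>)) \<le> ?S t" if "P l" for l
    proof -
      have "ennreal (2 powr (real l * \<beta>)) = (\<Sum>i\<in>{l}. ennreal (2 powr (real i * \<beta>)) * indicator {0<..e i} t)"
        using PE[OF that] by simp
      also have "\<dots> \<le> ?S t" by (rule sum_le_suminf) auto
      finally show ?thesis .
    qed
    show ?thesis
    proof (cases "\<forall>l. P l")
      \<comment> \<open>Here A t = 0 and the integrand is infinite. The series is infinite as well,
        because it contains arbitrarily large terms.\<close>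
      case True
      have "?S t = \<infinity>"
      proof (rule ccontr)
        assume "?S t \<noteq> \<infinity>"
        then obtain x where x: "?S t = ennreal x" "x \<ge> 0" by (cases "?S t") auto
        obtain l :: nat where l: "real l > x" using reals_Archimedean2 by blast
        obtain j :: nat where j: "real j * \<beta> \<ge> real l" using \<beta>(1) by (metis reals_Archimedean3 less_imp_le)
        have "x < 2 ^ l" using l less_exp[of l] by (metis less_trans of_nat_less_numeral_power_cancel_iff)
        also have "2 ^ l = 2 powr real l" by (simp add: powr_realpow)
        also have "\<dots> \<le> 2 powr (real j * \<beta>)" using j by (intro powr_mono) auto
        finally show False using level_le[of j] True x by (simp add: ennreal_le_iff)
      qed
      then show ?thesis using K0 by (simp add: ennreal_mult_top)
    next
      case False
      then obtain l0 where l0: "\<not> P l0" "\<And>i. i < l0 \<Longrightarrow> P i"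
        using exists_least_iff[of "\<lambda>l. \<not> P l"] by blast
      show ?thesis
      proof (cases l0)
        case 0
        have "?f t \<le> ennreal ((1 / \<mu>) powr p)" using level[of t 0] l0(1) 0 True by (simp add: P_def)
        also have "\<dots> \<le> ennreal K" using K1 by (rule ennreal_leI)
        also have "\<dots> \<le> ennreal K * (1 + ?S t)" using mult_left_mono[of 1 "1 + ?S t" "ennreal K"] by simp
        finally show ?thesis using True by simp
      next
        case (Suc l)
        have "?f t \<le> ennreal ((1 / \<mu>) powr p * 2 powr (real l0 * \<beta>))"
          using level[of t l0] l0(1) True by (simp add: P_def)
        also have "\<dots> = ennreal K * ennreal (2 powr (real l * \<beta>))"
        proof -
          have "2 powr (real l0 * \<beta>) = 2 powr \<beta> * 2 powr (real l * \<beta>)"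
            by (simp add: Suc ring_distribs flip: powr_add)
          then show ?thesis by (simp add: K_def mult_ac flip: ennreal_mult)
        qed
        also have "\<dots> \<le> ennreal K * ?S t" using l0(2) Suc by (intro mult_left_mono level_le) auto
        also have "\<dots> \<le> ennreal K * (1 + ?S t)" by (intro mult_left_mono) auto
        finally show ?thesis using True by simp
      qed
    qed
  qed simp
  have "\<not> (\<integral>\<^sup>+t\<in>{0<..<1}. ?f t \<partial>lborel) < \<infinity>"
    using div unfolding converges_near_0_def p_def \<gamma>_def by (metis zero_less_one)
  then have "\<infinity> = (\<integral>\<^sup>+t. ?f t * indicator {0<..<1} t \<partial>lborel)"
    by (metis infinity_ennreal_def top.not_eq_extremum)
  also have "\<dots> \<le> (\<integral>\<^sup>+t. ennreal K * (indicator {0<..<1} t + ?S t) \<partial>lborel)"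
    by (rule nn_integral_mono) (rule ptw)
  also have "\<dots> = ennreal K * (1 + (\<Sum>l. ennreal (2 powr (real l * \<beta>)) * ennreal (e l)))"
    using e0 by (simp add: nn_integral_cmult nn_integral_add nn_integral_suminf nn_integral_cmult_indicator)
  finally have inf: "(\<Sum>l. ennreal (2 powr (real l * \<beta>) * e l)) = \<infinity>"
    using e0 by (simp add: ennreal_mult_eq_top_iff top_unique ennreal_mult)
  obtain N where N: "M \<le> (\<Sum>l<N. 2 powr (real l * \<beta>) * (e l / 2))"
  proof (rule ccontr)
    assume "\<not> thesis"
    then have "(\<Sum>l<N. 2 powr (real l * \<beta>) * e l) \<le> 2 * M" for N
      using that[of N] by (force simp: sum_divide_distrib[symmetric])
    then have "(\<Sum>l<N. ennreal (2 powr (real l * \<beta>) * e l)) \<le> ennreal (2 * M)" for N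
      using e0 by (simp add: ennreal_leI)
    then have "(\<Sum>l. ennreal (2 powr (real l * \<beta>) * e l)) \<le> ennreal (2 * M)"
      by (simp add: suminf_eq_SUP SUP_least)
    then show False using inf by (simp add: top_unique)
  qed
  let ?T = "\<Sum>l<N. 2 powr (real l * \<beta>) * (e l / 2)"
  \<comment> \<open>Shrinking by \<rho> brings the gain from at least M down to exactly M, and with
    it the cost to at most \<open>\<mu> * M = 1\<close>.\<close>
  define \<rho> where "\<rho> = M / ?T"
  have \<rho>: "0 \<le> \<rho>" "\<rho> \<le> 1" "\<rho> * ?T = M" using N M by (auto simp: \<rho>_def)
  show thesis
  proof
    show "0 \<le> \<rho> * (e l / 2)" for l using \<rho> e0 by simp
    have "ennreal (2 ^ (l * n)) * A (\<rho> * (e l / 2)) \<le> ennreal (\<rho> * \<mu> * (2 powr (real l * \<beta>) * (e l / 2)))" for l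
    proof -
      have "A (\<rho> * (e l / 2)) \<le> ennreal \<rho> * A (e l / 2)"
        using \<rho> e0 by (intro young_function_scale A) auto
      also have "\<dots> \<le> ennreal \<rho> * ennreal (\<mu> * 2 powr (- (real l * \<gamma>)) * (e l / 2))"
        by (intro mult_left_mono half) auto
      finally have "ennreal (2 ^ (l * n)) * A (\<rho> * (e l / 2)) \<le>
          ennreal (2 ^ (l * n)) * (ennreal \<rho> * ennreal (\<mu> * 2 powr (- (real l * \<gamma>)) * (e l / 2)))"
        by (rule mult_left_mono) simp
      also have "\<dots> = ennreal (2 ^ (l * n) * (\<rho> * (\<mu> * 2 powr (- (real l * \<gamma>)) * (e l / 2))))"
        using \<rho> \<mu> e0 by (intro ennreal_mult3) auto
      also have "2 ^ (l * n) * (\<rho> * (\<mu> * 2 powr (- (real l * \<gamma>)) * (e l / 2))) =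
          \<rho> * \<mu> * ((2 powr (real l * real n) * 2 powr (- (real l * \<gamma>))) * (e l / 2))"
        by (simp flip: powr_realpow)
      also have "2 powr (real l * real n) * 2 powr (- (real l * \<gamma>)) = 2 powr (real l * \<beta>)"
        unfolding powr_add[symmetric] by (simp add: \<gamma>_def algebra_simps)
      finally show ?thesis .
    qed
    then have "(\<Sum>l<N. ennreal (2 ^ (l * n)) * A (\<rho> * (e l / 2))) \<le>
        (\<Sum>l<N. ennreal (\<rho> * \<mu> * (2 powr (real l * \<beta>) * (e l / 2))))"
      by (rule sum_mono)
    also have "\<dots> = ennreal (\<mu> * (\<rho> * ?T))"
      using \<rho> \<mu> e0 by (subst sum_ennreal) (auto simp: sum_distrib_left mult_ac)
    also have "\<dots> = 1" using \<rho> M by (simp add: \<mu>_def)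
    finally show "(\<Sum>l<N. ennreal (2 ^ (l * n)) * A (\<rho> * (e l / 2))) \<le> 1" .
    have "(\<Sum>l<N. 2 powr (real l * \<beta>) * (\<rho> * (e l / 2))) = \<rho> * ?T"
      by (simp add: sum_distrib_left mult_ac)
    then show "M \<le> (\<Sum>l<N. 2 powr (real l * \<beta>) * (\<rho> * (e l / 2)))" using \<rho> by simp
  qed
qed

section \<open>The modular of a dyadic superposition\<close>

text \<open>Up to a constant, a bound for the Hoelder quotient of order \<sigma> of a bounded
  Lipschitz function, with the distance \<tau> in units of the scale of the function: the Lipschitz
  bound serves short distances, boundedness long ones.\<close>

definition scale_kernel :: "real \<Rightarrow> real \<Rightarrow> real" where
  "scale_kernel \<sigma> \<tau> = min \<tau> 1 * \<tau> powr (- \<sigma>)"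

lemma scale_kernel_nonneg: "\<tau> \<ge> 0 \<Longrightarrow> scale_kernel \<sigma> \<tau> \<ge> 0"
  by (simp add: scale_kernel_def)

lemma scale_kernel_le1: "0 < \<tau> \<Longrightarrow> \<tau> \<le> 1 \<Longrightarrow> scale_kernel \<sigma> \<tau> = \<tau> powr (1 - \<sigma>)"
  by (simp add: scale_kernel_def powr_diff powr_minus field_simps)

lemma scale_kernel_ge1: "1 \<le> \<tau> \<Longrightarrow> scale_kernel \<sigma> \<tau> = \<tau> powr (- \<sigma>)"
  by (simp add: scale_kernel_def)

lemma scale_kernel_borel [measurable]: "scale_kernel \<sigma> \<in> borel_measurable borel"
  unfolding scale_kernel_def[abs_def] by measurable

text \<open>The surviving terms lie below 1 and grow geometrically, so the last one dominates the
  sum. The induction carries \<open>min (c * r ^ N) r\<close>, which follows the telescoping bound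
  until the truncation sets in and is capped afterwards.\<close>

lemma truncated_geometric_up:
  fixes c r :: real
  assumes "c > 0" "r > 1"
  shows "(\<Sum>l<N. if c * r ^ l \<le> 1 then c * r ^ l else 0) \<le> r / (r - 1)"
proof -
  have "(\<Sum>l<N. if c * r ^ l \<le> 1 then c * r ^ l else 0) \<le> min (c * r ^ N) r / (r - 1)" for N
  proof (induction N)
    case 0
    then show ?case using assms by simp
  next
    case (Suc N)
    show ?case
    proof (cases "c * r ^ N \<le> 1")
      case True
      then have "min (c * r ^ Suc N) r = r * (c * r ^ N)"
        using assms mult_left_mono[OF True, of r] by (simp add: min_def mult_ac)
      moreover have "min (c * r ^ N) r = c * r ^ N" using True assms by simp
      moreover have "a / (r - 1) + a = r * a / (r - 1)" for a using assms by (simp add: field_simps)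
      ultimately show ?thesis
        using True add_right_mono[OF Suc, of "c * r ^ N"] by (simp del: power_Suc)
    next
      case False
      have "min (c * r ^ N) r \<le> min (c * r ^ Suc N) r"
        using assms by (intro min.mono) (auto simp: mult_left_le_one_le)
      then have "min (c * r ^ N) r / (r - 1) \<le> min (c * r ^ Suc N) r / (r - 1)"
        using assms by (intro divide_right_mono) auto
      then show ?thesis using Suc False by simp
    qed
  qed
  also have "min (c * r ^ N) r / (r - 1) \<le> r / (r - 1)"
    using assms by (intro divide_right_mono) auto
  finally show ?thesis .
qed

text \<open>For a decreasing progression the first surviving term dominates. The bound in the
  induction measures how far the progression has dropped below 1, and is 0 as long as it has
  not.\<close>

lemma truncated_geometric_down:
  fixes c q :: real
  assumes "c > 0" "0 < q" "q < 1"
  shows "(\<Sum>l<N. if c * q ^ l \<le> 1 then c * q ^ l else 0) \<le> 1 / (1 - q)"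
proof -
  have "(\<Sum>l<N. if c * q ^ l \<le> 1 then c * q ^ l else 0) \<le> (1 - min 1 (c * q ^ N)) / (1 - q)" for N
  proof (induction N)
    case 0
    then show ?case using assms by simp
  next
    case (Suc N)
    have le: "c * q ^ Suc N \<le> c * q ^ N" using assms by (simp add: mult_left_le_one_le)
    show ?case
    proof (cases "c * q ^ N \<le> 1")
      case True
      then have "min 1 (c * q ^ Suc N) = q * (c * q ^ N)" "min 1 (c * q ^ N) = c * q ^ N"
        using le by (auto simp: mult_ac)
      moreover have "(1 - a) / (1 - q) + a = (1 - q * a) / (1 - q)" for a
        using assms by (simp add: field_simps)
      ultimately show ?thesis
        using True add_right_mono[OF Suc, of "c * q ^ N"] by (simp del: power_Suc)
    next
      case False
      have "(1 - min 1 (c * q ^ N)) / (1 - q) \<le> (1 - min 1 (c * q ^ Suc N)) / (1 - q)"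
        using assms min.mono[OF order_refl[of 1] le]
        by (intro divide_right_mono) (simp_all del: power_Suc)
      then show ?thesis using Suc False by simp
    qed
  qed
  also have "(1 - min 1 (c * q ^ N)) / (1 - q) \<le> 1 / (1 - q)"
    using assms by (intro divide_right_mono) auto
  finally show ?thesis .
qed

text \<open>Levels with \<open>2 ^ l \<ge> \<tau>\<close> contribute a geometric progression of
  ratio \<open>2 powr (\<sigma> - 1)\<close>, the others one of ratio
  \<open>2 powr \<sigma>\<close>, and all terms are at most 1. Both \<open>0 < \<sigma>\<close> and
  \<open>\<sigma> < 1\<close> enter here, and the cap at 1 makes the bound uniform in \<tau> and
  N.\<close>

lemma scale_kernel_dyadic_sum:
  assumes \<sigma>: "0 < \<sigma>" "\<sigma> < 1"
  obtains C where "C > 0" "\<And>\<tau> N. \<tau> \<ge> 0 \<Longrightarrow> (\<Sum>l<N. scale_kernel \<sigma> (\<tau> / 2 ^ l)) \<le> C"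
proof
  let ?r = "2 powr \<sigma>" and ?q = "2 powr (\<sigma> - 1)"
  have r: "?r > 1" and q: "0 < ?q" "?q < 1"
    using \<sigma> by (auto simp: powr_less_one)
  show "?r / (?r - 1) + 1 / (1 - ?q) > 0" using r q by (intro add_pos_pos divide_pos_pos) auto
  fix \<tau> :: real and N :: nat assume "\<tau> \<ge> 0"
  show "(\<Sum>l<N. scale_kernel \<sigma> (\<tau> / 2 ^ l)) \<le> ?r / (?r - 1) + 1 / (1 - ?q)"
  proof (cases "\<tau> = 0")
    case True
    then show ?thesis using r q by (simp add: scale_kernel_def)
  next
    case False
    with \<open>\<tau> \<ge> 0\<close> have \<tau>: "\<tau> > 0" by simp
    let ?x = "\<lambda>l. \<tau> powr (- \<sigma>) * ?r ^ l" and ?y = "\<lambda>l. \<tau> powr (1 - \<sigma>) * ?q ^ l"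
    have pw: "(2 powr a) ^ l = (2 ^ l) powr a" for a :: real and l :: nat
      by (simp add: powr_powr mult.commute flip: powr_realpow)
    have "scale_kernel \<sigma> (\<tau> / 2 ^ l) \<le> (if ?x l \<le> 1 then ?x l else 0) + (if ?y l \<le> 1 then ?y l else 0)" for l
    proof (cases "\<tau> / 2 ^ l \<le> 1")
      case True
      have y: "(\<tau> / 2 ^ l) powr (1 - \<sigma>) = ?y l"
        using \<tau> unfolding pw by (simp add: powr_divide powr_minus_divide[of _ "1 - \<sigma>", simplified] field_simps)
      have "(\<tau> / 2 ^ l) powr (1 - \<sigma>) \<le> 1" using True \<tau> \<sigma> by (intro powr_le1) auto
      moreover have "0 \<le> ?x l" by simp
      ultimately show ?thesis using y True \<tau> by (simp add: scale_kernel_le1)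
    next
      case False
      have x: "(\<tau> / 2 ^ l) powr (- \<sigma>) = ?x l"
        using \<tau> unfolding pw by (simp add: powr_divide powr_minus field_simps)
      have "(\<tau> / 2 ^ l) powr (- \<sigma>) \<le> 1"
        using False \<sigma> ge_one_powr_ge_zero[of "\<tau> / 2 ^ l" \<sigma>] by (simp add: powr_minus inverse_le_1_iff)
      moreover have "0 \<le> ?y l" by simp
      ultimately show ?thesis using x False by (simp add: scale_kernel_ge1)
    qed
    then have "(\<Sum>l<N. scale_kernel \<sigma> (\<tau> / 2 ^ l)) \<le>
        (\<Sum>l<N. if ?x l \<le> 1 then ?x l else 0) + (\<Sum>l<N. if ?y l \<le> 1 then ?y l else 0)"
      unfolding sum.distrib[symmetric] by (rule sum_mono)
    also have "\<dots> \<le> ?r / (?r - 1) + 1 / (1 - ?q)"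
      using \<tau> r q by (intro add_mono truncated_geometric_up truncated_geometric_down) auto
    finally show ?thesis .
  qed
qed

lemma dyadic_below:
  assumes "0 < t" "t \<le> (1::real)"
  obtains j :: nat where "1 / 2 ^ Suc j < t" "t \<le> 1 / 2 ^ j"
proof -
  obtain n :: nat where "(1 / 2) ^ n < t" using real_arch_pow_inv[of t "1 / 2"] assms by auto
  define m where "m = (LEAST m. (1 / 2 :: real) ^ m < t)"
  have m: "(1 / 2) ^ m < t" unfolding m_def using \<open>(1 / 2) ^ n < t\<close> by (rule LeastI)
  then have "m \<noteq> 0" using assms by (auto intro: Nat.gr0I)
  then obtain j where j: "m = Suc j" using not0_implies_Suc by blast
  then have "\<not> (1 / 2) ^ j < t" using not_less_Least[of j "\<lambda>m. (1 / 2 :: real) ^ m < t"] by (simp add: m_def)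
  then show ?thesis using that[of j] m j by (simp add: power_one_over)
qed

lemma dyadic_above:
  assumes "(1::real) \<le> t"
  obtains j :: nat where "2 ^ j \<le> t" "t < 2 ^ Suc j"
proof -
  obtain j where "1 / 2 ^ Suc j < 1 / t" "1 / t \<le> 1 / 2 ^ j"
    using dyadic_below[of "1 / t"] assms by auto
  then show ?thesis using that[of j] assms by (simp add: field_simps)
qed

text \<open>The kernel of the Gagliardo seminorm of order \<open>\<sigma>\<close> and exponent 1 of a bounded Lipschitz function.\<close>

definition gagliardo_kernel :: "real \<Rightarrow> real \<Rightarrow> real^'n::finite \<Rightarrow> ennreal" where
  "gagliardo_kernel \<sigma> R z = ennreal (scale_kernel \<sigma> (norm z / R)) / ennreal (norm z ^ CARD('n))"

lemma gagliardo_kernel_borel [measurable]: "gagliardo_kernel \<sigma> R \<in> borel_measurable borel"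
  unfolding gagliardo_kernel_def[abs_def] by measurable

text \<open>The kernel behaves like \<open>norm z powr (1 - \<sigma> - n)\<close> near 0 and like
  \<open>norm z powr (- \<sigma> - n)\<close> at infinity. Each dyadic annulus is enlarged to its
  outer ball, whose volume cancels the power n up to a factor \<open>2 ^ n\<close> and leaves
  geometric series of ratios q and p.\<close>

lemma gagliardo_kernel_integrable:
  assumes \<sigma>: "0 < \<sigma>" "\<sigma> < 1"
  shows "(\<integral>\<^sup>+z. gagliardo_kernel \<sigma> 1 (z :: real^'n::finite) \<partial>lborel) < \<infinity>"
proof -
  let ?n = "CARD('n)"
  define p where "p = 2 powr (- \<sigma>)"
  define q where "q = 2 powr (\<sigma> - 1)"
  have pq: "0 < p" "p < 1" "0 < q" "q < 1"
    using \<sigma> by (auto simp: p_def q_def powr_less_one)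
  let ?a = "\<lambda>j z. ennreal (q ^ j * (2 * 2 ^ j) ^ ?n) * indicator (cball (0::real^'n) (1 / 2 ^ j)) z"
  let ?b = "\<lambda>j z. ennreal (p ^ j / (2 ^ j) ^ ?n) * indicator (cball (0::real^'n) (2 * 2 ^ j)) z"
  have pw: "(2 powr a) ^ l = (2 ^ l) powr a" for a :: real and l :: nat
    by (simp add: powr_powr mult.commute flip: powr_realpow)
  have single: "f j \<le> (\<Sum>i. f i)" for f :: "nat \<Rightarrow> ennreal" and j
    using sum_le_suminf[of f "{j}"] by simp
  have ptw: "gagliardo_kernel \<sigma> 1 z \<le> (\<Sum>j. ?a j z) + (\<Sum>j. ?b j z)" for z :: "real^'n"
  proof (cases "z = 0")
    case False
    then have z: "norm z > 0" by simp
    show ?thesis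
    proof (cases "norm z \<le> 1")
      case True
      then obtain j where j: "1 / 2 ^ Suc j < norm z" "norm z \<le> 1 / 2 ^ j"
        using dyadic_below z by blast
      have "scale_kernel \<sigma> (norm z) = norm z powr (1 - \<sigma>)" using True z by (simp add: scale_kernel_le1)
      also have "\<dots> \<le> (1 / 2 ^ j) powr (1 - \<sigma>)" using j z \<sigma> by (intro powr_mono2) auto
      also have "\<dots> = q ^ j"
        unfolding q_def pw by (simp add: powr_divide powr_diff field_simps)
      finally have 1: "scale_kernel \<sigma> (norm z) \<le> q ^ j" .
      have "(1 / 2 ^ Suc j) ^ ?n \<le> norm z ^ ?n" using j by (intro power_mono) auto
      then have 2: "1 / norm z ^ ?n \<le> (2 * 2 ^ j) ^ ?n" using z by (simp add: field_simps power_mult_distrib)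
      have "gagliardo_kernel \<sigma> 1 z = ennreal (scale_kernel \<sigma> (norm z) * (1 / norm z ^ ?n))"
        using z by (simp add: gagliardo_kernel_def divide_ennreal scale_kernel_nonneg)
      also have "\<dots> \<le> ennreal (q ^ j * (2 * 2 ^ j) ^ ?n)"
        using 1 2 pq z by (intro ennreal_leI mult_mono) auto
      also have "\<dots> = ?a j z" using j by simp
      also have "\<dots> \<le> (\<Sum>j. ?a j z)" by (rule single)
      finally show ?thesis by (rule order_trans) simp
    next
      case False
      then obtain j where j: "2 ^ j \<le> norm z" "norm z < 2 ^ Suc j"
        using dyadic_above[of "norm z"] by force
      have "scale_kernel \<sigma> (norm z) = norm z powr (- \<sigma>)" using False by (simp add: scale_kernel_ge1)
      also have "\<dots> \<le> (2 ^ j) powr (- \<sigma>)" using j z \<sigma> by (intro powr_mono2') auto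
      also have "\<dots> = p ^ j" unfolding p_def pw by simp
      finally have 1: "scale_kernel \<sigma> (norm z) \<le> p ^ j" .
      have "(2 ^ j) ^ ?n \<le> norm z ^ ?n" using j by (intro power_mono) auto
      then have 2: "1 / norm z ^ ?n \<le> 1 / (2 ^ j) ^ ?n" using z by (intro divide_left_mono) auto
      have "gagliardo_kernel \<sigma> 1 z = ennreal (scale_kernel \<sigma> (norm z) * (1 / norm z ^ ?n))"
        using z by (simp add: gagliardo_kernel_def divide_ennreal scale_kernel_nonneg)
      also have "\<dots> \<le> ennreal (p ^ j * (1 / (2 ^ j) ^ ?n))"
        using 1 2 pq z by (intro ennreal_leI mult_mono) auto
      also have "\<dots> = ?b j z" using j by simp
      also have "\<dots> \<le> (\<Sum>j. ?b j z)" by (rule single)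
      finally show ?thesis by (rule order_trans) simp
    qed
  qed (simp add: gagliardo_kernel_def scale_kernel_def)
  let ?V = "unit_ball_vol (real ?n)"
  have vol: "emeasure lborel (cball (0::real^'n) r) = ennreal (?V * r ^ ?n)" if "r \<ge> 0" for r
    using emeasure_cball[OF that, of "0::real^'n"] by simp
  have ia: "(\<integral>\<^sup>+z. ?a j z \<partial>lborel) = ennreal (2 ^ ?n * ?V * q ^ j)" for j
  proof -
    have "(\<integral>\<^sup>+z. ?a j z \<partial>lborel) = ennreal (q ^ j * (2 * 2 ^ j) ^ ?n) * ennreal (?V * (1 / 2 ^ j) ^ ?n)"
      by (subst nn_integral_cmult_indicator) (simp_all add: vol)
    also have "\<dots> = ennreal ((q ^ j * (2 * 2 ^ j) ^ ?n) * (?V * (1 / 2 ^ j) ^ ?n))"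
      using pq by (intro ennreal_mult[symmetric]) auto
    also have "(q ^ j * (2 * 2 ^ j) ^ ?n) * (?V * (1 / 2 ^ j) ^ ?n) = 2 ^ ?n * ?V * q ^ j"
      by (simp add: power_mult_distrib power_one_over)
    finally show ?thesis .
  qed
  have ib: "(\<integral>\<^sup>+z. ?b j z \<partial>lborel) = ennreal (2 ^ ?n * ?V * p ^ j)" for j
  proof -
    have "(\<integral>\<^sup>+z. ?b j z \<partial>lborel) = ennreal (p ^ j / (2 ^ j) ^ ?n) * ennreal (?V * (2 * 2 ^ j) ^ ?n)"
      by (subst nn_integral_cmult_indicator) (simp_all add: vol)
    also have "\<dots> = ennreal ((p ^ j / (2 ^ j) ^ ?n) * (?V * (2 * 2 ^ j) ^ ?n))"
      using pq by (intro ennreal_mult[symmetric]) auto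
    also have "(p ^ j / (2 ^ j) ^ ?n) * (?V * (2 * 2 ^ j) ^ ?n) = 2 ^ ?n * ?V * p ^ j"
      by (simp add: power_mult_distrib)
    finally show ?thesis .
  qed
  have ma: "?a j \<in> borel_measurable lborel" for j
    by (intro borel_measurable_times_ennreal borel_measurable_const borel_measurable_indicator) simp
  have mb: "?b j \<in> borel_measurable lborel" for j
    by (intro borel_measurable_times_ennreal borel_measurable_const borel_measurable_indicator) simp
  have geo: "(\<Sum>j. ennreal (2 ^ ?n * ?V * r ^ j)) < \<infinity>" if "0 < r" "r < 1" for r
    using that by (subst suminf_ennreal2) (auto intro!: summable_mult summable_geometric)
  have "(\<integral>\<^sup>+z. gagliardo_kernel \<sigma> 1 (z :: real^'n) \<partial>lborel) \<le> (\<integral>\<^sup>+z. (\<Sum>j. ?a j z) + (\<Sum>j. ?b j z) \<partial>lborel)"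
    by (intro nn_integral_mono ptw)
  also have "\<dots> = (\<Sum>j. ennreal (2 ^ ?n * ?V * q ^ j)) + (\<Sum>j. ennreal (2 ^ ?n * ?V * p ^ j))"
  proof (subst nn_integral_add)
    show "(\<lambda>z. \<Sum>j. ?a j z) \<in> borel_measurable lborel"
      using ma by (intro borel_measurable_suminf_order) simp
    show "(\<lambda>z. \<Sum>j. ?b j z) \<in> borel_measurable lborel"
      using mb by (intro borel_measurable_suminf_order) simp
    have "(\<integral>\<^sup>+z. (\<Sum>j. ?a j z) \<partial>lborel) = (\<Sum>j. \<integral>\<^sup>+z. ?a j z \<partial>lborel)"
      by (intro nn_integral_suminf ma)
    moreover have "(\<integral>\<^sup>+z. (\<Sum>j. ?b j z) \<partial>lborel) = (\<Sum>j. \<integral>\<^sup>+z. ?b j z \<partial>lborel)"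
      by (intro nn_integral_suminf mb)
    ultimately show "(\<integral>\<^sup>+z. (\<Sum>j. ?a j z) \<partial>lborel) + (\<integral>\<^sup>+z. (\<Sum>j. ?b j z) \<partial>lborel) =
        (\<Sum>j. ennreal (2 ^ ?n * ?V * q ^ j)) + (\<Sum>j. ennreal (2 ^ ?n * ?V * p ^ j))"
      by (simp only: ia ib)
  qed
  also have "\<dots> < \<infinity>" 
    using geo[of p, OF pq(1,2)] geo[of q, OF pq(3,4)]
    unfolding infinity_ennreal_def ennreal_add_less_top by blast
  finally show ?thesis .
qed

text \<open>The power \<open>norm z ^ n\<close> in the denominator compensates the Jacobian of a
  dilation, so all dyadic levels have the same kernel mass.\<close>

lemma gagliardo_kernel_scale:
  assumes "R > 0"
  shows "(\<integral>\<^sup>+z. gagliardo_kernel \<sigma> R (z :: real^'n::finite) \<partial>lborel) =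
    (\<integral>\<^sup>+z. gagliardo_kernel \<sigma> 1 (z :: real^'n) \<partial>lborel)"
proof -
  let ?n = "CARD('n)"
  have "(\<integral>\<^sup>+z. gagliardo_kernel \<sigma> R (z :: real^'n) \<partial>lborel) =
      (\<integral>\<^sup>+z. gagliardo_kernel \<sigma> R z \<partial>density (distr lborel borel (\<lambda>x::real^'n. 0 + R *\<^sub>R x)) (\<lambda>_. \<bar>R\<bar> ^ ?n))"
    using lborel_affine[of R "0::real^'n"] assms by simp
  also have "\<dots> = (\<integral>\<^sup>+z. ennreal (R ^ ?n) * gagliardo_kernel \<sigma> R (R *\<^sub>R z :: real^'n) \<partial>lborel)"
    using assms by (subst nn_integral_density) (simp_all add: nn_integral_distr)
  also have "\<dots> = (\<integral>\<^sup>+z. gagliardo_kernel \<sigma> 1 (z :: real^'n) \<partial>lborel)"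
  proof (intro nn_integral_cong)
    fix z :: "real^'n"
    show "ennreal (R ^ ?n) * gagliardo_kernel \<sigma> R (R *\<^sub>R z) = gagliardo_kernel \<sigma> 1 z"
    proof (cases "z = 0")
      case True
      then show ?thesis by (simp add: gagliardo_kernel_def scale_kernel_def)
    next
      case False
      then show ?thesis using assms
        by (simp add: gagliardo_kernel_def scale_kernel_nonneg divide_ennreal power_mult_distrib
            flip: ennreal_mult)
    qed
  qed
  finally show ?thesis .
qed

lemma lborel_translation_dist:
  fixes f :: "real^'n::finite \<Rightarrow> ennreal"
  assumes [measurable]: "f \<in> borel_measurable borel"
  shows "(\<integral>\<^sup>+y. f (y - x) \<partial>lborel) = (\<integral>\<^sup>+y. f y \<partial>lborel)"
proof -
  have "(\<integral>\<^sup>+y. f y \<partial>lborel) = (\<integral>\<^sup>+y. f y \<partial>distr lborel borel (\<lambda>y. - x + y))"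
    unfolding lborel_distr_plus ..
  also have "\<dots> = (\<integral>\<^sup>+y. f (- x + y) \<partial>lborel)" by (rule nn_integral_distr) auto
  finally show ?thesis by simp
qed

text \<open>The sum of indicators covers all pairs with at least one point in the ball, the only
  pairs at which a function supported there can differ. Integrating out the other point by Tonelli
  and translation leaves the volume of the ball, which is the source of the weights
  \<open>2 ^ (l * n)\<close>.\<close>

lemma gagliardo_kernel_double_integral:
  assumes "R > 0" "r \<ge> 0"
  shows "(\<integral>\<^sup>+x. \<integral>\<^sup>+y. gagliardo_kernel \<sigma> R (y - x :: real^'n::finite) *
      (indicator (cball 0 r) x + indicator (cball 0 r) y) \<partial>lborel \<partial>lborel) =
    ennreal (2 * unit_ball_vol (real CARD('n)) * r ^ CARD('n)) *
      (\<integral>\<^sup>+z. gagliardo_kernel \<sigma> 1 (z :: real^'n) \<partial>lborel)"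
proof -
  let ?h = "gagliardo_kernel \<sigma> R :: real^'n \<Rightarrow> ennreal"
  define S :: "real^'n \<Rightarrow> ennreal" where "S x = indicator (cball 0 r) x" for x
  let ?I = "\<integral>\<^sup>+z. gagliardo_kernel \<sigma> 1 (z :: real^'n) \<partial>lborel"
  have sym: "?h (y - x) = ?h (x - y)" for x y by (simp add: gagliardo_kernel_def norm_minus_commute)
  have inner: "(\<integral>\<^sup>+y. ?h (y - x) \<partial>lborel) = ?I" for x
    using lborel_translation_dist[of ?h x] gagliardo_kernel_scale[OF assms(1)] by simp
  have [measurable]: "S \<in> borel_measurable borel"
    unfolding S_def[abs_def] by (intro borel_measurable_indicator) simp
  have intS: "(\<integral>\<^sup>+x. S x \<partial>lborel) = emeasure lborel (cball (0::real^'n) r)"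
    unfolding S_def by (rule nn_integral_indicator) simp
  have vol: "(\<integral>\<^sup>+x. S x * ?I \<partial>lborel) = ennreal (unit_ball_vol (real CARD('n)) * r ^ CARD('n)) * ?I"
    using assms emeasure_cball[of r "0::real^'n"] by (simp add: nn_integral_multc intS)
  have 1: "(\<integral>\<^sup>+x. \<integral>\<^sup>+y. ?h (y - x) * S x \<partial>lborel \<partial>lborel) = (\<integral>\<^sup>+x. S x * ?I \<partial>lborel)"
  proof (intro nn_integral_cong)
    fix x :: "real^'n"
    show "(\<integral>\<^sup>+y. ?h (y - x) * S x \<partial>lborel) = S x * ?I"
      by (subst nn_integral_multc) (simp_all add: inner mult.commute)
  qed
  have "(\<integral>\<^sup>+x. \<integral>\<^sup>+y. ?h (y - x) * S y \<partial>lborel \<partial>lborel) =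
      (\<integral>\<^sup>+y. \<integral>\<^sup>+x. ?h (y - x) * S y \<partial>lborel \<partial>lborel)"
    by (rule lborel_pair.Fubini') measurable
  also have "\<dots> = (\<integral>\<^sup>+x. S x * ?I \<partial>lborel)"
  proof (intro nn_integral_cong)
    fix y :: "real^'n"
    have "(\<integral>\<^sup>+x. ?h (y - x) * S y \<partial>lborel) = (\<integral>\<^sup>+x. ?h (x - y) * S y \<partial>lborel)"
      by (simp only: sym)
    also have "\<dots> = S y * ?I"
      by (subst nn_integral_multc) (simp_all add: inner mult.commute)
    finally show "(\<integral>\<^sup>+x. ?h (y - x) * S y \<partial>lborel) = S y * ?I" .
  qed
  finally have 2: "(\<integral>\<^sup>+x. \<integral>\<^sup>+y. ?h (y - x) * S y \<partial>lborel \<partial>lborel) = (\<integral>\<^sup>+x. S x * ?I \<partial>lborel)" .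
  have "(\<integral>\<^sup>+x. \<integral>\<^sup>+y. ?h (y - x) * (S x + S y) \<partial>lborel \<partial>lborel) =
      (\<integral>\<^sup>+x. (\<integral>\<^sup>+y. ?h (y - x) * S x \<partial>lborel) + (\<integral>\<^sup>+y. ?h (y - x) * S y \<partial>lborel) \<partial>lborel)"
    unfolding distrib_left by (intro nn_integral_cong nn_integral_add) measurable
  also have "\<dots> = (\<integral>\<^sup>+x. \<integral>\<^sup>+y. ?h (y - x) * S x \<partial>lborel \<partial>lborel) +
      (\<integral>\<^sup>+x. \<integral>\<^sup>+y. ?h (y - x) * S y \<partial>lborel \<partial>lborel)"
    by (intro nn_integral_add) measurable
  also have "\<dots> = ennreal (2 * unit_ball_vol (real CARD('n)) * r ^ CARD('n)) * ?I"
  proof -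
    have "ennreal (2 * unit_ball_vol (real CARD('n)) * r ^ CARD('n)) =
        ennreal (unit_ball_vol (real CARD('n)) * r ^ CARD('n)) + ennreal (unit_ball_vol (real CARD('n)) * r ^ CARD('n))"
      using assms by (subst ennreal_plus[symmetric]) auto
    then show ?thesis unfolding 1 2 vol by (simp only: distrib_right)
  qed
  finally show ?thesis unfolding S_def .
qed

lemma L2_set_sum_le:
  assumes "finite L"
  shows "L2_set (\<lambda>w. \<Sum>l\<in>L. f l w) I \<le> (\<Sum>l\<in>L. L2_set (f l) I)"
  using assms
proof induction
  case (insert l L)
  have "L2_set (\<lambda>w. f l w + (\<Sum>l\<in>L. f l w)) I \<le> L2_set (\<lambda>w. f l w) I + L2_set (\<lambda>w. \<Sum>l\<in>L. f l w) I"
    by (rule L2_set_triangle_ineq)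
  also have "\<dots> \<le> L2_set (\<lambda>w. f l w) I + (\<Sum>l\<in>L. L2_set (f l) I)"
    using insert.IH by simp
  finally show ?case using insert.hyps by simp
qed (simp add: L2_set_def)

text \<open>By Jensen's inequality, with the dyadically summable weights
  \<open>d (x / 2^l) (y / 2^l) / (\<bar>x - y\<bar> / 2^l) powr \<sigma>\<close>, the modular of a superposition of dyadic
  dilations reduces to Gagliardo seminorms of exponent 1 of the single profile.\<close>

lemma J_dyadic_superposition:
  fixes g :: "'i \<Rightarrow> real^'n::finite \<Rightarrow> real"
  assumes \<sigma>: "0 < \<sigma>" "\<sigma> < 1" and I: "finite I" and K: "K > 0" and r: "r > 0"
    and lip: "\<And>w x y. w \<in> I \<Longrightarrow> \<bar>g w x - g w y\<bar> \<le> K * min (dist x y) 1"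
    and supp: "\<And>w x. w \<in> I \<Longrightarrow> norm x > r \<Longrightarrow> g w x = 0"
  obtains C D where "C > 0" "D > 0"
    "\<And>A b N. young_function A \<Longrightarrow> (\<And>l. 0 \<le> b l) \<Longrightarrow>
      J \<sigma> A I (\<lambda>w x. \<Sum>l<N. b l * 2 powr (real l * \<sigma>) * g w ((1 / 2 ^ l) *\<^sub>R x))
        \<le> ennreal D * (\<Sum>l<N. ennreal (2 ^ (l * CARD('n))) * A (C * b l))"
proof -
  let ?n = "CARD('n)"
  obtain C0 where C0: "C0 > 0" "\<And>\<tau> N. \<tau> \<ge> 0 \<Longrightarrow> (\<Sum>l<N. scale_kernel \<sigma> (\<tau> / 2 ^ l)) \<le> C0"
    using scale_kernel_dyadic_sum[OF \<sigma>] by blast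
  \<comment> \<open>The Euclidean norm is bounded by the sum of the moduli of the components; the
    summand 1 keeps M positive for empty I.\<close>
  define M where "M = (real (card I) + 1) * K"
  have M: "M > 0" using K by (simp add: M_def)
  define C where "C = M * C0"
  have C: "C > 0" using M C0 by (simp add: C_def)
  obtain G where G: "(\<integral>\<^sup>+z. gagliardo_kernel \<sigma> 1 (z :: real^'n) \<partial>lborel) = ennreal G" "G \<ge> 0"
    using gagliardo_kernel_integrable[OF \<sigma>, where 'n='n] by (cases "\<integral>\<^sup>+z. gagliardo_kernel \<sigma> 1 (z :: real^'n) \<partial>lborel") auto
  \<comment> \<open>\<open>M / C\<close> comes from the size of the Jensen weights, the rest of the
    product from \<open>gagliardo_kernel_double_integral\<close>; the summand 1 secures
    positivity.\<close>
  define D where "D = (M / C) * (2 * unit_ball_vol (real ?n) * r ^ ?n) * G + 1"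
  have D: "D > 0" using M C r G by (simp add: D_def add_nonneg_pos)
  define d where "d l x y = L2_set (\<lambda>w. g w ((1 / 2 ^ l) *\<^sub>R x) - g w ((1 / 2 ^ l) *\<^sub>R y)) I" for l :: nat and x y
  define S :: "nat \<Rightarrow> real^'n \<Rightarrow> ennreal" where "S l x = indicator (cball 0 (r * 2 ^ l)) x" for l :: nat and x :: "real^'n"
  have d0: "0 \<le> d l x y" for l x y by (simp add: d_def)
  have d_le: "d l x y \<le> M * min (dist x y / 2 ^ l) 1" for l x y
  proof -
    have "d l x y \<le> (\<Sum>w\<in>I. \<bar>g w ((1 / 2 ^ l) *\<^sub>R x) - g w ((1 / 2 ^ l) *\<^sub>R y)\<bar>)"
      unfolding d_def by (rule L2_set_le_sum_abs)
    also have "\<dots> \<le> (\<Sum>w\<in>I. K * min (dist x y / 2 ^ l) 1)"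
    proof (rule sum_mono)
      fix w assume "w \<in> I"
      have "dist ((1 / 2 ^ l) *\<^sub>R x) ((1 / 2 ^ l) *\<^sub>R y) = dist x y / 2 ^ l"
        by (simp add: dist_norm flip: scaleR_diff_right)
      with lip[OF \<open>w \<in> I\<close>, of "(1 / 2 ^ l) *\<^sub>R x" "(1 / 2 ^ l) *\<^sub>R y"]
      show "\<bar>g w ((1 / 2 ^ l) *\<^sub>R x) - g w ((1 / 2 ^ l) *\<^sub>R y)\<bar> \<le> K * min (dist x y / 2 ^ l) 1" by simp
    qed
    also have "\<dots> \<le> M * min (dist x y / 2 ^ l) 1"
      using K by (simp add: M_def distrib_right mult.assoc)
    finally show ?thesis .
  qed
  have d_supp: "d l x y = 0" if "x \<notin> cball 0 (r * 2 ^ l)" "y \<notin> cball 0 (r * 2 ^ l)" for l x y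
  proof -
    have "norm ((1 / 2 ^ l) *\<^sub>R x) > r" "norm ((1 / 2 ^ l) *\<^sub>R y) > r"
      using that by (auto simp: field_simps)
    then show ?thesis using supp by (simp add: d_def L2_set_def)
  qed
  define q where "q l x y = d l x y * (dist x y / 2 ^ l) powr (- \<sigma>)" for l x y
  have q0: "0 \<le> q l x y" for l x y using d0 by (simp add: q_def)
  have q_le: "q l x y \<le> M * scale_kernel \<sigma> (dist x y / 2 ^ l)" for l x y
    using mult_right_mono[OF d_le, of "(dist x y / 2 ^ l) powr (- \<sigma>)"]
    by (simp add: q_def scale_kernel_def mult.assoc)
  have q_sum: "(\<Sum>l<N. q l x y / C) \<le> 1" for N x y
  proof -
    have "(\<Sum>l<N. q l x y) \<le> M * (\<Sum>l<N. scale_kernel \<sigma> (dist x y / 2 ^ l))"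
      unfolding sum_distrib_left by (intro sum_mono q_le)
    also have "\<dots> \<le> C" unfolding C_def using M C0(2)[of "dist x y"] by (intro mult_left_mono) auto
    finally show ?thesis using C by (simp flip: sum_divide_distrib)
  qed
  \<comment> \<open>Pairs with neither point in the ball contribute nothing by
    \<open>d_supp\<close>. On the diagonal both sides vanish, since q and
    \<open>scale_kernel\<close> are 0 there and \<open>0 / 0 = 0\<close> in
    \<open>ennreal\<close>.\<close>
  have kernel: "ennreal (q l x y / C) / ennreal (dist x y ^ ?n) \<le>
      ennreal (M / C) * (gagliardo_kernel \<sigma> (2 ^ l) (y - x) * (S l x + S l y))" for l x y
  proof (cases "x \<in> cball 0 (r * 2 ^ l) \<or> y \<in> cball 0 (r * 2 ^ l)")
    case True
    have "ennreal (q l x y / C) / ennreal (dist x y ^ ?n) \<le>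
        ennreal (M / C * scale_kernel \<sigma> (dist x y / 2 ^ l)) / ennreal (dist x y ^ ?n)"
      using q_le[of l x y] C by (intro divide_right_mono_ennreal ennreal_leI) (simp add: divide_right_mono)
    also have "\<dots> = ennreal (M / C) * gagliardo_kernel \<sigma> (2 ^ l) (y - x)"
    proof -
      have "ennreal (M / C * scale_kernel \<sigma> (dist x y / 2 ^ l)) =
          ennreal (M / C) * ennreal (scale_kernel \<sigma> (dist x y / 2 ^ l))"
        using M C by (intro ennreal_mult scale_kernel_nonneg) auto
      then show ?thesis
        by (simp add: gagliardo_kernel_def ennreal_times_divide dist_norm norm_minus_commute)
    qed
    also have "\<dots> \<le> ennreal (M / C) * (gagliardo_kernel \<sigma> (2 ^ l) (y - x) * (S l x + S l y))"
    proof (rule mult_left_mono)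
      have "1 \<le> S l x + S l y" using True by (auto simp: S_def)
      then show "gagliardo_kernel \<sigma> (2 ^ l) (y - x) \<le> gagliardo_kernel \<sigma> (2 ^ l) (y - x) * (S l x + S l y)"
        using mult_left_mono[of 1 "S l x + S l y" "gagliardo_kernel \<sigma> (2 ^ l) (y - x)"] by simp
    qed simp
    finally show ?thesis .
  next
    case False
    then show ?thesis using d_supp by (simp add: q_def)
  qed
  show thesis
  proof (rule that[OF C D])
    fix A :: "real \<Rightarrow> ennreal" and b :: "nat \<Rightarrow> real" and N :: nat
    assume A: "young_function A" and b: "\<And>l. 0 \<le> b l"
    let ?v = "\<lambda>w x. \<Sum>l<N. b l * 2 powr (real l * \<sigma>) * g w ((1 / 2 ^ l) *\<^sub>R x)"
    let ?H = "\<lambda>l x y. gagliardo_kernel \<sigma> (2 ^ l) (y - x) * (S l x + S l y)"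
    have [measurable]: "(\<lambda>x. S l x) \<in> borel_measurable borel" for l
      unfolding S_def by (intro borel_measurable_indicator) simp
    have ptw: "A (L2_set (\<lambda>w. ?v w x - ?v w y) I / dist x y powr \<sigma>) / ennreal (dist x y ^ ?n) \<le>
        (\<Sum>l<N. A (C * b l) * ennreal (M / C) * ?H l x y)" for x y
    proof -
      have "L2_set (\<lambda>w. ?v w x - ?v w y) I / dist x y powr \<sigma> \<le> (\<Sum>l<N. q l x y / C * (C * b l))"
      proof -
        have "L2_set (\<lambda>w. ?v w x - ?v w y) I = L2_set (\<lambda>w. \<Sum>l<N. b l * 2 powr (real l * \<sigma>) *
            (g w ((1 / 2 ^ l) *\<^sub>R x) - g w ((1 / 2 ^ l) *\<^sub>R y))) I"
          by (simp add: sum_subtractf right_diff_distrib)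
        also have "\<dots> \<le> (\<Sum>l<N. L2_set (\<lambda>w. b l * 2 powr (real l * \<sigma>) *
            (g w ((1 / 2 ^ l) *\<^sub>R x) - g w ((1 / 2 ^ l) *\<^sub>R y))) I)"
          by (rule L2_set_sum_le) simp
        also have "\<dots> = (\<Sum>l<N. b l * 2 powr (real l * \<sigma>) * d l x y)"
          using b by (simp add: d_def L2_set_right_distrib)
        finally have "L2_set (\<lambda>w. ?v w x - ?v w y) I / dist x y powr \<sigma> \<le>
            (\<Sum>l<N. b l * 2 powr (real l * \<sigma>) * d l x y) / dist x y powr \<sigma>"
          by (rule divide_right_mono) simp
        also have "\<dots> = (\<Sum>l<N. q l x y / C * (C * b l))"
          unfolding sum_divide_distrib
        proof (intro sum.cong refl)
          fix l
          \<comment> \<open>The amplitude \<open>2 powr (l * \<sigma>)\<close> is exactly what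
            converts the distance to units of \<open>2 ^ l\<close>.\<close>
          have "(dist x y / 2 ^ l) powr (- \<sigma>) = 2 powr (real l * \<sigma>) / dist x y powr \<sigma>"
            by (simp add: powr_divide powr_minus powr_powr field_simps flip: powr_realpow)
          then show "b l * 2 powr (real l * \<sigma>) * d l x y / dist x y powr \<sigma> = q l x y / C * (C * b l)"
            using C by (simp add: q_def)
        qed
        finally show ?thesis .
      qed
      then have "A (L2_set (\<lambda>w. ?v w x - ?v w y) I / dist x y powr \<sigma>) \<le> A (\<Sum>l<N. q l x y / C * (C * b l))"
        by (intro young_function_mono A) simp_all
      also have "\<dots> \<le> (\<Sum>l<N. ennreal (q l x y / C) * A (C * b l))"
        using C q0 b q_sum by (intro young_function_jensen A) auto
      finally have "A (L2_set (\<lambda>w. ?v w x - ?v w y) I / dist x y powr \<sigma>) / ennreal (dist x y ^ ?n) \<le>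
          (\<Sum>l<N. ennreal (q l x y / C) * A (C * b l)) / ennreal (dist x y ^ ?n)"
        by (rule divide_right_mono_ennreal)
      also have "\<dots> = (\<Sum>l<N. A (C * b l) * (ennreal (q l x y / C) / ennreal (dist x y ^ ?n)))"
        unfolding divide_ennreal_def sum_distrib_right by (simp add: mult_ac)
      also have "\<dots> \<le> (\<Sum>l<N. A (C * b l) * (ennreal (M / C) * ?H l x y))"
        by (intro sum_mono mult_left_mono kernel) simp
      finally show ?thesis by (simp add: mult.assoc)
    qed
    \<comment> \<open>No measurability of the integrand of J is at hand. The nonnegative integrals
      over the completion and over \<open>lborel\<close> agree for every integrand, and monotonicity
      leads to a Borel bound for which sum and integral can be exchanged.\<close>
    have "J \<sigma> A I ?v \<le> (\<integral>\<^sup>+x. \<integral>\<^sup>+y. (\<Sum>l<N. A (C * b l) * ennreal (M / C) * ?H l x y) \<partial>lborel \<partial>lborel)"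
      unfolding J_def nn_integral_completion by (intro nn_integral_mono ptw)
    also have "\<dots> = (\<Sum>l<N. A (C * b l) * ennreal (M / C) * (\<integral>\<^sup>+x. \<integral>\<^sup>+y. ?H l x y \<partial>lborel \<partial>lborel))"
      by (simp add: nn_integral_sum nn_integral_cmult)
    also have "\<dots> \<le> (\<Sum>l<N. ennreal D * (ennreal (2 ^ (l * ?n)) * A (C * b l)))"
    proof (rule sum_mono)
      fix l
      have "(\<integral>\<^sup>+x. \<integral>\<^sup>+y. ?H l x y \<partial>lborel \<partial>lborel) =
          ennreal (2 * unit_ball_vol (real ?n) * (r * 2 ^ l) ^ ?n) * ennreal G"
        unfolding S_def using r by (subst gagliardo_kernel_double_integral) (simp_all add: G)
      then have "ennreal (M / C) * (\<integral>\<^sup>+x. \<integral>\<^sup>+y. ?H l x y \<partial>lborel \<partial>lborel) =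
          ennreal (M / C * (2 * unit_ball_vol (real ?n) * (r * 2 ^ l) ^ ?n * G))"
        using M C r G by (simp only:) (intro ennreal_mult3; simp)
      also have "\<dots> \<le> ennreal (D * 2 ^ (l * ?n))"
      proof (intro ennreal_leI)
        have "M / C * (2 * unit_ball_vol (real ?n) * (r * 2 ^ l) ^ ?n * G) + (2 ^ l) ^ ?n = D * (2 ^ l) ^ ?n"
          using C by (simp add: D_def power_mult_distrib field_simps)
        moreover have "(2 ^ l) ^ ?n \<ge> (0 :: real)" by simp
        ultimately show "M / C * (2 * unit_ball_vol (real ?n) * (r * 2 ^ l) ^ ?n * G) \<le> D * 2 ^ (l * ?n)"
          unfolding power_mult by linarith
      qed
      also have "\<dots> = ennreal D * ennreal (2 ^ (l * ?n))" using D by (simp add: ennreal_mult)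
      finally have "ennreal (M / C) * (\<integral>\<^sup>+x. \<integral>\<^sup>+y. ?H l x y \<partial>lborel \<partial>lborel) \<le> ennreal D * ennreal (2 ^ (l * ?n))" .
      from mult_left_mono[OF this, of "A (C * b l)"]
      show "A (C * b l) * ennreal (M / C) * (\<integral>\<^sup>+x. \<integral>\<^sup>+y. ?H l x y \<partial>lborel \<partial>lborel) \<le>
          ennreal D * (ennreal (2 ^ (l * ?n)) * A (C * b l))"
        by (simp add: mult_ac)
    qed
    finally show "J \<sigma> A I ?v \<le> ennreal D * (\<Sum>l<N. ennreal (2 ^ (l * ?n)) * A (C * b l))"
      by (simp add: sum_distrib_left)
  qed
qed

section \<open>Campanato polynomials\<close>

lemma finite_multi_indices: "finite {\<alpha> :: 'n::finite \<Rightarrow> nat. sum \<alpha> UNIV \<le> k}"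
proof (rule finite_subset)
  show "{\<alpha> :: 'n \<Rightarrow> nat. sum \<alpha> UNIV \<le> k} \<subseteq> (UNIV \<rightarrow>\<^sub>E {..k})"
  proof
    fix \<alpha> :: "'n \<Rightarrow> nat" assume "\<alpha> \<in> {\<alpha>. sum \<alpha> UNIV \<le> k}"
    then have "\<alpha> i \<le> k" for i using member_le_sum[of i UNIV \<alpha>] by simp
    then show "\<alpha> \<in> UNIV \<rightarrow>\<^sub>E {..k}" by (simp add: PiE_UNIV_domain)
  qed
  show "finite (UNIV \<rightarrow>\<^sub>E {..k} :: ('n \<Rightarrow> nat) set)" by (intro finite_PiE) auto
qed

abbreviation monomial_fun :: "('n::finite \<Rightarrow> nat) \<Rightarrow> real^'n \<Rightarrow> real" where
  "monomial_fun \<alpha> \<equiv> \<lambda>x. \<Prod>i\<in>UNIV. x $ i ^ \<alpha> i"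

lemma smooth_fun_monomial: "smooth_fun (monomial_fun \<alpha>)"
  by (rule smooth_fun_product[of "\<lambda>i t. t ^ \<alpha> i"]) (rule smooth_real_power)

lemma polynomial_deg_le_monomial:
  assumes "sum \<alpha> UNIV \<le> k"
  shows "polynomial_deg_le k (\<lambda>x. a * monomial_fun \<alpha> x)"
proof -
  have "(\<Sum>\<beta> | sum \<beta> UNIV \<le> k. (if \<beta> = \<alpha> then a else 0) * monomial_fun \<beta> x) = a * monomial_fun \<alpha> x" for x
    using assms sum.delta[OF finite_multi_indices[of k], of \<alpha> "\<lambda>\<beta>. a * monomial_fun \<beta> x"]
    by (simp add: if_distrib[of "\<lambda>c. c * _"] cong: if_cong)
  then show ?thesis unfolding polynomial_deg_le_def by (intro exI[of _ "\<lambda>\<beta>. if \<beta> = \<alpha> then a else 0"]) simp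
qed

lemma polynomial_deg_le_add:
  assumes "polynomial_deg_le k P" "polynomial_deg_le k Q"
  shows "polynomial_deg_le k (\<lambda>x. P x + Q x)"
proof -
  obtain c d where "P = (\<lambda>x. \<Sum>\<alpha> | sum \<alpha> UNIV \<le> k. c \<alpha> * monomial_fun \<alpha> x)"
    "Q = (\<lambda>x. \<Sum>\<alpha> | sum \<alpha> UNIV \<le> k. d \<alpha> * monomial_fun \<alpha> x)"
    using assms unfolding polynomial_deg_le_def by blast
  then show ?thesis
    unfolding polynomial_deg_le_def
    by (intro exI[of _ "\<lambda>\<alpha>. c \<alpha> + d \<alpha>"]) (simp add: distrib_right sum.distrib)
qed

lemma polynomial_deg_le_cmult:
  assumes "polynomial_deg_le k P"
  shows "polynomial_deg_le k (\<lambda>x. a * P x)"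
proof -
  obtain c where "P = (\<lambda>x. \<Sum>\<alpha> | sum \<alpha> UNIV \<le> k. c \<alpha> * monomial_fun \<alpha> x)"
    using assms unfolding polynomial_deg_le_def by blast
  then show ?thesis
    unfolding polynomial_deg_le_def
    by (intro exI[of _ "\<lambda>\<alpha>. a * c \<alpha>"]) (simp add: sum_distrib_left mult.assoc)
qed

lemma polynomial_deg_le_zero: "polynomial_deg_le k (\<lambda>x. 0)"
  unfolding polynomial_deg_le_def by (intro exI[of _ "\<lambda>\<alpha>. 0"]) simp

lemma polynomial_deg_le_sum:
  assumes "finite I" "\<And>l. l \<in> I \<Longrightarrow> polynomial_deg_le k (P l)"
  shows "polynomial_deg_le k (\<lambda>x. \<Sum>l\<in>I. P l x)"
  using assms by (induction I) (auto simp: polynomial_deg_le_zero polynomial_deg_le_add)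

lemma polynomial_deg_le_diff:
  assumes "polynomial_deg_le k P" "polynomial_deg_le k Q"
  shows "polynomial_deg_le k (\<lambda>x. P x - Q x)"
  using polynomial_deg_le_add[OF assms(1) polynomial_deg_le_cmult[OF assms(2), of "-1"]] by simp

lemma polynomial_deg_le_smooth: "polynomial_deg_le k P \<Longrightarrow> smooth_fun P"
  unfolding polynomial_deg_le_def
  by (auto intro!: smooth_fun_linear_combination(2) finite_multi_indices smooth_fun_monomial)

lemma polynomial_deg_le_partial:
  assumes "polynomial_deg_le (Suc k) P"
  shows "polynomial_deg_le k (partials [i] P)"
proof -
  have mono: "polynomial_deg_le k (\<lambda>x. c * partials [i] (monomial_fun \<alpha>) x)"
    if "sum \<alpha> UNIV \<le> Suc k" for c and \<alpha> :: "'a \<Rightarrow> nat"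
  proof -
    let ?\<beta> = "\<alpha>(i := \<alpha> i - 1)"
    have "((\<lambda>t. t ^ \<alpha> j) has_real_derivative real (\<alpha> j) * t ^ (\<alpha> j - 1)) (at t)" for j and t :: real
      by (auto intro!: derivative_eq_intros)
    then have p: "partials [i] (monomial_fun \<alpha>) =
        (\<lambda>x. \<Prod>j\<in>UNIV. (if j = i then (\<lambda>t. real (\<alpha> j) * t ^ (\<alpha> j - 1)) else (\<lambda>t. t ^ \<alpha> j)) (x $ j))"
      by (rule partial_product(2)[of "\<lambda>j t. t ^ \<alpha> j" "\<lambda>j t. real (\<alpha> j) * t ^ (\<alpha> j - 1)"])
    have "c * partials [i] (monomial_fun \<alpha>) x = (c * real (\<alpha> i)) * monomial_fun ?\<beta> x" for x
      unfolding p by (subst (1 2) prod.remove[of UNIV i]) (auto simp: mult_ac intro!: prod.cong)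
    then have eq: "(\<lambda>x. c * partials [i] (monomial_fun \<alpha>) x) = (\<lambda>x. (c * real (\<alpha> i)) * monomial_fun ?\<beta> x)"
      by blast
    show ?thesis
    proof (cases "\<alpha> i = 0")
      case True
      then show ?thesis unfolding eq by (simp add: polynomial_deg_le_zero)
    next
      case False
      have "sum \<alpha> UNIV = \<alpha> i + sum \<alpha> (UNIV - {i})" "sum ?\<beta> UNIV = (\<alpha> i - 1) + sum \<alpha> (UNIV - {i})"
        by (subst sum.remove[of _ i]; simp)+
      then have "sum ?\<beta> UNIV \<le> k" using that False by linarith
      then show ?thesis unfolding eq by (rule polynomial_deg_le_monomial)
    qed
  qed
  obtain c where P: "P = (\<lambda>x. \<Sum>\<alpha> | sum \<alpha> UNIV \<le> Suc k. c \<alpha> * monomial_fun \<alpha> x)"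
    using assms unfolding polynomial_deg_le_def by blast
  have "partials [i] P = (\<lambda>x. \<Sum>\<alpha> | sum \<alpha> UNIV \<le> Suc k. c \<alpha> * partials [i] (monomial_fun \<alpha>) x)"
    unfolding P by (intro smooth_fun_linear_combination(1) finite_multi_indices smooth_fun_monomial)
  then show ?thesis
    using mono by (auto intro!: polynomial_deg_le_sum finite_multi_indices)
qed

lemma zero_partials_imp_constant:
  assumes "smooth_fun D" "\<And>i. partials [i] D = (\<lambda>x. 0)"
  obtains c where "D = (\<lambda>x. c)"
proof -
  have "(D has_derivative (\<lambda>h. 0)) (at x)" for x
  proof -
    let ?D = "frechet_derivative D (at x)"
    have D: "(D has_derivative ?D) (at x)"
      using smooth_fun_has_derivative[OF assms(1), of "[]" x] by simp
    have "?D = (\<lambda>h. 0)"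
    proof (rule linear_eq_stdbasis)
      show "linear ?D" using D by (rule has_derivative_linear)
      show "linear (\<lambda>h. 0 :: real)" by (rule linear_zero)
      fix b :: "real^'a" assume "b \<in> Basis"
      then obtain i where "b = axis i 1" by (auto simp: Basis_vec_def)
      then show "?D b = 0" using assms(2)[of i] by (metis partials.simps)
    qed
    with D show ?thesis by simp
  qed
  then have "D x = D 0" for x
    by (intro has_derivative_zero_unique[of UNIV D]) auto
  then show ?thesis using that[of "D 0"] by blast
qed

lemma smooth_fun_set_integrable_ball:
  assumes "smooth_fun f"
  shows "set_integrable lebesgue (ball 0 1) (partials w f)"
proof -
  have "locally_integrable (partials w f)"
    by (intro continuous_imp_locally_integrable smooth_fun_continuous assms)
  then have "set_integrable lebesgue (cball 0 1) (partials w f)"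
    by (simp add: locally_integrable_def)
  then show ?thesis by (rule set_integrable_subset) (auto simp: ball_subset_cball)
qed

lemma measure_unit_ball_pos: "measure lebesgue (ball (0::real^'n::finite) 1) > 0"
  using content_ball_pos[of 1 "0::real^'n"] by simp

lemma set_integral_const_unit_ball:
  "(LINT x:ball (0::real^'n::finite) 1|lebesgue. c) = measure lebesgue (ball (0::real^'n) 1) * (c::real)"
  by (simp add: set_lebesgue_integral_def)

text \<open>Uniqueness of the Campanato polynomial, to be applied to the difference of two
  candidates. By induction on k all first partial derivatives vanish, which leaves a constant of
  mean 0.\<close>

lemma polynomial_zero_if_partial_means_zero:
  fixes D :: "real^'n::finite \<Rightarrow> real"
  assumes "polynomial_deg_le k D"
    and "\<And>w. length w \<le> k \<Longrightarrow> (LINT x:ball 0 1|lebesgue. partials w D x) = 0"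
  shows "D = (\<lambda>x. 0)"
  using assms
proof (induction k arbitrary: D)
  case 0
  obtain c where c: "D = (\<lambda>x. \<Sum>\<alpha> | sum \<alpha> UNIV \<le> 0. c \<alpha> * monomial_fun \<alpha> x)"
    using 0(1) unfolding polynomial_deg_le_def by blast
  have "{\<alpha> :: 'n \<Rightarrow> nat. sum \<alpha> UNIV \<le> 0} = {\<lambda>_. 0}" by auto
  then have D: "D = (\<lambda>x. c (\<lambda>_. 0))" unfolding c by simp
  have "(LINT x:ball (0::real^'n) 1|lebesgue. c (\<lambda>_. 0)) = 0" using 0(2)[of "[]"] D by simp
  then show ?case using measure_unit_ball_pos[where 'n='n] D by (simp add: set_integral_const_unit_ball)
next
  case (Suc k)
  have "partials [i] D = (\<lambda>x. 0)" for i
  proof (rule Suc.IH)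
    show "polynomial_deg_le k (partials [i] D)" using Suc.prems(1) by (rule polynomial_deg_le_partial)
    show "(LINT x:ball 0 1|lebesgue. partials w (partials [i] D) x) = 0" if "length w \<le> k" for w
      using Suc.prems(2)[of "w @ [i]"] that by (simp only: partials_snoc length_append) simp
  qed
  then obtain c where D: "D = (\<lambda>x. c)"
    using zero_partials_imp_constant polynomial_deg_le_smooth[OF Suc.prems(1)] by blast
  have "(LINT x:ball (0::real^'n) 1|lebesgue. c) = 0" using Suc.prems(2)[of "[]"] D by simp
  then show ?case using measure_unit_ball_pos[where 'n='n] D by (simp add: set_integral_const_unit_ball)
qed

text \<open>On the unit ball the superpositions are polynomials in one coordinate, and so are their
  Campanato polynomials. This reduces the existence of the latter to univariate algebra.\<close>

definition coordinate_poly :: "'n::finite \<Rightarrow> real poly \<Rightarrow> real^'n \<Rightarrow> real" where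
  "coordinate_poly i p x = poly p (x $ i)"

lemma coordinate_poly_deriv:
  "(coordinate_poly i p has_derivative (\<lambda>h. poly (pderiv p) (x $ i) * h $ i)) (at x)"
  unfolding coordinate_poly_def[abs_def]
  by (rule has_derivative_compose[of "\<lambda>x. x $ i" "\<lambda>h. h $ i" x UNIV "poly p"])
    (use poly_DERIV[of p] in \<open>auto simp: has_field_derivative_def
      intro: bounded_linear_imp_has_derivative bounded_linear_vec_nth\<close>)

lemma coordinate_poly_0: "coordinate_poly i 0 = (\<lambda>x. 0)"
  by (auto simp: coordinate_poly_def)

lemma partials_coordinate_poly:
  "partials w (coordinate_poly i p) =
    (if set w \<subseteq> {i} then coordinate_poly i ((pderiv ^^ length w) p) else (\<lambda>x. 0))"
proof (induction w)
  case (Cons j w)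
  have step: "(\<lambda>x. frechet_derivative (coordinate_poly i q) (at x) (axis j 1)) =
      (if j = i then coordinate_poly i (pderiv q) else (\<lambda>x. 0))" for q j
    by (rule ext, subst frechet_derivative_at[OF coordinate_poly_deriv, symmetric])
      (simp add: coordinate_poly_def axis_def)
  show ?case unfolding partials.simps(2) Cons by (simp add: step)
qed simp

lemma smooth_fun_coordinate_poly: "smooth_fun (coordinate_poly i p)"
proof (rule smooth_fun_coinduct[of "\<lambda>f. \<exists>p. f = coordinate_poly i p"])
  fix f assume "\<exists>p. f = coordinate_poly i p"
  then obtain p where f: "f = coordinate_poly i p" by blast
  have "\<exists>q. partials [j] f = coordinate_poly i q" for j
    unfolding f partials_coordinate_poly using coordinate_poly_0[of i] by (metis (full_types))
  then show "f differentiable_on UNIV \<and> (\<forall>j. \<exists>q. partials [j] f = coordinate_poly i q)"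
    using coordinate_poly_deriv f unfolding differentiable_on_def differentiable_def by blast
qed blast

lemma polynomial_deg_le_coordinate_poly:
  assumes "degree p \<le> k"
  shows "polynomial_deg_le k (coordinate_poly i p)"
proof -
  have mono: "monomial_fun (\<lambda>m. if m = i then j else 0) x = x $ i ^ j" for j and x :: "real^'a"
    by (subst prod.remove[of _ i]) auto
  have "coordinate_poly i p = (\<lambda>x. \<Sum>j\<le>degree p. coeff p j * monomial_fun (\<lambda>m. if m = i then j else 0) x)"
    unfolding mono by (simp add: coordinate_poly_def[abs_def] poly_altdef)
  moreover have "polynomial_deg_le k (\<lambda>x. coeff p j * monomial_fun (\<lambda>m. if m = i then j else 0) x)"
    if "j \<le> degree p" for j
    using that assms by (intro polynomial_deg_le_monomial) simp
  ultimately show ?thesis by (auto intro!: polynomial_deg_le_sum)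
qed

lemma coordinate_poly_set_integrable:
  "set_integrable lebesgue (ball 0 1) (coordinate_poly i p)"
  using smooth_fun_set_integrable_ball[OF smooth_fun_coordinate_poly, of "[]"] by simp

lemma higher_pderiv_diff: "(pderiv ^^ n) (p - q) = (pderiv ^^ n) p - (pderiv ^^ n) q"
  for p q :: "real poly"
  by (induction n) (simp_all add: pderiv_diff)

text \<open>Existence is obtained from the top order down: the leading coefficient is determined by
  the mean of the highest derivative alone, and once the leading monomial is subtracted the lower
  orders pose the same problem for a smaller k.\<close>

lemma coordinate_poly_best_fit:
  fixes i :: "'n::finite"
  shows "\<exists>q. degree q \<le> k \<and> (\<forall>h\<le>k.
    (LINT x:ball 0 1|lebesgue. coordinate_poly i ((pderiv ^^ h) (p - q)) (x::real^'n)) = 0)"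
proof -
  define I where "I p = (LINT x:ball 0 1|lebesgue. coordinate_poly i p (x::real^'n))" for p
  define m where "m = measure lebesgue (ball (0::real^'n) 1)"
  have m: "m > 0" using measure_unit_ball_pos m_def by metis
  have I_diff: "I (p - q) = I p - I q" for p q
  proof -
    have "coordinate_poly i (p - q) = (\<lambda>x. coordinate_poly i p x - coordinate_poly i q x)"
      by (auto simp: coordinate_poly_def)
    then show ?thesis unfolding I_def
      by (simp only: set_integral_diff(2)[OF coordinate_poly_set_integrable coordinate_poly_set_integrable])
  qed
  have I_const: "I [:c:] = m * c" for c
    unfolding I_def m_def set_integral_const_unit_ball[symmetric] by (simp add: coordinate_poly_def[abs_def])
  have "\<exists>q. degree q \<le> k \<and> (\<forall>h\<le>k. I ((pderiv ^^ h) (p - q)) = 0)" for p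
  proof (induction k arbitrary: p)
    case 0
    show ?case using m by (intro exI[of _ "[:I p / m:]"]) (simp add: I_diff I_const)
  next
    case (Suc k)
    \<comment> \<open>The derivative of order \<open>Suc k\<close> of the monomial is the constant
      \<open>c * fact (Suc k)\<close>, whose integral over the ball carries the further factor
      m.\<close>
    define c where "c = I ((pderiv ^^ Suc k) p) / (m * fact (Suc k))"
    let ?r = "monom c (Suc k)"
    have top: "(pderiv ^^ Suc k) ?r = [:c * fact (Suc k):]"
    proof (rule poly_eqI)
      fix j
      show "coeff ((pderiv ^^ Suc k) ?r) j = coeff [:c * fact (Suc k):] j"
        by (cases j) (simp_all add: coeff_higher_pderiv pochhammer_fact mult.commute del: funpow.simps fact_Suc)
    qed
    obtain q where q: "degree q \<le> k" "\<And>h. h \<le> k \<Longrightarrow> I ((pderiv ^^ h) (p - ?r - q)) = 0"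
      using Suc[of "p - ?r"] by blast
    have "I ((pderiv ^^ h) (p - (?r + q))) = 0" if "h \<le> Suc k" for h
    proof (cases "h = Suc k")
      case True
      \<comment> \<open>The correction q has degree at most k and does not disturb the order already
        matched.\<close>
      have "(pderiv ^^ Suc k) q = 0"
        using q(1) by (intro poly_eqI) (simp add: coeff_higher_pderiv coeff_eq_0 del: funpow.simps)
      then have "(pderiv ^^ h) (p - (?r + q)) = (pderiv ^^ Suc k) p - [:c * fact (Suc k):]"
        using top unfolding True higher_pderiv_diff higher_pderiv_add by (simp only: add_0_right)
      then show ?thesis using m by (simp add: I_diff I_const c_def del: funpow.simps fact_Suc)
    next
      case False
      then show ?thesis using q(2)[of h] that by (simp add: diff_diff_eq)
    qed
    moreover have "degree (?r + q) \<le> Suc k"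
      using q(1) by (intro degree_add_le degree_monom_le) auto
    ultimately show ?case by blast
  qed
  then show ?thesis unfolding I_def .
qed

text \<open>\<open>campanato_poly\<close> is a definite description, so its evaluation takes
  existence and uniqueness. Since q depends neither on u nor on M, the polynomial, and with it the
  error, is proportional to the amplitude M.\<close>

lemma campanato_poly_test_function:
  fixes u :: "real^'n::finite \<Rightarrow> real"
  assumes u: "test_function u" "\<And>x. x \<in> ball 0 1 \<Longrightarrow> u x = M * coordinate_poly i p x"
    and q: "degree q \<le> k"
      "\<And>h. h \<le> k \<Longrightarrow> (LINT x:ball 0 1|lebesgue. coordinate_poly i ((pderiv ^^ h) (p - q)) (x::real^'n)) = 0"
  shows "campanato_poly k (ball 0 1) u = (\<lambda>x. M * coordinate_poly i q x)"
proof -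
  have sp: "smooth_fun (\<lambda>x. M * coordinate_poly i p x)" "partials w (\<lambda>x. M * coordinate_poly i p x) =
      (\<lambda>x. M * partials w (coordinate_poly i p) x)" for p w
    using smooth_fun_linear_combination[where I="{()}" and f="\<lambda>_. coordinate_poly i p" and c="\<lambda>_. M"]
    by (simp_all add: smooth_fun_coordinate_poly)
  have deriv: "(LINT x:ball 0 1|lebesgue. weak_deriv w u x - partials w P x) =
      (LINT x:ball 0 1|lebesgue. M * partials w (coordinate_poly i p) x - partials w P x)"
    if "smooth_fun P" for w and P :: "real^'n \<Rightarrow> real"
    unfolding set_lebesgue_integral_def
  proof (rule integral_cong_AE)
    have su: "smooth_fun u" using u(1) by (rule test_functionE) blast
    have ae: "AE x in lebesgue. weak_deriv w u x = partials (rev w) u x"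
      by (rule weak_deriv_test_function[OF u(1)])
    \<comment> \<open>Partial derivatives of a coordinate polynomial depend on the word only through
      its set and its length, so the reversal disappears.\<close>
    have eq: "partials (rev w) u x = M * partials w (coordinate_poly i p) x" if "x \<in> ball 0 1" for x
    proof -
      have "partials (rev w) u x = partials (rev w) (\<lambda>x. M * coordinate_poly i p x) x"
        using that u(2) by (intro partials_cong_open[of "ball 0 1"]) auto
      also have "\<dots> = M * partials w (coordinate_poly i p) x"
        unfolding sp(2) by (simp add: partials_coordinate_poly)
      finally show ?thesis .
    qed
    show AE: "AE x in lebesgue. indicator (ball 0 1) x *\<^sub>R (weak_deriv w u x - partials w P x) =
      indicator (ball 0 1) x *\<^sub>R (M * partials w (coordinate_poly i p) x - partials w P x)"
      using ae by eventually_elim (auto simp: indicator_def eq)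
    show meas: "(\<lambda>x. indicator (ball 0 1) x *\<^sub>R (M * partials w (coordinate_poly i p) x - partials w P x))
        \<in> borel_measurable lebesgue"
      using borel_measurable_integrable[OF set_integral_diff(1)[OF
          smooth_fun_set_integrable_ball[OF sp(1)[of p], of w] smooth_fun_set_integrable_ball[OF that, of w],
          unfolded set_integrable_def]] unfolding sp(2) .
    show "(\<lambda>x. indicator (ball 0 1) x *\<^sub>R (weak_deriv w u x - partials w P x)) \<in> borel_measurable lebesgue"
      using meas AE by (rule borel_measurable_AE[OF _ AE_symmetric])
  qed
  show ?thesis unfolding campanato_poly_def
  proof (rule the_equality)
    let ?Q = "\<lambda>x. M * coordinate_poly i q x"
    have fit: "(LINT x:ball 0 1|lebesgue. weak_deriv w u x - partials w ?Q x) = 0" if "length w \<le> k" for w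
    proof -
      have "(LINT x:ball 0 1|lebesgue. weak_deriv w u x - partials w ?Q x) =
          (LINT x:ball 0 1|lebesgue. M * (partials w (coordinate_poly i p) x - partials w (coordinate_poly i q) x))"
        using deriv[OF sp(1)[of q], of w] unfolding sp(2) by (simp add: right_diff_distrib)
      also have "\<dots> = M * (LINT x:ball 0 1|lebesgue. partials w (coordinate_poly i p) x - partials w (coordinate_poly i q) x)"
        by (rule set_integral_mult_right)
      also have "(\<lambda>x. partials w (coordinate_poly i p) x - partials w (coordinate_poly i q) x) =
          (\<lambda>x. if set w \<subseteq> {i} then coordinate_poly i ((pderiv ^^ length w) (p - q)) x else 0)"
        by (auto simp: partials_coordinate_poly coordinate_poly_def fun_eq_iff higher_pderiv_diff)
      also have "(LINT x:ball 0 1|lebesgue. \<dots> x) = 0"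
        using q(2)[OF that] by (cases "set w \<subseteq> {i}") (simp_all add: set_lebesgue_integral_def)
      finally show ?thesis by simp
    qed
    have polyQ: "polynomial_deg_le k ?Q"
      by (intro polynomial_deg_le_cmult polynomial_deg_le_coordinate_poly q(1))
    show "polynomial_deg_le k ?Q \<and>
        (\<forall>w. length w \<le> k \<longrightarrow> (LINT x:ball 0 1|lebesgue. weak_deriv w u x - partials w ?Q x) = 0)"
      using fit polyQ by blast
    fix P assume P: "polynomial_deg_le k P \<and>
        (\<forall>w. length w \<le> k \<longrightarrow> (LINT x:ball 0 1|lebesgue. weak_deriv w u x - partials w P x) = 0)"
    then have smP: "smooth_fun P" using polynomial_deg_le_smooth by blast
    have smQ: "smooth_fun ?Q" by (rule sp(1))
    let ?D = "\<lambda>x. ?Q x - P x"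
    have pD: "partials w ?D = (\<lambda>x. partials w ?Q x - partials w P x)" for w
      using smooth_fun_linear_combination(1)[of "{True, False}" "\<lambda>b. if b then ?Q else P" w "\<lambda>b. if b then 1 else -1"]
        smP smQ by (simp add: if_split)
    have "?D = (\<lambda>x. 0)"
    proof (rule polynomial_zero_if_partial_means_zero[of k])
      show "polynomial_deg_le k ?D" using polyQ P by (intro polynomial_deg_le_diff) auto
      fix w :: "'n list" assume w: "length w \<le> k"
      let ?U = "\<lambda>x. M * partials w (coordinate_poly i p) x"
      have int: "set_integrable lebesgue (ball 0 1) (\<lambda>x. ?U x - partials w P x)"
        "set_integrable lebesgue (ball 0 1) (\<lambda>x. ?U x - partials w ?Q x)"
        using smooth_fun_set_integrable_ball[OF sp(1)[of p], of w] smooth_fun_set_integrable_ball[OF smP, of w]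
          smooth_fun_set_integrable_ball[OF smQ, of w] unfolding sp(2) by (auto intro: set_integral_diff(1))
      \<comment> \<open>Subtracting the two fitting conditions eliminates u and leaves the means of
        the derivatives of \<open>?D\<close>.\<close>
      have "(LINT x:ball 0 1|lebesgue. (?U x - partials w P x) - (?U x - partials w ?Q x)) = 0 - 0"
        unfolding set_integral_diff(2)[OF int] using P fit[OF w] w deriv[OF smP] deriv[OF smQ] by simp
      then show "(LINT x:ball 0 1|lebesgue. partials w ?D x) = 0" unfolding pD by simp
    qed
    then show "P = ?Q" by (auto simp: fun_eq_iff)
  qed
qed

section \<open>The embedding\<close>

lemma test_function_bounded:
  assumes "test_function f"
  obtains B where "B > 0" "\<And>x. \<bar>f x\<bar> \<le> B"
proof -
  obtain R where R: "R > 0" "smooth_fun f" "\<And>w x. norm x > R \<Longrightarrow> partials w f x = 0"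
    using assms by (rule test_functionE) blast
  have "compact (f ` cball 0 R)"
    using smooth_fun_continuous[OF R(2), of "cball 0 R" "[]"]
    by (intro compact_continuous_image) simp_all
  then have "bounded (f ` cball 0 R)" by (rule compact_imp_bounded)
  then obtain B where B: "B > 0" "\<And>x. x \<in> cball 0 R \<Longrightarrow> \<bar>f x\<bar> \<le> B"
    unfolding bounded_pos real_norm_def by blast
  have "\<bar>f x\<bar> \<le> B" for x
    using B R(3)[of x "[]"] by (cases "norm x \<le> R") (auto simp: not_le)
  with B(1) show ?thesis by (rule that)
qed

text \<open>The mean value inequality, with the operator norm of the derivative bounded through the
  partial derivatives, controls short distances, and boundedness of f long ones. The form with
  \<open>min\<close> is the one from which \<open>scale_kernel\<close> arises.\<close>

lemma test_function_lipschitz: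
  fixes f :: "real^'n::finite \<Rightarrow> real"
  assumes "test_function f"
  obtains K where "K > 0" "\<And>x y. \<bar>f x - f y\<bar> \<le> K * min (dist x y) 1"
proof -
  have sm: "smooth_fun f" using assms by (rule test_functionE) blast
  obtain B where B: "B > 0" "\<And>x. \<bar>f x\<bar> \<le> B" by (rule test_function_bounded[OF assms]) blast
  have "\<exists>b>0. \<forall>x. \<bar>partials [j] f x\<bar> \<le> b" for j
    by (rule test_function_bounded[OF test_function_partials[OF assms, of "[j]"]]) blast
  then obtain b where b: "\<And>j. b j > 0" "\<And>j x. \<bar>partials [j] f x\<bar> \<le> b j" by metis
  define L where "L = sum b UNIV"
  have L: "L \<ge> 0" unfolding L_def by (intro sum_nonneg) (simp add: b less_imp_le)
  have lip: "norm (f x - f y) \<le> L * norm (x - y)" for x y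
  proof (rule differentiable_bound[of UNIV f "\<lambda>x. frechet_derivative f (at x)"])
    fix x
    let ?D = "frechet_derivative f (at x)"
    have D: "(f has_derivative ?D) (at x)"
      using smooth_fun_has_derivative[OF sm, of "[]" x] by simp
    then show "(f has_derivative ?D) (at x within UNIV)" by simp
    show "onorm ?D \<le> L"
    proof (rule onorm_le)
      fix h :: "real^'n"
      have lin: "linear ?D" using D by (rule has_derivative_linear)
      have "?D h = ?D (\<Sum>j\<in>UNIV. (h $ j) *\<^sub>R axis j 1)"
        by (simp add: basis_expansion flip: scalar_mult_eq_scaleR)
      also have "\<dots> = (\<Sum>j\<in>UNIV. h $ j * partials [j] f x)"
        by (simp add: linear_sum[OF lin] linear_scale[OF lin])
      finally have "\<bar>?D h\<bar> \<le> (\<Sum>j\<in>UNIV. \<bar>h $ j * partials [j] f x\<bar>)" by (simp only: sum_abs)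
      also have "\<dots> \<le> (\<Sum>j\<in>UNIV. b j * norm h)"
      proof (rule sum_mono)
        fix j
        have "\<bar>h $ j\<bar> * \<bar>partials [j] f x\<bar> \<le> norm h * b j"
          using b component_le_norm_cart[of h j] by (intro mult_mono) auto
        then show "\<bar>h $ j * partials [j] f x\<bar> \<le> b j * norm h" by (simp add: abs_mult mult.commute)
      qed
      finally show "norm (?D h) \<le> L * norm h" by (simp add: L_def sum_distrib_right)
    qed
  qed auto
  show ?thesis
  proof (rule that[of "L + 2 * B"])
    show "L + 2 * B > 0" using L B by simp
    fix x y
    have "\<bar>f x - f y\<bar> \<le> 2 * B" using B(2)[of x] B(2)[of y] by linarith
    moreover have "0 \<le> 2 * B * norm (x - y)" using B(1) by simp
    moreover have "\<bar>f x - f y\<bar> \<le> L * norm (x - y)" using lip[of x y] by simp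
    ultimately show "\<bar>f x - f y\<bar> \<le> (L + 2 * B) * min (dist x y) 1"
      using L unfolding min_def dist_norm distrib_right by (cases "norm (x - y) \<le> 1"; simp only: if_True if_False; linarith)
  qed
qed

text \<open>Allows the chosen weak derivatives to be replaced by classical ones inside the modular:
  for almost every x the inner integrands agree at almost every y.\<close>

lemma J_cong_AE:
  assumes "finite I" "\<And>w. w \<in> I \<Longrightarrow> AE x in lebesgue. v w x = v' w x"
  shows "J \<sigma> A I v = J \<sigma> A I v'"
proof -
  have ae: "AE x in lebesgue. \<forall>w\<in>I. v w x = v' w x"
    using assms by (simp add: AE_finite_all)
  have L2: "L2_set (\<lambda>w. v w x - v w y) I = L2_set (\<lambda>w. v' w x - v' w y) I"
    if "\<forall>w\<in>I. v w x = v' w x" "\<forall>w\<in>I. v w y = v' w y" for x y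
    using that by (intro L2_set_cong) auto
  show ?thesis unfolding J_def
  proof (rule nn_integral_cong_AE)
    show "AE x in lebesgue. (\<integral>\<^sup>+y. A (L2_set (\<lambda>i. v i x - v i y) I / dist x y powr \<sigma>)
          / ennreal (dist x y ^ CARD('b)) \<partial>lebesgue) =
        (\<integral>\<^sup>+y. A (L2_set (\<lambda>i. v' i x - v' i y) I / dist x y powr \<sigma>)
          / ennreal (dist x y ^ CARD('b)) \<partial>lebesgue)"
      using ae
    proof (rule eventually_mono)
      fix x assume x: "\<forall>w\<in>I. v w x = v' w x"
      show "(\<integral>\<^sup>+y. A (L2_set (\<lambda>i. v i x - v i y) I / dist x y powr \<sigma>)
          / ennreal (dist x y ^ CARD('b)) \<partial>lebesgue) =
        (\<integral>\<^sup>+y. A (L2_set (\<lambda>i. v' i x - v' i y) I / dist x y powr \<sigma>)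
          / ennreal (dist x y ^ CARD('b)) \<partial>lebesgue)"
        by (rule nn_integral_cong_AE, rule eventually_mono[OF ae]) (simp add: L2[OF x])
    qed
  qed
qed

lemma V_seminorm_test_function:
  assumes "test_function u"
  shows "V_seminorm s A u = luxemburg_seminorm (frac s) A {w. length w = nat \<lfloor>s\<rfloor>} (\<lambda>w. partials (rev w) u)"
proof -
  have fin: "finite {w :: 'a list. length w = nat \<lfloor>s\<rfloor>}"
    using finite_lists_length_eq[of "UNIV :: 'a set"] by simp
  have "J (frac s) A {w. length w = nat \<lfloor>s\<rfloor>} (\<lambda>w x. weak_deriv w u x / l) =
      J (frac s) A {w. length w = nat \<lfloor>s\<rfloor>} (\<lambda>w x. partials (rev w) u x / l)" for l
    using fin
  proof (rule J_cong_AE)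
    fix w
    show "AE x in lebesgue. weak_deriv w u x / l = partials (rev w) u x / l"
      using weak_deriv_test_function[OF assms, of w] by eventually_elim simp
  qed
  then show ?thesis by (simp add: V_seminorm_def luxemburg_seminorm_def)
qed

text \<open>Superlevel sets of the chosen weak derivatives lie in a ball containing the support, up
  to a null set on which the representative is arbitrary; their measure is therefore finite at every
  order.\<close>

lemma test_function_in_V_d:
  fixes u :: "real^'n::finite \<Rightarrow> real"
  assumes u: "test_function u" and fin: "V_seminorm s A u < \<infinity>"
  shows "u \<in> V_d j s A"
proof -
  obtain R where R: "R > 0" "smooth_fun u" "\<And>w x. norm x > R \<Longrightarrow> partials w u x = 0"
    using u by (rule test_functionE) blast
  have cont: "continuous_on UNIV u" using smooth_fun_continuous[OF R(2), of UNIV "[]"] by simp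
  have "u \<in> borel_measurable lebesgue"
    using borel_measurable_continuous_onI[OF cont] by (intro measurable_completion) simp
  moreover have "weakly_differentiable m u" for m
    unfolding weakly_differentiable_def
    using continuous_imp_locally_integrable[OF cont] test_function_has_weak_deriv[OF u] by blast
  ultimately have V: "u \<in> V s A" using fin by (simp add: V_def)
  have "emeasure lebesgue {x. L2_set (\<lambda>w. weak_deriv w u x) {w. length w = h} > t} < \<infinity>"
    if "t > 0" for t h
  proof -
    let ?I = "{w :: 'n list. length w = h}"
    have "finite ?I" using finite_lists_length_eq[of "UNIV :: 'n set"] by simp
    then have "AE x in lebesgue. \<forall>w\<in>?I. weak_deriv w u x = partials (rev w) u x"
      using weak_deriv_test_function[OF u] by (subst AE_finite_all) auto
    then obtain N where N: "N \<in> null_sets lebesgue"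
      "\<And>x. x \<notin> N \<Longrightarrow> \<forall>w\<in>?I. weak_deriv w u x = partials (rev w) u x"
      by (auto elim!: AE_E3)
    have "{x. L2_set (\<lambda>w. weak_deriv w u x) ?I > t} \<subseteq> cball 0 R \<union> N"
    proof
      fix x assume x: "x \<in> {x. L2_set (\<lambda>w. weak_deriv w u x) ?I > t}"
      show "x \<in> cball 0 R \<union> N"
      proof (rule ccontr)
        assume "x \<notin> cball 0 R \<union> N"
        then have "norm x > R" "x \<notin> N" by auto
        then have "\<forall>w\<in>?I. weak_deriv w u x = 0" using N(2) R(3) by simp
        then have "L2_set (\<lambda>w. weak_deriv w u x) ?I = 0" by (simp add: L2_set_def)
        then show False using x that by simp
      qed
    qed
    then have "emeasure lebesgue {x. L2_set (\<lambda>w. weak_deriv w u x) ?I > t} \<le> emeasure lebesgue (cball 0 R \<union> N)"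
      using N(1) by (intro emeasure_mono) auto
    also have "\<dots> = emeasure lebesgue (cball (0::real^'n) R)"
      using N(1) by (intro emeasure_Un_null_set) auto
    also have "\<dots> < \<infinity>" using emeasure_bounded_finite[of "cball (0::real^'n) R"] by simp
    finally show ?thesis .
  qed
  then show ?thesis using V by (simp add: V_d_def)
qed

text \<open>The error p - q of the best fit is a nonzero polynomial, since p has degree above k and
  q does not. Its integral over the unit ball is thus positive, and \<kappa> is this integral with
  the normalising factors of the seminorm, or 1 if that value were infinite.\<close>

lemma campanato_seminorm_lower_bound:
  fixes i :: "'n::finite"
  assumes \<phi>: "\<And>r. r > 0 \<Longrightarrow> \<phi> r > 0" and p: "degree p > k"
  obtains \<kappa> where "\<kappa> > 0"
    "\<And>M u. M \<ge> 0 \<Longrightarrow> test_function u \<Longrightarrow> (\<And>x. x \<in> ball 0 1 \<Longrightarrow> u x = M * coordinate_poly i p x) \<Longrightarrow>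
      ennreal (\<kappa> * M) \<le> campanato_seminorm k \<phi> (u :: real^'n \<Rightarrow> real)"
proof -
  obtain q where q: "degree q \<le> k"
    "\<And>h. h \<le> k \<Longrightarrow> (LINT x:ball 0 1|lebesgue. coordinate_poly i ((pderiv ^^ h) (p - q)) (x::real^'n)) = 0"
    using coordinate_poly_best_fit[of k i p] by blast
  let ?B = "ball (0::real^'n) 1"
  define m where "m = measure lebesgue ?B"
  have m: "m > 0" using measure_unit_ball_pos m_def by metis
  define a where "a = 1 / (\<phi> (m powr (1 / real CARD('n))) * m powr (real k / real CARD('n)))"
  have a: "a > 0" using m \<phi>[of "m powr (1 / real CARD('n))"] by (simp add: a_def)
  define F where "F = (\<lambda>x::real^'n. ennreal \<bar>coordinate_poly i (p - q) x\<bar> * indicator ?B x)"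
  have cont: "continuous_on UNIV (coordinate_poly i (p - q) :: real^'n \<Rightarrow> real)"
    using smooth_fun_continuous[OF smooth_fun_coordinate_poly, of _ "[]"] by simp
  have "(\<lambda>x::real^'n. coordinate_poly i (p - q) x) \<in> borel_measurable lborel"
    using borel_measurable_continuous_onI[OF cont] by simp
  then have [measurable]: "coordinate_poly i (p - q) \<in> borel_measurable (lebesgue :: (real^'n) measure)"
    by (rule measurable_completion)
  have measF: "F \<in> borel_measurable lebesgue"
    unfolding F_def by (intro borel_measurable_times_ennreal borel_measurable_indicator) simp_all
  have pos: "(\<integral>\<^sup>+x. F x \<partial>lebesgue) \<noteq> 0"
  proof
    assume "(\<integral>\<^sup>+x. F x \<partial>lebesgue) = 0"
    then have "AE x in lebesgue. F x = 0" using measF by (simp add: nn_integral_0_iff_AE)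
    then have "{x. F x \<noteq> 0} \<in> null_sets lebesgue"
      by (simp add: AE_iff_null_sets[symmetric] completion.AE_iff_null_sets) 
    moreover have eq: "{x. F x \<noteq> 0} = {x \<in> ?B. coordinate_poly i (p - q) x \<noteq> 0}"
      by (auto simp: F_def indicator_def)
    moreover have "open {x \<in> ?B. coordinate_poly i (p - q) x \<noteq> 0}"
    proof -
      have "open (?B \<inter> coordinate_poly i (p - q) -` (- {0}))"
        using cont by (intro open_Int open_vimage) auto
      then show ?thesis by (simp add: vimage_def Int_def)
    qed
    ultimately have empty: "{x \<in> ?B. coordinate_poly i (p - q) x \<noteq> 0} = {}"
      using open_not_negligible negligible_iff_null_sets by metis
    \<comment> \<open>The part of the open ball where the error does not vanish is open and null,
      hence empty. Restriction to the axis of coordinate i gives infinitely many roots of p -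
      q.\<close>
    have "poly (p - q) t = 0" if "t \<in> {0<..<1}" for t
    proof -
      have "axis i t = t *\<^sub>R (axis i 1 :: real^'n)" by (simp add: axis_def vec_eq_iff)
      then have "axis i t \<in> ?B" using that by (simp add: norm_axis_1)
      then show ?thesis using empty by (auto simp: coordinate_poly_def axis_def)
    qed
    then have "{0<..<1} \<subseteq> {t. poly (p - q) t = 0}" by blast
    moreover have "p - q \<noteq> 0" using p q(1) by auto
    ultimately have "finite {0<..<1::real}" using poly_roots_finite finite_subset by blast
    then show False using infinite_Ioo[of 0 "1::real"] by simp
  qed
  define T where "T = ennreal a * ennreal (1 / m) * (\<integral>\<^sup>+x. F x \<partial>lebesgue)"
  have "T \<noteq> 0" using a m pos by (simp add: T_def)
  obtain \<kappa> where \<kappa>: "\<kappa> > 0" "ennreal \<kappa> \<le> T"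
  proof (cases T)
    case (real t)
    then show ?thesis using that[of t] \<open>T \<noteq> 0\<close> by (auto simp: less_le)
  next
    case top
    then show ?thesis using that[of 1] by simp
  qed
  show ?thesis
  proof (rule that[OF \<kappa>(1)])
    fix M :: real and u :: "real^'n \<Rightarrow> real"
    assume M: "M \<ge> 0" and u: "test_function u" and eq: "\<And>x. x \<in> ?B \<Longrightarrow> u x = M * coordinate_poly i p x"
    have cp: "campanato_poly k ?B u = (\<lambda>x. M * coordinate_poly i q x)"
      by (rule campanato_poly_test_function[OF u eq q])
    have "(\<integral>\<^sup>+x\<in>?B. ennreal \<bar>u x - campanato_poly k ?B u x\<bar> \<partial>lebesgue) = (\<integral>\<^sup>+x. ennreal M * F x \<partial>lebesgue)"
    proof (rule nn_integral_cong)
      fix x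
      have "\<bar>u x - campanato_poly k ?B u x\<bar> = M * \<bar>coordinate_poly i (p - q) x\<bar>" if "x \<in> ?B"
        using that M eq by (simp add: cp coordinate_poly_def abs_mult flip: right_diff_distrib)
      then show "ennreal \<bar>u x - campanato_poly k ?B u x\<bar> * indicator ?B x = ennreal M * F x"
        using M by (auto simp: F_def indicator_def ennreal_mult)
    qed
    also have "\<dots> = ennreal M * (\<integral>\<^sup>+x. F x \<partial>lebesgue)" using measF by (rule nn_integral_cmult)
    finally have I: "(\<integral>\<^sup>+x\<in>?B. ennreal \<bar>u x - campanato_poly k ?B u x\<bar> \<partial>lebesgue) =
      ennreal M * (\<integral>\<^sup>+x. F x \<partial>lebesgue)" .
    have "ennreal (\<kappa> * M) = ennreal \<kappa> * ennreal M" using \<kappa> M by (simp add: ennreal_mult)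
    also have "\<dots> \<le> T * ennreal M" using \<kappa>(2) by (rule mult_right_mono) simp
    also have "\<dots> = ennreal a * ennreal (1 / m) * (\<integral>\<^sup>+x\<in>?B. ennreal \<bar>u x - campanato_poly k ?B u x\<bar> \<partial>lebesgue)"
      unfolding T_def I by (simp add: mult_ac)
    also have "\<dots> \<le> campanato_seminorm k \<phi> u"
      unfolding campanato_seminorm_def Let_def
    proof (rule SUP_upper2[of ?B])
      show "?B \<in> {ball a r |a r. r > 0}" by (intro CollectI exI[of _ 0] exI[of _ 1]) simp
    qed (simp add: a_def m_def)
    finally show "ennreal (\<kappa> * M) \<le> campanato_seminorm k \<phi> u" .
  qed
qed

text \<open>A product of one-dimensional cutoffs, with the power placed in coordinate i. It vanishes
  once some coordinate has modulus at least 2, as happens outside the ball of radius 2n because the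
  Euclidean norm is at most the sum of the moduli.\<close>

lemma test_profile_exists:
  fixes i :: "'n::finite"
  obtains \<psi> :: "real^'n \<Rightarrow> real" and r where "test_function \<psi>" "r > 0"
    "\<And>x. norm x > r \<Longrightarrow> \<psi> x = 0" "\<And>x. x \<in> ball 0 1 \<Longrightarrow> \<psi> x = x $ i ^ Suc k"
proof -
  obtain \<eta> where \<eta>: "smooth_real \<eta>" "\<And>t. \<bar>t\<bar> \<le> 1 \<Longrightarrow> \<eta> t = 1" "\<And>t. \<bar>t\<bar> \<ge> 2 \<Longrightarrow> \<eta> t = 0"
    by (rule smooth_cutoff_exists) blast
  define f where "f j t = (if j = i then t ^ Suc k * \<eta> t else \<eta> t)" for j t
  define \<psi> where "\<psi> x = (\<Prod>j\<in>UNIV. f j (x $ j))" for x :: "real^'n"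
  have smf: "smooth_real (f j)" for j
    unfolding f_def using \<eta>(1) smooth_real_mult[OF smooth_real_power \<eta>(1)] by (cases "j = i") (simp_all del: power_Suc)
  then have sm: "smooth_fun \<psi>" unfolding \<psi>_def by (rule smooth_fun_product)
  have z: "\<psi> x = 0" if "norm x > 2 * real CARD('n)" for x
  proof -
    have "\<exists>j. \<bar>x $ j\<bar> \<ge> 2"
    proof (rule ccontr)
      assume "\<not> ?thesis"
      then have "(\<Sum>j\<in>UNIV. \<bar>x $ j\<bar>) \<le> (\<Sum>j\<in>(UNIV :: 'n set). 2)"
        by (intro sum_mono) (simp add: not_le less_imp_le)
      then show False using norm_le_l1_cart[of x] that by simp
    qed
    then obtain j where "\<bar>x $ j\<bar> \<ge> 2" by blast
    then have "\<eta> (x $ j) = 0" by (rule \<eta>(3))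
    then have "f j (x $ j) = 0" unfolding f_def by (simp only: mult_zero_right if_cancel)
    then show ?thesis unfolding \<psi>_def by (intro prod_zero bexI[of _ j]) auto
  qed
  have eq: "\<psi> x = x $ i ^ Suc k" if "x \<in> ball 0 1" for x
  proof -
    have "\<bar>x $ j\<bar> \<le> 1" for j using component_le_norm_cart[of x j] that by simp
    then have "f j (x $ j) = (if j = i then x $ i ^ Suc k else 1)" for j
      using \<eta>(2) by (simp add: f_def)
    then show ?thesis by (simp add: \<psi>_def)
  qed
  show ?thesis
    by (rule that[of \<psi> "2 * real CARD('n)"]) (use test_functionI[OF sm z] z eq in auto)
qed

theorem theorem5p1:
  fixes A :: "real \<Rightarrow> ennreal" and \<phi> :: "real \<Rightarrow> real" and s :: real and k :: nat
  assumes "s > 1" and "s \<notin> \<nat>"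
    and "young_function A"
    and "admissible \<phi>"
    and "k \<in> {0..nat \<lfloor>s\<rfloor> - 1}"
    and "continuous_embedding
           (V_d (k + 1) s A :: (real^'n::finite \<Rightarrow> real) set) (V_seminorm s A)
           (campanato k \<phi>) (campanato_seminorm k \<phi>)"
  shows "s \<in> {1<..<real CARD('n) + real k + 1} \<and>
         converges_near_0 (\<lambda>t. ennreal_powr (ennreal t / A t)
           ((s - (real k + 1)) / (real CARD('n) - (s - (real k + 1)))))"
proof (rule ccontr)
  assume neg: "\<not> ?thesis"
  define \<beta> where "\<beta> = s - (real k + 1)"
  define m where "m = nat \<lfloor>s\<rfloor>"
  define \<sigma> where "\<sigma> = frac s"
  have s: "s = real m + \<sigma>" using assms(1) by (simp add: m_def \<sigma>_def frac_def)
  have "s \<notin> \<int>" using assms(1,2) by (auto simp: Nats_altdef1 Ints_def)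
  then have \<sigma>: "0 < \<sigma>" "\<sigma> < 1" by (auto simp: \<sigma>_def frac_lt_1 frac_gt_0_iff)
  have "m \<ge> 1" using assms(1) by (simp add: m_def le_nat_iff)
  then have km: "k + 1 \<le> m" using assms(5) by (auto simp: m_def)
  have \<beta>: "\<beta> = real m - real (k + 1) + \<sigma>" "\<beta> > 0" using km \<sigma> s by (auto simp: \<beta>_def)
  have capacity: "\<exists>N b. (\<forall>l. 0 \<le> b l) \<and> (\<Sum>l<N. ennreal (2 ^ (l * CARD('n))) * A (b l)) \<le> 1 \<and>
      M \<le> (\<Sum>l<N. 2 powr (real l * \<beta>) * b l)" if "M > 0" for M
  \<comment> \<open>\<open>\<beta> < n\<close> is the condition \<open>s < n + k + 1\<close>, under
    which the negated conclusion can only mean divergence of the integral.\<close>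
  proof (cases "\<beta> < real CARD('n)")
    case True
    then have div: "\<not> converges_near_0 (\<lambda>t. ennreal_powr (ennreal t / A t) (\<beta> / (real CARD('n) - \<beta>)))"
      using neg assms(1) by (simp add: \<beta>_def)
    show ?thesis
      by (rule young_function_capacity_subcritical[OF assms(3) \<beta>(2) True that div]) blast
  next
    case False
    have "\<beta> \<noteq> real CARD('n)"
    proof
      assume "\<beta> = real CARD('n)"
      then have "s = real (CARD('n) + k + 1)" by (simp add: \<beta>_def)
      then show False using assms(2) by (metis of_nat_in_Nats)
    qed
    then have "real CARD('n) < \<beta>" using False by simp
    then show ?thesis
      by (rule young_function_capacity_supercritical[OF assms(3) _ that]) blast
  qed
  obtain i :: 'n where True by blast
  let ?p = "monom 1 (Suc k) :: real poly"
  obtain \<psi> :: "real^'n \<Rightarrow> real" and r where \<psi>: "test_function \<psi>" and r: "r > 0"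
    "\<And>x. norm x > r \<Longrightarrow> \<psi> x = 0" and \<psi>_eq: "\<And>x. x \<in> ball 0 1 \<Longrightarrow> \<psi> x = x $ i ^ Suc k"
    by (rule test_profile_exists[of i k]) blast
  have sm: "smooth_fun \<psi>" using \<psi> by (rule test_functionE) blast
  let ?I = "{w :: 'n list. length w = m}"
  have finI: "finite ?I" using finite_lists_length_eq[of "UNIV :: 'n set" m] by simp
  have "\<exists>K>0. \<forall>x y. \<bar>partials (rev w) \<psi> x - partials (rev w) \<psi> y\<bar> \<le> K * min (dist x y) 1" for w
    by (rule test_function_lipschitz[OF test_function_partials[OF \<psi>, of "rev w"]]) blast
  then obtain Kw where Kw: "\<And>w. Kw w > 0"
    "\<And>w x y. \<bar>partials (rev w) \<psi> x - partials (rev w) \<psi> y\<bar> \<le> Kw w * min (dist x y) 1" by metis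
  define K where "K = sum Kw ?I + 1"
  have K: "K > 0" unfolding K_def by (intro add_nonneg_pos sum_nonneg) (auto simp: Kw less_imp_le)
  have lip: "\<bar>partials (rev w) \<psi> x - partials (rev w) \<psi> y\<bar> \<le> K * min (dist x y) 1" if "w \<in> ?I" for w x y
  proof -
    have "Kw w \<le> K" unfolding K_def
      using member_le_sum[OF that _ finI, of Kw] Kw(1) by (simp add: less_imp_le)
    then have "Kw w * min (dist x y) 1 \<le> K * min (dist x y) 1" by (rule mult_right_mono) simp
    with Kw(2)[of w x y] show ?thesis by (rule order_trans)
  qed
  have supp: "partials (rev w) \<psi> x = 0" if "norm x > r" for w x
    using r(2) that by (rule partials_eq_0)
  obtain C D where CD: "C > 0" "D > 0" and J_le: "\<And>b N. (\<And>l. 0 \<le> b l) \<Longrightarrow>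
      J \<sigma> A ?I (\<lambda>w x. \<Sum>l<N. b l * 2 powr (real l * \<sigma>) * partials (rev w) \<psi> ((1 / 2 ^ l) *\<^sub>R x))
        \<le> ennreal D * (\<Sum>l<N. ennreal (2 ^ (l * CARD('n))) * A (C * b l))"
    by (rule J_dyadic_superposition[of \<sigma> ?I K r "\<lambda>w. partials (rev w) \<psi>", OF \<sigma> finI K r(1) lip supp])
      (use assms(3) in blast)+
  obtain \<kappa> where \<kappa>: "\<kappa> > 0"
    "\<And>M u. M \<ge> 0 \<Longrightarrow> test_function u \<Longrightarrow> (\<And>x. x \<in> ball 0 1 \<Longrightarrow> u x = M * coordinate_poly i ?p x) \<Longrightarrow>
      ennreal (\<kappa> * M) \<le> campanato_seminorm k \<phi> u"
    using campanato_seminorm_lower_bound[of \<phi> k ?p i] assms(4)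
    by (auto simp: admissible_def degree_monom_eq)
  obtain c where c: "\<And>u. u \<in> (V_d (k + 1) s A :: (real^'n \<Rightarrow> real) set) \<Longrightarrow>
      campanato_seminorm k \<phi> u \<le> ennreal c * V_seminorm s A u"
    using assms(6) unfolding continuous_embedding_def by blast
  \<comment> \<open>C is the factor left inside A by Jensen's inequality, D the one in front of the
    modular bound. Division by E cancels C and, by convexity, gains \<open>1 / max 1 D\<close>
    against D; the maximum keeps this convexity factor at most 1.\<close>
  define E where "E = C * max 1 D"
  have E: "E > 0" using CD by (simp add: E_def)
  \<comment> \<open>Makes \<open>\<kappa> * M\<close> exceed the embedding constant; the modulus
    also covers a negative c, for which \<open>ennreal c\<close> is 0.\<close>
  define M where "M = (\<bar>c\<bar> + 1) / \<kappa>"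
  have M: "M > 0" using \<kappa>(1) by (simp add: M_def)
  \<comment> \<open>The target is multiplied by E in advance, since the amplitudes are divided by E
    afterwards.\<close>
  obtain N b where b: "\<And>l. 0 \<le> b l" "(\<Sum>l<N. ennreal (2 ^ (l * CARD('n))) * A (b l)) \<le> 1"
    "E * M \<le> (\<Sum>l<N. 2 powr (real l * \<beta>) * b l)"
    using capacity[of "E * M"] E M by auto
  define b' where "b' l = b l / E" for l
  define a where "a l = 2 powr (real l * \<beta>) * b' l" for l
  have b': "0 \<le> b' l" for l using b(1) E by (simp add: b'_def)
  have a0: "0 \<le> a l" for l using b' by (simp add: a_def)
  have sum_a: "M \<le> sum a {..<N}"
    using b(3) E by (simp add: a_def b'_def field_simps flip: sum_divide_distrib)
  define u where "u x = (\<Sum>l<N. a l * (2 ^ l) ^ Suc k * \<psi> ((1 / 2 ^ l) *\<^sub>R x))" for x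
  note scale = smooth_fun_scale[OF sm]
  have smu: "smooth_fun u"
    unfolding u_def by (intro smooth_fun_linear_combination(2) scale(2)) auto
  have u_test: "test_function u"
  proof (rule test_functionI[OF smu])
    fix x :: "real^'n" assume x: "norm x > r * 2 ^ N"
    have "\<psi> ((1 / 2 ^ l) *\<^sub>R x) = 0" if "l < N" for l
    proof (rule r(2))
      have "r * 2 ^ l \<le> r * 2 ^ N" using r(1) that by (intro mult_left_mono power_increasing) auto
      then show "r < norm ((1 / 2 ^ l) *\<^sub>R x)" using x by (simp add: field_simps)
    qed
    then show "u x = 0" by (simp add: u_def)
  qed
  have u_partials: "partials (rev w) u x =
      (\<Sum>l<N. b' l * 2 powr (real l * \<sigma>) * partials (rev w) \<psi> ((1 / 2 ^ l) *\<^sub>R x))" if "w \<in> ?I" for w x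
  proof -
    have "partials (rev w) u x =
        (\<Sum>l<N. a l * (2 ^ l) ^ Suc k * ((1 / 2 ^ l) ^ m * partials (rev w) \<psi> ((1 / 2 ^ l) *\<^sub>R x)))"
      using that unfolding u_def[abs_def]
      by (subst smooth_fun_linear_combination(1)) (auto simp: scale)
    also have "\<dots> = (\<Sum>l<N. b' l * 2 powr (real l * \<sigma>) * partials (rev w) \<psi> ((1 / 2 ^ l) *\<^sub>R x))"
    proof (rule sum.cong[OF refl])
      fix l
      \<comment> \<open>Each of the m derivatives of the dilated profile contributes a factor
        \<open>1 / 2 ^ l\<close>. Together with the homogeneity factor and
        \<open>2 powr (l * \<beta>)\<close> the exponents add up to \<open>l * \<sigma>\<close>,
        because \<open>\<beta> = m - (k + 1) + \<sigma>\<close>.\<close>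
      have "(2 ^ l) ^ Suc k * (1 / 2 ^ l) ^ m = 2 powr (real l * (real (k + 1) - real m))"
      proof -
        have "(2 ^ l) ^ j = 2 powr (real l * real j)" for j :: nat
          using powr_realpow[of 2 "l * j"] by (simp add: power_mult)
        then have "(2 ^ l) ^ Suc k * (1 / 2 ^ l) ^ m = 2 powr (real l * real (Suc k)) / 2 powr (real l * real m)"
          unfolding power_one_over by (simp only: times_divide_eq_right mult_1_right)
        then show ?thesis by (simp add: right_diff_distrib powr_diff)
      qed
      then have e: "2 powr (real l * \<beta>) * ((2 ^ l) ^ Suc k * (1 / 2 ^ l) ^ m) = 2 powr (real l * \<sigma>)"
        by (simp add: \<beta>(1) algebra_simps flip: powr_add)
      have "a l * (2 ^ l) ^ Suc k * ((1 / 2 ^ l) ^ m * partials (rev w) \<psi> ((1 / 2 ^ l) *\<^sub>R x)) =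
          b' l * (2 powr (real l * \<beta>) * ((2 ^ l) ^ Suc k * (1 / 2 ^ l) ^ m)) * partials (rev w) \<psi> ((1 / 2 ^ l) *\<^sub>R x)"
        by (simp only: a_def mult_ac)
      then show "a l * (2 ^ l) ^ Suc k * ((1 / 2 ^ l) ^ m * partials (rev w) \<psi> ((1 / 2 ^ l) *\<^sub>R x)) =
          b' l * 2 powr (real l * \<sigma>) * partials (rev w) \<psi> ((1 / 2 ^ l) *\<^sub>R x)"
        unfolding e .
    qed
    finally show ?thesis .
  qed
  have "J \<sigma> A ?I (\<lambda>w. partials (rev w) u) =
      J \<sigma> A ?I (\<lambda>w x. \<Sum>l<N. b' l * 2 powr (real l * \<sigma>) * partials (rev w) \<psi> ((1 / 2 ^ l) *\<^sub>R x))"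
    using finI by (rule J_cong_AE) (simp add: u_partials)
  also have "\<dots> \<le> ennreal D * (\<Sum>l<N. ennreal (2 ^ (l * CARD('n))) * A (C * b' l))"
    using b' by (rule J_le)
  also have "\<dots> \<le> ennreal D * (\<Sum>l<N. ennreal (1 / max 1 D) * (ennreal (2 ^ (l * CARD('n))) * A (b l)))"
  proof (intro mult_left_mono sum_mono)
    fix l
    have "C * b' l = (1 / max 1 D) * b l" using CD by (simp add: b'_def E_def)
    then have "A (C * b' l) \<le> ennreal (1 / max 1 D) * A (b l)"
      using young_function_scale[OF assms(3) b(1), of "1 / max 1 D" l] by simp
    from mult_left_mono[OF this, of "ennreal (2 ^ (l * CARD('n)))"]
    show "ennreal (2 ^ (l * CARD('n))) * A (C * b' l) \<le>
        ennreal (1 / max 1 D) * (ennreal (2 ^ (l * CARD('n))) * A (b l))"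
      by (simp add: mult_ac)
  qed simp
  also have "\<dots> = ennreal (D / max 1 D) * (\<Sum>l<N. ennreal (2 ^ (l * CARD('n))) * A (b l))"
  proof -
    have "ennreal D * ennreal (1 / max 1 D) = ennreal (D / max 1 D)"
      using CD by (subst ennreal_mult[symmetric]) auto
    then show ?thesis unfolding sum_distrib_left[symmetric] by (simp only: mult.assoc[symmetric])
  qed
  also have "\<dots> \<le> 1 * 1"
    using CD b(2) by (intro mult_mono) (auto simp: ennreal_le_1)
  finally have J1: "J \<sigma> A ?I (\<lambda>w. partials (rev w) u) \<le> 1" by simp
  have "V_seminorm s A u \<le> ennreal 1"
    unfolding V_seminorm_test_function[OF u_test] luxemburg_seminorm_def
    using J1 by (intro Inf_lower imageI) (simp add: m_def \<sigma>_def)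
  then have V1: "V_seminorm s A u \<le> 1" by simp
  then have "u \<in> V_d (k + 1) s A"
    using u_test by (intro test_function_in_V_d) (auto simp: le_less_trans)
  then have "campanato_seminorm k \<phi> u \<le> ennreal c * V_seminorm s A u" by (rule c)
  also have "\<dots> \<le> ennreal c * 1" using V1 by (rule mult_left_mono) simp
  finally have upper: "campanato_seminorm k \<phi> u \<le> ennreal c" by simp
  \<comment> \<open>The dilations only shrink the argument, so every profile is evaluated inside the
    unit ball, where it is the pure power and the factors \<open>2 ^ l\<close> cancel.\<close>
  have "u x = sum a {..<N} * coordinate_poly i ?p x" if "x \<in> ball 0 1" for x
  proof -
    have "(2 ^ l) ^ Suc k * \<psi> ((1 / 2 ^ l) *\<^sub>R x) = x $ i ^ Suc k" for l
    proof -
      have "norm ((1 / 2 ^ l) *\<^sub>R x) \<le> norm x" 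
        using mult_left_mono[of 1 "2 ^ l" "norm x"] by (simp add: divide_le_eq)
      then have "(1 / 2 ^ l) *\<^sub>R x \<in> ball 0 1"
        using that unfolding mem_ball_0 by (rule le_less_trans)
      then have "\<psi> ((1 / 2 ^ l) *\<^sub>R x) = ((1 / 2 ^ l) * x $ i) ^ Suc k" using \<psi>_eq by simp
      then show ?thesis by (simp add: power_mult_distrib[symmetric] del: power_Suc)
    qed
    then show ?thesis
      by (simp add: u_def mult.assoc sum_distrib_right coordinate_poly_def poly_monom del: power_Suc)
  qed
  then have "ennreal (\<kappa> * sum a {..<N}) \<le> campanato_seminorm k \<phi> u"
    using a0 u_test by (intro \<kappa>(2) sum_nonneg) auto
  with upper have "ennreal (\<kappa> * sum a {..<N}) \<le> ennreal c" by (rule order_trans[rotated])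
  moreover have "\<bar>c\<bar> + 1 \<le> \<kappa> * sum a {..<N}"
    using mult_left_mono[OF sum_a, of \<kappa>] \<kappa>(1) by (simp add: M_def)
  ultimately show False using \<kappa>(1) by (auto simp: ennreal_le_iff2)
qed

end
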